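(* Let $W:\mathbb{R}\to\mathbb{R}$ be a double-well potential such that: (1) $W$ is continuous; (2) $W\ge 0$ and $W(z)=0$ if and only if $z=\pm1$; (3) $\liminf_{z\to\pm\infty}W(z)>0$. For $\varepsilon\in(0,1)$ let $s_\varepsilon\in(0,1)$ be such that $\lim_{\varepsilon\to0}s_\varepsilon=\frac12$. Then the family of functionals $$F_\varepsilon(u)=\begin{cases}\dfrac{\lambda_+(\varepsilon)}{\varepsilon}\displaystyle\int_{(0,1)}W(u)\,dt+\lambda_+(\varepsilon)\,\varepsilon^{2s_\varepsilon-1}[u]_{s_\varepsilon}^2 & \text{if } s_\varepsilon>\frac12,\\[2mm] \dfrac{1}{|\log\varepsilon|\,\varepsilon}\displaystyle\int_{(0,1)}W(u)\,dt+\dfrac{1}{|\log\varepsilon|}[u]_{s_\varepsilon}^2 & \text{if } s_\varepsilon=\frac12,\\[2mm] \dfrac{\lambda_-(\varepsilon)}{\varepsilon}\displaystyle\int_{(0,1)}W(u)\,dt+\lambda_-(\varepsilon)[u]_{s_\varepsilon}^2 & \text{if } s_\varepsilon<\frac12,\end{cases}$$ where $$\lambda_+(\varepsilon)=\frac{1-2s_\varepsilon}{\varepsilon^{2s_\varepsilon-1}-1},\qquad \lambda_-(\varepsilon)=\frac{2s_\varepsilon-1}{\varepsilon^{\frac{1-2s_\varepsilon}{2s_\varepsilon}}-1},$$ $\Gamma$-converges as $\varepsilon\to0^+$, with respect to convergence in measure on $(0,1)$, to the functional $$F_0(u)=\begin{cases} m_{\frac12}\,\#S(u) & \text{if } u\in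 BV((0,1),\{-1,1\}),\\ +\infty & \text{otherwise,}\end{cases}$$ with $m_{\frac12}=8$.
   Context: For $s\in(0,1)$ and a measurable $v:(0,1)\to\mathbb{R}$, the squared Gagliardo seminorm is $$[v]_s^2=\iint_{(0,1)\times(0,1)}\frac{|v(x)-v(y)|^2}{|x-y|^{1+2s}}\,dx\,dy\in[0,+\infty],$$ which is finite exactly when $v\in H^s(0,1)$. The functionals are defined on (a.e. equivalence classes of) real-valued measurable functions on $(0,1)$ with values in $[0,+\infty]$. $BV((0,1),\{-1,1\})$ is the set of functions of bounded variation on $(0,1)$ taking only the values $-1$ and $1$ a.e. (i.e. piecewise constant with finitely many jumps); $S(u)$ is the set of jump points of $u$ and $\#S(u)$ its cardinality. $\Gamma$-convergence of $F_\varepsilon$ to $F_0$ as $\varepsilon\to0^+$ with respect to convergence in measure means: for every $\varepsilon_j\to0^+$ and every $u$, (i) $\liminf_j F_{\varepsilon_j}(u_j)\ge F_0(u)$ whenever $u_j\to u$ in measure; (ii) there exist $u_j\to u$ in measure with $\limsup_j F_{\varepsilon_j}(u_j)\le F_0(u)$. *)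

theory Defs
  imports "HOL-Analysis.Analysis"
begin

section \<open>Convergence notions\<close>

definition tendsto_in_measure ::
    "'a measure \<Rightarrow> (nat \<Rightarrow> 'a \<Rightarrow> real) \<Rightarrow> ('a \<Rightarrow> real) \<Rightarrow> bool" where
  "tendsto_in_measure M U u \<longleftrightarrow>
     (\<forall>\<delta>>0. (\<lambda>j. emeasure M {x \<in> space M. \<bar>U j x - u x\<bar> > \<delta>}) \<longlonglongrightarrow> 0)"

(* X is the class of admissible functions and conv U u is the mode of convergence of a
   sequence U in X to u in X. *)
definition Gamma_converges ::
    "'f set \<Rightarrow> ((nat \<Rightarrow> 'f) \<Rightarrow> 'f \<Rightarrow> bool) \<Rightarrow> (real \<Rightarrow> 'f \<Rightarrow> ennreal) \<Rightarrow> ('f \<Rightarrow> ennreal) \<Rightarrow> bool" where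
  "Gamma_converges X conv F F0 \<longleftrightarrow>
     (\<forall>\<epsilon>::nat \<Rightarrow> real. filterlim \<epsilon> (at_right 0) sequentially \<longrightarrow>
       (\<forall>u\<in>X.
          (\<forall>U. (\<forall>j. U j \<in> X) \<and> conv U u \<longrightarrow> F0 u \<le> liminf (\<lambda>j. F (\<epsilon> j) (U j))) \<and>
          (\<exists>U. (\<forall>j. U j \<in> X) \<and> conv U u \<and> limsup (\<lambda>j. F (\<epsilon> j) (U j)) \<le> F0 u)))"


section \<open>Functions on the unit interval\<close>

(* A class of a.e. equal functions on (0,1) is represented by any total function that is
   Lebesgue measurable on (0,1); values outside (0,1) are never used, and every notion
   below is invariant under a.e. modification. *)

abbreviation unit_leb :: "real measure" where
  "unit_leb \<equiv> lebesgue_on {0<..<1}"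

abbreviation meas_funs :: "(real \<Rightarrow> real) set" where
  "meas_funs \<equiv> borel_measurable unit_leb"

(* The integrand is 0 on the (null) diagonal, by division by zero. *)
definition gagliardo_sq :: "real \<Rightarrow> (real \<Rightarrow> real) \<Rightarrow> ennreal" where
  "gagliardo_sq s v =
     (\<integral>\<^sup>+p\<in>{0<..<1} \<times> {0<..<1}.
        ennreal (\<bar>v (fst p) - v (snd p)\<bar>\<^sup>2 / \<bar>fst p - snd p\<bar> powr (1 + 2 * s)) \<partial>lebesgue)"

definition bounded_variation_on :: "(real \<Rightarrow> real) \<Rightarrow> real set \<Rightarrow> bool" where
  "bounded_variation_on v I \<longleftrightarrow>
     (\<exists>B. \<forall>n (x :: nat \<Rightarrow> real).
        (\<forall>i\<le>n. x i \<in> I) \<and> (\<forall>i<n. x i \<le> x (Suc i)) \<longrightarrow>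
        (\<Sum>i<n. \<bar>v (x (Suc i)) - v (x i)\<bar>) \<le> B)"

(* Bounded variation of an a.e. class: some representative has bounded pointwise variation. *)
definition BV_pm1 :: "(real \<Rightarrow> real) set" where
  "BV_pm1 = {u \<in> meas_funs.
      (AE t in unit_leb. u t \<in> {-1, 1}) \<and>
      (\<exists>v. (AE t in unit_leb. v t = u t) \<and> bounded_variation_on v {0<..<1})}"

(* Limits up to null sets, so that the jump set depends only on the a.e. class. *)
definition has_ess_limit_right :: "(real \<Rightarrow> real) \<Rightarrow> real \<Rightarrow> real \<Rightarrow> bool" where
  "has_ess_limit_right u l t \<longleftrightarrow>
     (\<forall>e>0. \<exists>d>0. AE y in lebesgue. t < y \<and> y < t + d \<longrightarrow> \<bar>u y - l\<bar> < e)"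

definition has_ess_limit_left :: "(real \<Rightarrow> real) \<Rightarrow> real \<Rightarrow> real \<Rightarrow> bool" where
  "has_ess_limit_left u l t \<longleftrightarrow>
     (\<forall>e>0. \<exists>d>0. AE y in lebesgue. t - d < y \<and> y < t \<longrightarrow> \<bar>u y - l\<bar> < e)"

definition jump_set :: "(real \<Rightarrow> real) \<Rightarrow> real set" where
  "jump_set u = {t \<in> {0<..<1}.
      \<exists>a b. has_ess_limit_left u a t \<and> has_ess_limit_right u b t \<and> a \<noteq> b}"


section \<open>The functionals\<close>

definition double_well :: "(real \<Rightarrow> real) \<Rightarrow> bool" where
  "double_well W \<longleftrightarrow>
     continuous_on UNIV W \<and>
     (\<forall>z. W z \<ge> 0) \<and> (\<forall>z. W z = 0 \<longleftrightarrow> z = 1 \<or> z = -1) \<and>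
     Liminf at_top (\<lambda>z. ereal (W z)) > 0 \<and> Liminf at_bot (\<lambda>z. ereal (W z)) > 0"

definition potential_energy :: "(real \<Rightarrow> real) \<Rightarrow> (real \<Rightarrow> real) \<Rightarrow> ennreal" where
  "potential_energy W u = (\<integral>\<^sup>+t. ennreal (W (u t)) \<partial>unit_leb)"

definition lambda_plus :: "real \<Rightarrow> real \<Rightarrow> real" where
  "lambda_plus s \<epsilon> = (1 - 2 * s) / (\<epsilon> powr (2 * s - 1) - 1)"

definition lambda_minus :: "real \<Rightarrow> real \<Rightarrow> real" where
  "lambda_minus s \<epsilon> = (2 * s - 1) / (\<epsilon> powr ((1 - 2 * s) / (2 * s)) - 1)"

(* All real coefficients below are positive for 0 < \<epsilon> < 1 and 0 < s < 1, so their
   conversion to ennreal truncates nothing. *)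
definition F_eps :: "(real \<Rightarrow> real) \<Rightarrow> (real \<Rightarrow> real) \<Rightarrow> real \<Rightarrow> (real \<Rightarrow> real) \<Rightarrow> ennreal" where
  "F_eps W s \<epsilon> u =
     (if s \<epsilon> > 1/2 then
        ennreal (lambda_plus (s \<epsilon>) \<epsilon> / \<epsilon>) * potential_energy W u
        + ennreal (lambda_plus (s \<epsilon>) \<epsilon> * \<epsilon> powr (2 * s \<epsilon> - 1)) * gagliardo_sq (s \<epsilon>) u
      else if s \<epsilon> = 1/2 then
        ennreal (1 / (\<bar>ln \<epsilon>\<bar> * \<epsilon>)) * potential_energy W u
        + ennreal (1 / \<bar>ln \<epsilon>\<bar>) * gagliardo_sq (s \<epsilon>) u
      else
        ennreal (lambda_minus (s \<epsilon>) \<epsilon> / \<epsilon>) * potential_energy W u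
        + ennreal (lambda_minus (s \<epsilon>) \<epsilon>) * gagliardo_sq (s \<epsilon>) u)"

(* Counting measure rather than card, which would be 0 on an infinite set. *)
definition jump_functional :: "real \<Rightarrow> (real \<Rightarrow> real) \<Rightarrow> ennreal" where
  "jump_functional m u =
     (if u \<in> BV_pm1 then ennreal m * emeasure (count_space UNIV) (jump_set u) else \<infinity>)"

end

theory Submission
  imports Defs "HOL-Real_Asymp.Real_Asymp"
begin

text \<open>Let \<open>\<eta> = \<epsilon>\<close> if \<open>s \<ge> 1/2\<close> and \<open>\<eta> = \<epsilon> powr (1 / (2 * s))\<close> otherwise, and let \<open>K\<close> be the integral
  of \<open>r powr (- 2 * s)\<close> over \<open>[\<eta>, 1]\<close>. All three cases of the functional then equal
  \<open>(\<eta> powr (- 2 * s) * \<integral> W(u) + [u]\<^sup>2) / K\<close>. As \<open>\<eta> \<rightarrow> 0\<close> and \<open>s \<rightarrow> 1/2\<close>, both \<open>K\<close> and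
  \<open>Q = K * \<eta> powr (2 * s - 1)\<close> tend to infinity while \<open>\<eta> * Q\<close> tends to 0. The seminorm is
  \<open>2 * \<integral> \<parallel>u(\<cdot> + h) - u\<parallel>\<^sup>2 * h powr (- 1 - 2 * s)\<close> over \<open>h > 0\<close>, and a function with \<open>N\<close> jumps between
  \<open>-1\<close> and \<open>1\<close> satisfies \<open>\<parallel>u(\<cdot> + h) - u\<parallel>\<^sup>2 = 4 * N * h\<close> for small \<open>h\<close>, which produces the constant 8.

  For the upper bound the jumps are replaced by Lipschitz transitions of width \<open>\<eta>\<close>. For the lower
  bound, a function of bounded energy is close to \<open>\<plusminus>1\<close> outside a set of measure of order
  \<open>\<eta> * Q\<close>, and around every point where the limit essentially takes both values it must switch:
  for \<open>h\<close> well above \<open>\<eta> * Q\<close> the points \<open>x\<close> with \<open>x\<close> and \<open>x + h\<close> in opposite phases have measure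
  at least \<open>(1 - o(1)) * h\<close>. The scales below this threshold carry a negligible part of \<open>K\<close>.\<close>

subsection \<open>The scale weight\<close>

text \<open>No rate links s \<rightarrow> 1/2 to \<epsilon> \<rightarrow> 0:
  \<open>\<eta> powr (2 * s - 1)\<close> may vanish, stay bounded or blow up, and \<open>K\<close>
  need not be comparable to \<open>- ln \<eta>\<close>. Hence every estimate is uniform in
  \<open>s\<close> near 1/2 and is expressed through \<open>K\<close> and \<open>Q\<close> instead
  of through logarithms. The role of \<open>Q\<close> is threefold. The error of the recovery
  sequence, relative to \<open>K\<close>, is of order \<open>1 / Q\<close>. Bounded energy allows
  intermediate values only on a set of measure of order \<open>K * \<eta> powr (2 * s)\<close>,
  which is \<open>\<eta> * Q\<close>. Discarding all scales below a multiple of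
  \<open>\<eta> * Q\<close> loses a fraction of \<open>K\<close> of order \<open>1 / sqrt Q\<close>.
  So \<open>Q\<close> tending to infinity makes the two bounds meet, while \<open>\<eta> * Q\<close>
  tending to 0 leaves room for the scales on which switches are counted. The constant is 8 = 2 * 4:
  each unordered pair of points is counted twice in the double integral, and the squared difference
  between the wells is 4.\<close>

definition scale_weight :: "real \<Rightarrow> real \<Rightarrow> real" where
  "scale_weight s r = (if s = 1/2 then - ln r else (r powr (1 - 2 * s) - 1) / (2 * s - 1))"

text \<open>\<open>scale_weight s\<close> is the antiderivative of
  \<open>- (r powr (- 2 * s))\<close> that vanishes at 1. The branch s = 1/2 is the limit of the
  other one, so the weight has no singularity at the critical exponent.\<close>

lemma scale_weight_has_derivative:
  assumes "0 < r"
  shows "(scale_weight s has_real_derivative - (r powr (- 2 * s))) (at r)"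
proof (cases "s = 1/2")
  case True
  have "((\<lambda>r. - ln r) has_real_derivative - (1 / r)) (at r)"
    using assms by (auto intro!: derivative_eq_intros)
  moreover have "scale_weight s = (\<lambda>r. - ln r)" using True by (simp add: fun_eq_iff scale_weight_def)
  moreover have "r powr (- 2 * s) = 1 / r"
    using assms unfolding True by (simp add: powr_minus_divide)
  ultimately show ?thesis by simp
next
  case False
  have "((\<lambda>r. (r powr (1 - 2 * s) - 1) / (2 * s - 1)) has_real_derivative
      ((1 - 2 * s) * r powr (1 - 2 * s - 1)) / (2 * s - 1)) (at r)"
    using assms False by (auto intro!: derivative_eq_intros)
  moreover have "((1 - 2 * s) * r powr (1 - 2 * s - 1)) / (2 * s - 1) = - (r powr (- 2 * s))"
  proof -
    have "2 * s - 1 \<noteq> 0" using False by auto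
    then show ?thesis by (simp add: field_simps)
  qed
  ultimately show ?thesis
    using False by (simp add: scale_weight_def[abs_def])
qed

lemma scale_weight_1 [simp]: "scale_weight s 1 = 0"
  by (simp add: scale_weight_def)

lemma scale_weight_antimono:
  assumes "0 < a" "a \<le> b"
  shows "scale_weight s b \<le> scale_weight s a"
proof (rule DERIV_nonpos_imp_nonincreasing[OF assms(2)])
  fix x assume "a \<le> x" "x \<le> b"
  then show "\<exists>y. (scale_weight s has_real_derivative y) (at x) \<and> y \<le> 0"
    using scale_weight_has_derivative[of x s] assms by (intro exI conjI) auto
qed

lemma nn_integral_powr_interval:
  assumes "0 < a" "a \<le> b"
  shows "(\<integral>\<^sup>+h\<in>{a..b}. ennreal (h powr (- 2 * s)) \<partial>lborel)
    = ennreal (scale_weight s a - scale_weight s b)"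
proof -
  have "(\<integral>\<^sup>+h. ennreal (h powr (- 2 * s)) * indicator {a..b} h \<partial>lborel)
      = ennreal (- scale_weight s b - - scale_weight s a)"
  proof (rule nn_integral_FTC_Icc)
    fix x assume "x \<in> {a..b}"
    then have "(scale_weight s has_real_derivative - (x powr (- 2 * s))) (at x)"
      using assms by (intro scale_weight_has_derivative) auto
    from DERIV_minus[OF this]
    show "((\<lambda>h. - scale_weight s h) has_real_derivative x powr (- 2 * s)) (at x)" by simp
  qed (use assms in auto)
  then show ?thesis by simp
qed

text \<open>For d > 0 the quotient is at least \<open>L\<close>, but for d < 0 it never exceeds
  \<open>1 / \<bar>d\<bar>\<close>. The bound, which equals
  \<open>1 / (1 / L + \<bar>d\<bar>)\<close>, respects both limits and holds for either
  sign.\<close>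

lemma exp_quotient_ge:
  fixes d L :: real
  assumes "0 < L" "d \<noteq> 0"
  shows "L / (1 + \<bar>d\<bar> * L) \<le> (exp (d * L) - 1) / d"
proof (cases "d > 0")
  case True
  have "1 + d * L \<le> exp (d * L)" by (rule exp_ge_add_one_self)
  then have "L \<le> (exp (d * L) - 1) / d" using True by (simp add: field_simps)
  moreover have "L / (1 + \<bar>d\<bar> * L) \<le> L"
    using divide_left_mono[of 1 "1 + \<bar>d\<bar> * L" L] assms by (simp add: add_pos_pos)
  ultimately show ?thesis by linarith
next
  case False
  define e where "e = - d"
  have e: "e > 0" using False assms e_def by auto
  have p: "1 + e * L > 0" using e assms by (simp add: add_pos_pos)
  have "exp (e * L) \<ge> 1 + e * L" by (rule exp_ge_add_one_self)
  then have "exp (- (e * L)) \<le> 1 / (1 + e * L)"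
    using p by (simp add: exp_minus field_simps)
  then have "(1 - 1 / (1 + e * L)) / e \<le> (1 - exp (- (e * L))) / e"
    using e by (intro divide_right_mono) auto
  moreover have "(1 - 1 / (1 + e * L)) / e = L / (1 + e * L)"
    using p e by (simp add: diff_divide_eq_iff)
  moreover have "(exp (d * L) - 1) / d = (1 - exp (- (e * L))) / e"
    using e by (simp add: e_def field_simps)
  ultimately show ?thesis using e by (simp add: e_def)
qed

lemma scale_weight_exp:
  assumes "0 < r" "s \<noteq> 1/2"
  shows "scale_weight s r = (exp ((2 * s - 1) * - ln r) - 1) / (2 * s - 1)"
  using assms by (simp add: scale_weight_def powr_def algebra_simps)

text \<open>Multiplication by \<open>r powr (2 * s - 1)\<close> replaces \<open>2 * s - 1\<close> by
  its negative in the formula of \<open>scale_weight_exp\<close>. Thus \<open>K\<close> and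
  \<open>Q\<close> are values of one quotient at opposite arguments, and a single sign-independent
  bound makes both large.\<close>

lemma scale_weight_rescaled_exp:
  assumes "0 < r" "s \<noteq> 1/2"
  shows "scale_weight s r * r powr (2 * s - 1) = (exp ((1 - 2 * s) * - ln r) - 1) / (1 - 2 * s)"
proof -
  have "r powr (1 - 2 * s) * r powr (2 * s - 1) = 1"
    using assms by (simp flip: powr_add)
  then have "scale_weight s r * r powr (2 * s - 1) = (1 - r powr (2 * s - 1)) / (2 * s - 1)"
    using assms by (simp add: scale_weight_def algebra_simps)
  also have "\<dots> = (r powr (2 * s - 1) - 1) / (1 - 2 * s)"
  proof -
    have "2 * s - 1 \<noteq> 0" "1 - 2 * s \<noteq> 0" using assms by auto
    then show ?thesis by (simp add: field_simps)
  qed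
  finally show ?thesis using assms by (simp add: powr_def algebra_simps)
qed

lemma scale_weight_ge:
  assumes "0 < r" "r < 1"
  shows "- ln r / (1 + \<bar>2 * s - 1\<bar> * - ln r) \<le> scale_weight s r"
proof (cases "s = 1/2")
  case True
  show ?thesis unfolding True by (simp add: scale_weight_def)
next
  case False
  have "0 < - ln r" using assms by simp
  from exp_quotient_ge[OF this, of "2 * s - 1"] False show ?thesis
    by (simp only: scale_weight_exp[OF assms(1) False])
qed

lemma scale_weight_rescaled_ge:
  assumes "0 < r" "r < 1"
  shows "- ln r / (1 + \<bar>2 * s - 1\<bar> * - ln r) \<le> scale_weight s r * r powr (2 * s - 1)"
proof (cases "s = 1/2")
  case True
  show ?thesis unfolding True using assms by (simp add: scale_weight_def)
next
  case False
  have "0 < - ln r" using assms by simp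
  from exp_quotient_ge[OF this, of "1 - 2 * s"] False show ?thesis
    by (simp only: scale_weight_rescaled_exp[OF assms(1) False]) (auto simp: abs_minus_commute)
qed

text \<open>A crude bound: it only has to make \<open>\<eta> * Q\<close> vanish, for which any power
  of \<open>1 / r\<close> with exponent below 1 is good enough.\<close>

lemma scale_weight_rescaled_le:
  assumes "0 < r" "r < 1" "\<bar>2 * s - 1\<bar> \<le> 1/2"
  shows "scale_weight s r * r powr (2 * s - 1) \<le> - ln r * r powr (- 1/2)"
proof (cases "s = 1/2")
  case True
  have "1 \<le> r powr (- 1/2)" using powr_mono'[of "- 1/2" 0 r] assms by simp
  moreover have "0 < - ln r" using assms by simp
  ultimately have "- ln r * 1 \<le> - ln r * r powr (- 1/2)" by (intro mult_left_mono) auto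
  then show ?thesis unfolding True using assms by (simp add: scale_weight_def)
next
  case False
  define d where "d = 1 - 2 * s"
  define L where "L = - ln r"
  have L: "0 < L" using assms by (simp add: L_def)
  have d: "d \<noteq> 0" "\<bar>d\<bar> \<le> 1/2" using False assms(3) unfolding d_def by linarith+
  have "(exp (d * L) - 1) / d \<le> L * exp (1/2 * L)"
  proof (cases "d > 0")
    case True
    have "1 + - (d * L) \<le> exp (- (d * L))" by (rule exp_ge_add_one_self)
    then have "exp (d * L) * (1 - d * L) \<le> exp (d * L) * exp (- (d * L))" by (intro mult_left_mono) auto
    also have "\<dots> = 1" by (simp flip: exp_add)
    finally have "(exp (d * L) - 1) / d \<le> L * exp (d * L)" using True by (simp add: field_simps)
    also have "\<dots> \<le> L * exp (1/2 * L)" using L d by (intro mult_left_mono) auto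
    finally show ?thesis .
  next
    case n: False
    have "1 + d * L \<le> exp (d * L)" by (rule exp_ge_add_one_self)
    then have "(exp (d * L) - 1) / d \<le> L" using n d by (simp add: field_simps)
    also have "\<dots> \<le> L * exp (1/2 * L)" using L by (simp add: mult_le_cancel_left1)
    finally show ?thesis .
  qed
  moreover have "exp (1/2 * L) = r powr (-1/2)" using assms by (simp add: powr_def L_def)
  ultimately show ?thesis
    by (simp only: scale_weight_rescaled_exp[OF assms(1) False] flip: d_def L_def)
qed

text \<open>On [a, b] the integrand \<open>x powr (- 2 * s)\<close> is at most
  \<open>a powr (1/2 - 2 * s) * x powr (- 1/2)\<close>, because the exponent
  \<open>1/2 - 2 * s\<close> is nonpositive. Integrating the square root singularity gives the
  claim. What matters is the growth like \<open>sqrt (b / a)\<close>, slower than linear and uniform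
  in \<open>s\<close>. Monotonicity of \<open>\<phi>\<close> is this comparison of integrands in
  differentiated form.\<close>

lemma scale_weight_diff_le:
  assumes "1/4 \<le> s" "0 < a" "a \<le> b"
  shows "scale_weight s a - scale_weight s b \<le> 2 * a powr (1 - 2 * s) * sqrt (b / a)"
proof -
  define c where "c = a powr (1/2 - 2 * s)"
  define \<phi> where "\<phi> r = scale_weight s r + 2 * c * r powr (1/2)" for r
  have "\<phi> a \<le> \<phi> b"
  proof (rule DERIV_nonneg_imp_nondecreasing[OF assms(3)])
    fix x assume x: "a \<le> x" "x \<le> b"
    then have x0: "0 < x" using assms by auto
    have "((\<lambda>r. 2 * c * r powr (1/2)) has_real_derivative 2 * c * (1/2 * x powr (1/2 - 1))) (at x)"
      using x0 by (auto intro!: derivative_eq_intros)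
    from DERIV_add[OF scale_weight_has_derivative[OF x0, of s] this]
    have "(\<phi> has_real_derivative - (x powr (- 2 * s)) + 2 * c * (1/2 * x powr (1/2 - 1))) (at x)"
      by (simp add: \<phi>_def[abs_def])
    moreover have "x powr (- 2 * s) \<le> c * x powr (1/2 - 1)"
    proof -
      have "x powr (- 2 * s) = x powr (1/2 - 2 * s) * x powr (1/2 - 1)"
        using x0 by (simp flip: powr_add)
      also have "x powr (1/2 - 2 * s) \<le> c"
        unfolding c_def using assms x by (intro powr_mono2') auto
      finally show ?thesis by (simp add: mult_right_mono)
    qed
    ultimately show "\<exists>y. (\<phi> has_real_derivative y) (at x) \<and> 0 \<le> y"
      by (intro exI conjI) auto
  qed
  moreover have "c * b powr (1/2) = a powr (1 - 2 * s) * sqrt (b / a)"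
  proof -
    have "a powr (- 1/2) = 1 / sqrt a"
      using assms powr_minus_divide[of a "1/2"] by (simp add: powr_half_sqrt)
    then have "a powr (1 - 2 * s) * sqrt (b / a) = a powr (1 - 2 * s) * a powr (- 1/2) * b powr (1/2)"
      using assms by (simp add: powr_half_sqrt real_sqrt_divide)
    also have "a powr (1 - 2 * s) * a powr (- 1/2) = c"
      unfolding c_def using assms by (simp flip: powr_add)
    finally show ?thesis by simp
  qed
  moreover have "0 \<le> c * a powr (1/2)" by (simp add: c_def)
  ultimately show ?thesis by (simp add: \<phi>_def)
qed

section \<open>Asymptotics of the weight along sequences\<close>

lemma eventually_in_unit_interval:
  fixes f :: "'a \<Rightarrow> real"
  assumes "filterlim f (at_right 0) F"
  shows "\<forall>\<^sub>F x in F. 0 < f x \<and> f x < 1"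
proof -
  have "\<forall>\<^sub>F x in at_right (0::real). 0 < x \<and> x < 1"
    by (intro eventually_conj eventually_at_right_less eventually_at_rightI[of 0 1]) auto
  then show ?thesis using assms unfolding filterlim_iff by blast
qed

context
  fixes \<eta> s :: "nat \<Rightarrow> real"
  assumes \<eta>: "filterlim \<eta> (at_right 0) sequentially" and s: "s \<longlonglongrightarrow> 1/2"
begin

lemma eventually_scale:
  "\<forall>\<^sub>F j in sequentially. 0 < \<eta> j \<and> \<eta> j < 1 \<and> \<bar>2 * s j - 1\<bar> \<le> 1/2"
proof -
  have "\<forall>\<^sub>F j in sequentially. 0 < \<eta> j \<and> \<eta> j < 1"
    by (rule eventually_in_unit_interval[OF \<eta>])
  moreover have "\<forall>\<^sub>F j in sequentially. dist (s j) (1/2) < 1/4"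
    by (rule tendstoD[OF s]) simp
  ultimately show ?thesis
  proof eventually_elim
    case (elim j)
    then show ?case unfolding dist_real_def by linarith
  qed
qed

text \<open>The reciprocal is the sum of \<open>inverse (- ln (\<eta> j))\<close> and
  \<open>\<bar>2 * s j - 1\<bar>\<close>. Each summand tends to 0 by itself, so the relative speed
  of the two limits is irrelevant.\<close>

lemma lower_weight_at_top:
  "filterlim (\<lambda>j. - ln (\<eta> j) / (1 + \<bar>2 * s j - 1\<bar> * - ln (\<eta> j))) at_top sequentially"
proof -
  have "filterlim (\<lambda>j. ln (\<eta> j)) at_bot sequentially"
    by (rule filterlim_compose[OF ln_at_0 \<eta>])
  then have L: "filterlim (\<lambda>j. - ln (\<eta> j)) at_top sequentially"
    by (simp add: filterlim_uminus_at_bot)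
  have "(\<lambda>j. inverse (- ln (\<eta> j)) + \<bar>2 * s j - 1\<bar>) \<longlonglongrightarrow> 0 + \<bar>2 * (1/2) - 1\<bar>"
    by (intro tendsto_intros s tendsto_inverse_0_at_top L)
  moreover have pos: "\<forall>\<^sub>F j in sequentially. 0 < inverse (- ln (\<eta> j)) + \<bar>2 * s j - 1\<bar>"
    using eventually_scale
  proof eventually_elim
    case (elim j)
    then have "0 < - ln (\<eta> j)" by simp
    then have "0 < inverse (- ln (\<eta> j))" by (rule positive_imp_inverse_positive)
    then show ?case by linarith
  qed
  ultimately have "filterlim (\<lambda>j. inverse (inverse (- ln (\<eta> j)) + \<bar>2 * s j - 1\<bar>)) at_top sequentially"
    by (intro filterlim_inverse_at_top) simp_all
  moreover have "\<forall>\<^sub>F j in sequentially. inverse (inverse (- ln (\<eta> j)) + \<bar>2 * s j - 1\<bar>)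
      = - ln (\<eta> j) / (1 + \<bar>2 * s j - 1\<bar> * - ln (\<eta> j))"
    using eventually_scale
  proof eventually_elim
    case (elim j)
    define L where "L = - ln (\<eta> j)"
    have "L > 0" using elim by (simp add: L_def)
    then have "inverse (inverse L + \<bar>2 * s j - 1\<bar>) = L / (1 + \<bar>2 * s j - 1\<bar> * L)"
      by (simp add: divide_simps)
    then show ?case by (simp add: L_def)
  qed
  ultimately show ?thesis
    by (rule iffD1[OF filterlim_cong[OF refl refl], rotated])
qed

lemma scale_weight_at_top: "filterlim (\<lambda>j. scale_weight (s j) (\<eta> j)) at_top sequentially"
  by (rule filterlim_at_top_mono[OF lower_weight_at_top])
    (use eventually_scale in \<open>eventually_elim, blast intro: scale_weight_ge\<close>)

lemma scale_weight_rescaled_at_top: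
  "filterlim (\<lambda>j. scale_weight (s j) (\<eta> j) * \<eta> j powr (2 * s j - 1)) at_top sequentially"
  by (rule filterlim_at_top_mono[OF lower_weight_at_top])
    (use eventually_scale in \<open>eventually_elim, blast intro: scale_weight_rescaled_ge\<close>)

lemma scale_weight_times_powr_tendsto_0:
  "(\<lambda>j. scale_weight (s j) (\<eta> j) * \<eta> j powr (2 * s j)) \<longlonglongrightarrow> 0"
proof (rule tendsto_sandwich)
  show "\<forall>\<^sub>F j in sequentially. 0 \<le> scale_weight (s j) (\<eta> j) * \<eta> j powr (2 * s j)"
    using eventually_scale
  proof eventually_elim
    case (elim j)
    then show ?case using scale_weight_antimono[of "\<eta> j" 1 "s j"] by auto
  qed
  show "\<forall>\<^sub>F j in sequentially. scale_weight (s j) (\<eta> j) * \<eta> j powr (2 * s j)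
      \<le> - ln (\<eta> j) * \<eta> j powr (1/2)"
    using eventually_scale
  proof eventually_elim
    case (elim j)
    have "scale_weight (s j) (\<eta> j) * \<eta> j powr (2 * s j)
        = scale_weight (s j) (\<eta> j) * \<eta> j powr (2 * s j - 1) * \<eta> j powr 1"
      using elim by (simp only: mult.assoc flip: powr_add) simp
    also have "\<dots> \<le> - ln (\<eta> j) * \<eta> j powr (-1/2) * \<eta> j powr 1"
      using elim by (intro mult_right_mono scale_weight_rescaled_le) auto
    also have "\<dots> = - ln (\<eta> j) * \<eta> j powr (1/2)"
      using elim by (simp only: mult.assoc flip: powr_add) simp
    finally show ?case .
  qed
  have "((\<lambda>x::real. - ln x * x powr (1/2)) \<longlongrightarrow> 0) (at_right 0)"
    by real_asymp
  then show "(\<lambda>j. - ln (\<eta> j) * \<eta> j powr (1/2)) \<longlonglongrightarrow> 0"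
    by (rule filterlim_compose[OF _ \<eta>])
qed auto

text \<open>Cutting off at a multiple of \<open>scale_weight s \<eta> * \<eta> powr (2 * s)\<close> instead of \<open>\<eta>\<close>
  costs only a negligible fraction of the weight.\<close>

lemma scale_weight_cutoff:
  assumes "0 < c"
  shows "(\<lambda>j. scale_weight (s j) (c * (scale_weight (s j) (\<eta> j) * \<eta> j powr (2 * s j)))
      / scale_weight (s j) (\<eta> j)) \<longlonglongrightarrow> 1"
proof -
  define K where "K j = scale_weight (s j) (\<eta> j)" for j
  define Q where "Q j = K j * \<eta> j powr (2 * s j - 1)" for j
  define G where "G j = c * (K j * \<eta> j powr (2 * s j))" for j
  have Q: "filterlim Q at_top sequentially"
    using scale_weight_rescaled_at_top by (simp add: Q_def[abs_def] K_def)
  have K: "filterlim K at_top sequentially"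
    using scale_weight_at_top by (simp add: K_def[abs_def])
  \<comment> \<open>The condition \<open>1 / c \<le> Q j\<close> says exactly that the new cutoff
    \<open>G j = c * Q j * \<eta> j\<close> is not below \<open>\<eta> j\<close>.\<close>
  have ev: "\<forall>\<^sub>F j in sequentially. 0 < \<eta> j \<and> \<eta> j < 1 \<and> \<bar>2 * s j - 1\<bar> \<le> 1/2 \<and> 1 / c \<le> Q j \<and> 1 \<le> K j"
    using eventually_scale eventually_conj[OF filterlim_at_top[THEN iffD1, OF Q, rule_format, of "1 / c"]
        filterlim_at_top[THEN iffD1, OF K, rule_format, of 1]]
    by eventually_elim auto
  have G: "G j = c * Q j * \<eta> j" if "0 < \<eta> j" for j
  proof -
    have "\<eta> j powr (2 * s j) = \<eta> j powr (2 * s j - 1) * \<eta> j powr 1"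
      unfolding powr_add[symmetric] by simp
    then show ?thesis using that by (simp add: G_def Q_def)
  qed
  \<comment> \<open>With b / a = c * Q and \<open>\<eta> powr (1 - 2 * s) = K / Q\<close>, the
    weight between the two cutoffs is at most \<open>2 * (K / Q) * sqrt (c * Q)\<close>, a fraction
    \<open>2 * sqrt c / sqrt Q\<close> of \<open>K\<close>.\<close>
  have "\<forall>\<^sub>F j in sequentially. 1 - 2 * sqrt c / sqrt (Q j) \<le> scale_weight (s j) (G j) / K j"
    using ev
  proof eventually_elim
    case (elim j)
    have ge: "\<eta> j \<le> G j" using elim assms G[of j] by (simp add: field_simps)
    have Qp: "0 < Q j" using elim assms by (meson less_le_trans zero_less_divide_1_iff)
    have "K j - scale_weight (s j) (G j) \<le> 2 * \<eta> j powr (1 - 2 * s j) * sqrt (G j / \<eta> j)"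
      unfolding K_def using elim ge by (intro scale_weight_diff_le) linarith+
    also have "\<eta> j powr (1 - 2 * s j) = K j / Q j"
    proof -
      have "\<eta> j powr (1 - 2 * s j) * \<eta> j powr (2 * s j - 1) = 1" using elim by (simp flip: powr_add)
      then show ?thesis using Qp elim by (simp add: Q_def field_simps)
    qed
    also have "sqrt (G j / \<eta> j) = sqrt c * sqrt (Q j)" using elim G[of j] by (simp add: real_sqrt_mult)
    also have "2 * (K j / Q j) * (sqrt c * sqrt (Q j)) = K j * (2 * sqrt c * (sqrt (Q j) / Q j))"
      by simp
    also have "sqrt (Q j) / Q j = 1 / sqrt (Q j)" using Qp by (simp add: real_div_sqrt field_simps)
    finally show ?case using elim by (simp add: field_simps)
  qed
  moreover have "\<forall>\<^sub>F j in sequentially. scale_weight (s j) (G j) / K j \<le> 1"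
    using ev
  proof eventually_elim
    case (elim j)
    have ge: "\<eta> j \<le> G j" using elim assms G[of j] by (simp add: field_simps)
    from scale_weight_antimono[OF _ this, of "s j"] elim show ?case by (simp add: K_def)
  qed
  moreover have "(\<lambda>j. 1 - 2 * sqrt c / sqrt (Q j)) \<longlonglongrightarrow> 1"
  proof -
    have "filterlim (\<lambda>j. sqrt (Q j)) at_top sequentially"
      by (rule filterlim_compose[OF sqrt_at_top Q])
    from tendsto_divide_0[OF tendsto_const filterlim_at_top_imp_at_infinity[OF this], of "2 * sqrt c"]
    show ?thesis by (auto intro: tendsto_eq_intros)
  qed
  ultimately have "(\<lambda>j. scale_weight (s j) (G j) / K j) \<longlonglongrightarrow> 1"
    by (rule tendsto_sandwich[OF _ _ _ tendsto_const])
  then show ?thesis by (simp add: G_def K_def)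
qed

end

subsection \<open>Unified form of the functionals and slicing of the seminorm\<close>

text \<open>The scale is fixed by requiring that the coefficient of the potential divided by that of
  the seminorm be \<open>\<eta> powr (- 2 * s)\<close>. This ratio is
  \<open>\<epsilon> powr (- 2 * s)\<close> when s \<ge> 1/2 and \<open>1 / \<epsilon>\<close> when s
  < 1/2.\<close>

definition intrinsic_scale :: "real \<Rightarrow> real \<Rightarrow> real" where
  "intrinsic_scale s \<epsilon> = (if s < 1/2 then \<epsilon> powr (1 / (2 * s)) else \<epsilon>)"

definition scaled_energy :: "(real \<Rightarrow> real) \<Rightarrow> real \<Rightarrow> real \<Rightarrow> (real \<Rightarrow> real) \<Rightarrow> ennreal" where
  "scaled_energy W s \<eta> u =
     ennreal (\<eta> powr (- 2 * s) / scale_weight s \<eta>) * potential_energy W u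
     + ennreal (1 / scale_weight s \<eta>) * gagliardo_sq s u"

lemma F_eps_eq_scaled_energy:
  assumes "0 < \<epsilon>" "\<epsilon> < 1" "0 < s \<epsilon>"
  shows "F_eps W s \<epsilon> u = scaled_energy W (s \<epsilon>) (intrinsic_scale (s \<epsilon>) \<epsilon>) u"
proof -
  consider "s \<epsilon> > 1/2" | "s \<epsilon> = 1/2" | "s \<epsilon> < 1/2" by linarith
  then show ?thesis
  proof cases
    case 1
    define p where "p = \<epsilon> powr (2 * s \<epsilon> - 1)"
    have p: "0 < p" "p < 1"
      using assms 1 by (auto simp: p_def powr01_less_one)
    have q: "\<epsilon> powr (1 - 2 * s \<epsilon>) = 1 / p"
      using assms powr_minus_divide[of \<epsilon> "2 * s \<epsilon> - 1"] by (simp add: p_def)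
    have r: "\<epsilon> powr (- 2 * s \<epsilon>) = 1 / (p * \<epsilon>)"
    proof -
      have "p * \<epsilon> = \<epsilon> powr (2 * s \<epsilon> - 1) * \<epsilon> powr 1" using assms by (simp add: p_def)
      also have "\<dots> = \<epsilon> powr (2 * s \<epsilon>)" unfolding powr_add[symmetric] by simp
      finally show ?thesis using powr_minus_divide[of \<epsilon> "2 * s \<epsilon>"] by simp
    qed
    define d where "d = 2 * s \<epsilon> - 1"
    have d: "d > 0" using 1 by (simp add: d_def)
    have w: "scale_weight (s \<epsilon>) \<epsilon> = (1 / p - 1) / d"
      using 1 q by (simp add: scale_weight_def d_def)
    have l: "lambda_plus (s \<epsilon>) \<epsilon> = - d / (p - 1)" by (simp add: lambda_plus_def p_def d_def)
    have A: "1 / scale_weight (s \<epsilon>) \<epsilon> = lambda_plus (s \<epsilon>) \<epsilon> * p"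
      using p d assms unfolding w l by (simp add: divide_simps) (simp add: algebra_simps)
    have B: "\<epsilon> powr (- 2 * s \<epsilon>) / scale_weight (s \<epsilon>) \<epsilon> = lambda_plus (s \<epsilon>) \<epsilon> / \<epsilon>"
    proof -
      have "\<epsilon> powr (- 2 * s \<epsilon>) / scale_weight (s \<epsilon>) \<epsilon> = 1 / (p * \<epsilon>) * (1 / scale_weight (s \<epsilon>) \<epsilon>)"
        unfolding r by simp
      then show ?thesis unfolding A using p by simp
    qed
    show ?thesis
      using 1 A B by (simp add: F_eps_def scaled_energy_def intrinsic_scale_def p_def)
  next
    case 2
    have "\<bar>ln \<epsilon>\<bar> = - ln \<epsilon>" using assms by simp
    moreover have "\<epsilon> powr - 1 = 1 / \<epsilon>" using assms by (simp add: powr_minus_divide)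
    ultimately show ?thesis
      using 2 by (simp add: F_eps_def scaled_energy_def intrinsic_scale_def scale_weight_def mult.commute)
  next
    case 3
    define \<eta> where "\<eta> = \<epsilon> powr (1 / (2 * s \<epsilon>))"
    define p where "p = \<epsilon> powr ((1 - 2 * s \<epsilon>) / (2 * s \<epsilon>))"
    define d where "d = 1 - 2 * s \<epsilon>"
    have d: "d > 0" using 3 by (simp add: d_def)
    have "\<eta> powr (1 - 2 * s \<epsilon>) = p" by (simp add: \<eta>_def p_def powr_powr)
    then have w: "scale_weight (s \<epsilon>) \<eta> = (p - 1) / (- d)"
      using 3 by (simp add: scale_weight_def d_def)
    have l: "lambda_minus (s \<epsilon>) \<epsilon> = - d / (p - 1)" by (simp add: lambda_minus_def p_def d_def)
    have "\<eta> powr (- 2 * s \<epsilon>) = \<epsilon> powr - 1" using assms by (simp add: \<eta>_def powr_powr)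
    then have r: "\<eta> powr (- 2 * s \<epsilon>) = 1 / \<epsilon>" using assms by (simp add: powr_minus_divide)
    have A: "1 / scale_weight (s \<epsilon>) \<eta> = lambda_minus (s \<epsilon>) \<epsilon>" unfolding w l by simp
    have B: "\<eta> powr (- 2 * s \<epsilon>) / scale_weight (s \<epsilon>) \<eta> = lambda_minus (s \<epsilon>) \<epsilon> / \<epsilon>"
      unfolding r A[symmetric] by simp
    show ?thesis
      using 3 A B by (simp add: F_eps_def scaled_energy_def intrinsic_scale_def \<eta>_def)
  qed
qed

lemma intrinsic_scale_tendsto_0:
  fixes \<epsilon> s :: "nat \<Rightarrow> real"
  assumes "filterlim \<epsilon> (at_right 0) sequentially" "\<forall>\<^sub>F j in sequentially. 0 < s j"
  shows "filterlim (\<lambda>j. intrinsic_scale (s j) (\<epsilon> j)) (at_right 0) sequentially"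
proof -
  have ev: "\<forall>\<^sub>F j in sequentially. 0 < \<epsilon> j \<and> \<epsilon> j < 1"
    by (rule eventually_in_unit_interval[OF assms(1)])
  have bounds: "\<forall>\<^sub>F j in sequentially. 0 < intrinsic_scale (s j) (\<epsilon> j) \<and> intrinsic_scale (s j) (\<epsilon> j) \<le> \<epsilon> j"
    using ev assms(2)
  proof eventually_elim
    case (elim j)
    have "\<epsilon> j powr (1 / (2 * s j)) \<le> \<epsilon> j powr 1" if "s j < 1/2"
      using elim that by (intro powr_mono') (auto simp: field_simps)
    then show ?case using elim by (auto simp: intrinsic_scale_def)
  qed
  have "\<epsilon> \<longlonglongrightarrow> 0" using assms(1) by (simp add: filterlim_at)
  have "(\<lambda>j. intrinsic_scale (s j) (\<epsilon> j)) \<longlonglongrightarrow> 0"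
    by (rule tendsto_sandwich[OF _ _ tendsto_const \<open>\<epsilon> \<longlonglongrightarrow> 0\<close>])
      (use bounds in \<open>auto elim!: eventually_mono\<close>)
  then show ?thesis
    unfolding filterlim_at using bounds by (auto elim!: eventually_mono)
qed

section \<open>Invariance under almost-everywhere modification, and slicing\<close>

lemma AE_unit_leb_iff:
  "(AE t in unit_leb. P t) \<longleftrightarrow> (AE t in lborel. 0 < t \<and> t < 1 \<longrightarrow> P t)"
  by (simp add: AE_restrict_space_iff AE_completion_iff)

lemma AE_lborel_prodI:
  fixes P Q :: "real \<Rightarrow> bool"
  assumes "AE x in lborel. P x"
  shows "AE p in (lborel :: (real \<times> real) measure). P (fst p) \<and> P (snd p)"
proof -
  obtain N where N: "N \<in> null_sets lborel" "{x. \<not> P x} \<subseteq> N"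
    using assms unfolding eventually_ae_filter by auto
  have "N \<times> UNIV \<in> null_sets (lborel \<Otimes>\<^sub>M lborel)" "UNIV \<times> N \<in> null_sets (lborel \<Otimes>\<^sub>M (lborel :: real measure))"
    using N(1) by (auto simp: null_sets_def lborel.emeasure_pair_measure_Times)
  from null_sets.Un[OF this] show ?thesis
    unfolding lborel_prod by (rule AE_I') (use N(2) in auto)
qed

lemma gagliardo_sq_cong_AE:
  assumes "AE t in unit_leb. u t = v t"
  shows "gagliardo_sq s u = gagliardo_sq s v"
  unfolding gagliardo_sq_def nn_integral_completion
proof (rule nn_integral_cong_AE)
  have "AE t in lborel. 0 < t \<and> t < 1 \<longrightarrow> u t = v t"
    using assms by (simp add: AE_unit_leb_iff)
  from AE_lborel_prodI[OF this]
  show "AE p in lborel. ennreal (\<bar>u (fst p) - u (snd p)\<bar>\<^sup>2 / \<bar>fst p - snd p\<bar> powr (1 + 2 * s)) *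
      indicator ({0<..<1} \<times> {0<..<1}) p =
      ennreal (\<bar>v (fst p) - v (snd p)\<bar>\<^sup>2 / \<bar>fst p - snd p\<bar> powr (1 + 2 * s)) *
      indicator ({0<..<1} \<times> {0<..<1}) p"
    by eventually_elim (auto simp: indicator_def)
qed

lemma potential_energy_cong_AE:
  assumes "AE t in unit_leb. u t = v t"
  shows "potential_energy W u = potential_energy W v"
  unfolding potential_energy_def by (rule nn_integral_cong_AE) (use assms in \<open>auto elim!: eventually_mono\<close>)

text \<open>The lower bound is proved for Borel functions, whose level sets, translates and slices
  are measurable for \<open>lborel\<close> and its products. This lemma transfers it to Lebesgue
  measurable functions.\<close>

lemma meas_funs_borel_representative:
  assumes "u \<in> meas_funs"
  obtains v :: "real \<Rightarrow> real" where "v \<in> borel_measurable borel" "AE t in unit_leb. u t = v t"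
proof -
  have "(\<lambda>t. indicator {0<..<1} t *\<^sub>R u t) \<in> borel_measurable lebesgue"
    using assms by (simp add: borel_measurable_restrict_space_iff)
  then obtain v where "v \<in> borel_measurable lborel" "AE t in lborel. indicator {0<..<1} t *\<^sub>R u t = v t"
    using completion_ex_borel_measurable_real by blast
  then have "v \<in> borel_measurable borel" "AE t in unit_leb. u t = v t"
    by (auto simp: AE_unit_leb_iff elim!: eventually_mono)
  then show ?thesis by (rule that)
qed

text \<open>Substitute y = x + h and exchange the integrals. By symmetry the slice integral
  \<open>J\<close> is even in h, so the half-lines h > 0 and h < 0 contribute equally, and h = 0 is
  a null set.\<close>

lemma nn_integral_symmetric_slices:
  fixes g :: "real \<times> real \<Rightarrow> ennreal"
  assumes g [measurable]: "g \<in> borel_measurable borel" and sym: "\<And>x y. g (x, y) = g (y, x)"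
  shows "(\<integral>\<^sup>+p. g p \<partial>lebesgue) = 2 * (\<integral>\<^sup>+h\<in>{0<..}. (\<integral>\<^sup>+x. g (x, x + h) \<partial>lborel) \<partial>lborel)"
proof -
  define J where "J h = (\<integral>\<^sup>+x. g (x, x + h) \<partial>lborel)" for h
  have [measurable]: "J \<in> borel_measurable borel" unfolding J_def by measurable
  have even: "J (- h) = J h" for h
  proof -
    have "J (- h) = (\<integral>\<^sup>+x. g (h + 1 * x, h + 1 * x + (- h)) \<partial>lborel)"
      unfolding J_def by (subst nn_integral_real_affine[where c = 1 and t = h]) auto
    also have "\<dots> = J h" unfolding J_def by (auto intro!: nn_integral_cong simp: sym add.commute)
    finally show ?thesis .
  qed
  have "(\<integral>\<^sup>+p. g p \<partial>lebesgue) = (\<integral>\<^sup>+p. g p \<partial>(lborel \<Otimes>\<^sub>M lborel))"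
    by (simp add: nn_integral_completion lborel_prod)
  also have "\<dots> = (\<integral>\<^sup>+x. \<integral>\<^sup>+y. g (x, y) \<partial>lborel \<partial>lborel)"
    by (rule lborel.nn_integral_fst[symmetric]) (simp add: lborel_prod)
  also have "\<dots> = (\<integral>\<^sup>+x. \<integral>\<^sup>+h. g (x, x + h) \<partial>lborel \<partial>lborel)"
  proof (rule nn_integral_cong)
    fix x :: real
    show "(\<integral>\<^sup>+y. g (x, y) \<partial>lborel) = (\<integral>\<^sup>+h. g (x, x + h) \<partial>lborel)"
      using nn_integral_real_affine[where c = 1 and t = x and f = "\<lambda>y. g (x, y)"] by simp
  qed
  also have "\<dots> = (\<integral>\<^sup>+h. J h \<partial>lborel)"
    unfolding J_def by (rule lborel_pair.Fubini') measurable
  also have "\<dots> = (\<integral>\<^sup>+h. J h * indicator {0<..} h + J h * indicator {..<0} h \<partial>lborel)"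
    by (intro nn_integral_cong_AE eventually_mono[OF AE_lborel_singleton[of 0]]) (auto simp: indicator_def)
  also have "\<dots> = (\<integral>\<^sup>+h\<in>{0<..}. J h \<partial>lborel) + (\<integral>\<^sup>+h\<in>{..<0}. J h \<partial>lborel)"
    by (rule nn_integral_add) auto
  also have "(\<integral>\<^sup>+h\<in>{..<0}. J h \<partial>lborel) = (\<integral>\<^sup>+h. J (0 + - 1 * h) * indicator {..<0} (0 + - 1 * h) \<partial>lborel)"
    by (subst nn_integral_real_affine[where c = "- 1" and t = 0]) auto
  also have "\<dots> = (\<integral>\<^sup>+h\<in>{0<..}. J h \<partial>lborel)"
    by (rule nn_integral_cong) (auto simp: even indicator_def)
  finally show ?thesis by (simp add: J_def mult_2)
qed

subsection \<open>Essential switching points and bounded variation\<close>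

text \<open>For \<open>u\<close> with values in {-1, 1} this is the support in (0,1) of the
  distributional derivative. Unlike the jump set, it refers to no one-sided limits, so it also
  detects oscillation of a function outside \<open>BV_pm1\<close>.\<close>

definition ess_switch_set :: "(real \<Rightarrow> real) \<Rightarrow> real set" where
  "ess_switch_set u = {t \<in> {0<..<1}.
     \<forall>r>0. \<forall>c\<in>{-1, 1}. \<not> (AE x in lborel. x \<in> {t - r<..<t + r} \<longrightarrow> u x = c)}"

definition ess_representative :: "(real \<Rightarrow> real) \<Rightarrow> real \<Rightarrow> real" where
  "ess_representative u t =
     (if \<exists>r>0. AE x in lborel. x \<in> {t - r<..<t + r} \<longrightarrow> u x = 1 then 1 else - 1)"

lemma ess_switch_setD:
  assumes "t \<in> ess_switch_set u" "a < t" "t < b" "c \<in> {-1, 1}"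
  shows "\<not> (AE x in lborel. x \<in> {a<..<b} \<longrightarrow> u x = c)"
proof
  assume *: "AE x in lborel. x \<in> {a<..<b} \<longrightarrow> u x = c"
  define r where "r = min (t - a) (b - t)"
  have "r > 0" using assms by (simp add: r_def)
  moreover have "AE x in lborel. x \<in> {t - r<..<t + r} \<longrightarrow> u x = c"
    using * by eventually_elim (auto simp: r_def)
  ultimately show False using assms(1,4) by (auto simp: ess_switch_set_def)
qed

lemma AE_interval_nonempty:
  fixes a b :: real
  assumes "a < b" "AE x in lborel. x \<in> {a<..<b} \<longrightarrow> P x"
  shows "\<exists>x\<in>{a<..<b}. P x"
proof (rule ccontr)
  assume "\<not> ?thesis"
  then have "AE x in lborel. x \<notin> {a<..<b}" using assms(2) by (auto elim!: eventually_mono)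
  then have "{a<..<b} \<in> null_sets lborel" by (subst AE_iff_null_sets) auto
  then show False using assms(1) by (simp add: null_sets_def)
qed

lemma ess_representative_range: "ess_representative u t \<in> {-1, 1}"
  by (simp add: ess_representative_def)

lemma ess_representative_locally_constant:
  assumes "t \<in> {0<..<1}" "t \<notin> ess_switch_set u"
  shows "\<exists>r>0. \<exists>c\<in>{-1, 1}. (\<forall>x\<in>{t - r<..<t + r}. ess_representative u x = c) \<and>
    (AE x in lborel. x \<in> {t - r<..<t + r} \<longrightarrow> u x = c)"
proof -
  obtain r c where r: "r > 0" "c \<in> {-1, 1}" and ae: "AE x in lborel. x \<in> {t - r<..<t + r} \<longrightarrow> u x = c"
    using assms by (auto simp: ess_switch_set_def)
  have "ess_representative u x = c" if x: "x \<in> {t - r<..<t + r}" for x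
  proof (cases "c = 1")
    case True
    define q where "q = min (x - (t - r)) (t + r - x)"
    have "q > 0" using x by (simp add: q_def)
    moreover have "AE y in lborel. y \<in> {x - q<..<x + q} \<longrightarrow> u y = 1"
      using ae by eventually_elim (auto simp: q_def True)
    ultimately show ?thesis using True by (auto simp: ess_representative_def)
  next
    case False
    have "\<not> (AE y in lborel. y \<in> {x - q<..<x + q} \<longrightarrow> u y = 1)" if "q > 0" for q
    proof
      assume "AE y in lborel. y \<in> {x - q<..<x + q} \<longrightarrow> u y = 1"
      with ae have "AE y in lborel. y \<in> {max (x - q) (t - r)<..<min (x + q) (t + r)} \<longrightarrow> False"
        by eventually_elim (use False in auto)
      from AE_interval_nonempty[OF _ this] show False using x \<open>q > 0\<close> by auto
    qed
    then show ?thesis using False r(2) by (auto simp: ess_representative_def)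
  qed
  with r ae show ?thesis by blast
qed

text \<open>Equality holds a.e. near each point that is not a switching point. Lindelof reduces
  these uncountably many neighbourhoods to countably many, so the exceptional null sets can be
  united.\<close>

lemma ess_representative_AE_eq:
  assumes fin: "finite (ess_switch_set u)"
  shows "AE t in unit_leb. ess_representative u t = u t"
proof -
  define good where "good = {0<..<1} - ess_switch_set u"
  have "\<forall>t\<in>good. \<exists>r>0. AE x in lborel. x \<in> {t - r<..<t + r} \<longrightarrow> ess_representative u x = u x"
  proof
    fix t assume "t \<in> good"
    then obtain r c where "r > 0" and c: "\<forall>x\<in>{t - r<..<t + r}. ess_representative u x = c"
      and ae: "AE x in lborel. x \<in> {t - r<..<t + r} \<longrightarrow> u x = c"
      using ess_representative_locally_constant[of t u] unfolding good_def by blast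
    from ae have "AE x in lborel. x \<in> {t - r<..<t + r} \<longrightarrow> ess_representative u x = u x"
      by eventually_elim (use c in auto)
    with \<open>r > 0\<close> show "\<exists>r>0. AE x in lborel. x \<in> {t - r<..<t + r} \<longrightarrow> ess_representative u x = u x"
      by blast
  qed
  then obtain r where r: "\<And>t. t \<in> good \<Longrightarrow> r t > 0"
    "\<And>t. t \<in> good \<Longrightarrow> AE x in lborel. x \<in> {t - r t<..<t + r t} \<longrightarrow> ess_representative u x = u x"
    by metis
  define \<F> where "\<F> = (\<lambda>t. {t - r t<..<t + r t}) ` good"
  have "\<And>A. A \<in> \<F> \<Longrightarrow> open A" by (auto simp: \<F>_def)
  from Lindelof[OF this] obtain \<F>' where F': "\<F>' \<subseteq> \<F>" "countable \<F>'" "\<Union>\<F>' = \<Union>\<F>" by metis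
  have "AE x in lborel. \<forall>A\<in>\<F>'. x \<in> A \<longrightarrow> ess_representative u x = u x"
    using F' r(2) by (intro AE_ball_countable') (auto simp: \<F>_def)
  moreover have "AE x in lborel. \<forall>t\<in>ess_switch_set u. x \<noteq> t"
    using fin by (intro AE_ball_countable') (auto intro: countable_finite AE_lborel_singleton)
  ultimately have "AE x in lborel. 0 < x \<and> x < 1 \<longrightarrow> ess_representative u x = u x"
  proof eventually_elim
    case (elim x)
    show ?case
    proof
      assume "0 < x \<and> x < 1"
      then have "x \<in> good" using elim by (auto simp: good_def)
      then have "x \<in> \<Union>\<F>" using r(1) by (force simp: \<F>_def)
      then show "ess_representative u x = u x" using elim F' by blast
    qed
  qed
  then show ?thesis by (simp add: AE_unit_leb_iff)
qed

lemma ess_representative_eq_on_interval: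
  assumes "0 < x" "x \<le> y" "y < 1" "{x..y} \<inter> ess_switch_set u = {}"
  shows "ess_representative u x = ess_representative u y"
proof -
  have "ess_representative u constant_on {x..y}"
  proof (rule locally_constant_imp_constant)
    show "connected {x..y}" by simp
    fix t assume t: "t \<in> {x..y}"
    then have "t \<in> {0<..<1}" "t \<notin> ess_switch_set u" using assms by auto
    then obtain r c where "r > 0" and c: "\<forall>x\<in>{t - r<..<t + r}. ess_representative u x = c"
      using ess_representative_locally_constant by blast
    then show "\<exists>T. openin (top_of_set {x..y}) T \<and> t \<in> T \<and> (\<forall>z\<in>T. ess_representative u z = ess_representative u t)"
      using t by (intro exI[of _ "{x..y} \<inter> {t - r<..<t + r}"]) (auto simp: openin_open_Int)
  qed
  then show ?thesis using assms by (auto simp: constant_on_def)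
qed

lemma bounded_variation_ess_representative:
  assumes fin: "finite (ess_switch_set u)"
  shows "bounded_variation_on (ess_representative u) {0<..<1}"
proof -
  define S where "S = ess_switch_set u"
  \<comment> \<open>Each switching point is counted once strictly and once weakly. Then
    \<open>m\<close> grows by at least 1 from x to y > x whenever a switching point lies in the
    closed interval, even at one of its ends.\<close>
  define m where "m t = real (card {s \<in> S. s < t} + card {s \<in> S. s \<le> t})" for t
  have fin: "finite {s \<in> S. P s}" for P using fin by (simp add: S_def)
  have step: "\<bar>ess_representative u y - ess_representative u x\<bar> \<le> 2 * (m y - m x)"
    if "0 < x" "x \<le> y" "y < 1" for x y
  proof -
    have c: "card {s \<in> S. s < x} \<le> card {s \<in> S. s < y}" "card {s \<in> S. s \<le> x} \<le> card {s \<in> S. s \<le> y}"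
      using that by (auto intro!: card_mono fin)
    show ?thesis
    proof (cases "ess_representative u x = ess_representative u y")
      case True
      then show ?thesis using c by (simp add: m_def)
    next
      case False
      then have "{x..y} \<inter> S \<noteq> {}"
        using ess_representative_eq_on_interval[of x y u] \<open>0 < x\<close> \<open>x \<le> y\<close> \<open>y < 1\<close> by (auto simp: S_def)
      then obtain t where t: "t \<in> S" "x \<le> t" "t \<le> y" by auto
      have "x < y" using that False by (cases "x = y") auto
      have "m x + 1 \<le> m y"
      proof (cases "t < y")
        case True
        have "card (insert t {s \<in> S. s < x}) \<le> card {s \<in> S. s < y}"
          using True t by (intro card_mono fin) auto
        then show ?thesis using c t fin by (simp add: m_def)
      next
        case False
        then have "card (insert t {s \<in> S. s \<le> x}) \<le> card {s \<in> S. s \<le> y}"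
          using t \<open>x < y\<close> by (intro card_mono fin) auto
        then show ?thesis using c t fin False \<open>x < y\<close> by (simp add: m_def)
      qed
      moreover have "\<bar>ess_representative u y - ess_representative u x\<bar> \<le> 2"
        using ess_representative_range[of u x] ess_representative_range[of u y] by auto
      ultimately show ?thesis by simp
    qed
  qed
  have m: "0 \<le> m t" "m t \<le> 2 * real (card S)" for t
  proof -
    have "card {s \<in> S. s < t} \<le> card S" "card {s \<in> S. s \<le> t} \<le> card S"
      using fin[of "\<lambda>_. True"] by (auto intro!: card_mono)
    then show "m t \<le> 2 * real (card S)" by (simp add: m_def)
  qed (simp add: m_def)
  show ?thesis
    unfolding bounded_variation_on_def
  proof (intro exI allI impI)
    fix n and x :: "nat \<Rightarrow> real"
    assume x: "(\<forall>i\<le>n. x i \<in> {0<..<1}) \<and> (\<forall>i<n. x i \<le> x (Suc i))"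
    then have "(\<Sum>i<n. \<bar>ess_representative u (x (Suc i)) - ess_representative u (x i)\<bar>)
        \<le> (\<Sum>i<n. 2 * (m (x (Suc i)) - m (x i)))"
      by (intro sum_mono step) auto
    also have "\<dots> = 2 * (m (x n) - m (x 0))"
      unfolding sum_distrib_left[symmetric] sum_lessThan_telescope[of "\<lambda>i. m (x i)"] ..
    also have "\<dots> \<le> 4 * real (card S)" using m[of "x n"] m[of "x 0"] by argo
    finally show "(\<Sum>i<n. \<bar>ess_representative u (x (Suc i)) - ess_representative u (x i)\<bar>) \<le> 4 * real (card S)" .
  qed
qed

lemma ex_between_finite:
  fixes b :: real
  assumes "finite A" "\<forall>a\<in>A. a < b" "0 < b"
  shows "\<exists>y>0. y < b \<and> (\<forall>a\<in>A. a < y)"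
proof -
  define M where "M = Max (insert 0 A)"
  have "M < b" using assms by (simp add: M_def)
  moreover have "0 \<le> M" "\<forall>a\<in>A. a \<le> M" using assms by (auto simp: M_def)
  ultimately show ?thesis by (intro exI[of _ "(M + b) / 2"]) auto
qed

text \<open>Bounded variation concerns pointwise values of a representative \<open>v\<close>,
  switching concerns null sets. The link: if \<open>v\<close> omitted the value c near a switching
  point, \<open>u\<close> would be a.e. equal to -c there.\<close>

lemma ess_switch_set_values:
  assumes pm: "AE t in unit_leb. u t \<in> {-1, 1}" and v: "AE t in unit_leb. v t = u t"
    and t: "t \<in> ess_switch_set u" "a < t" "t < b" and c: "c \<in> {-1, 1}"
  shows "\<exists>x\<in>{a<..<b}. v x = c"
proof (rule ccontr)
  assume n: "\<not> ?thesis"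
  have t01: "0 < t" "t < 1" using t by (auto simp: ess_switch_set_def)
  from pm v have "AE x in lborel. (0 < x \<and> x < 1 \<longrightarrow> u x \<in> {-1, 1}) \<and> (0 < x \<and> x < 1 \<longrightarrow> v x = u x)"
    by (simp add: AE_unit_leb_iff)
  then have "AE x in lborel. x \<in> {max 0 a<..<min 1 b} \<longrightarrow> u x = - c"
    by eventually_elim (use n c in auto)
  moreover have "\<not> (AE x in lborel. x \<in> {max 0 a<..<min 1 b} \<longrightarrow> u x = - c)"
    by (rule ess_switch_setD) (use t t01 c in auto)
  ultimately show False by contradiction
qed

lemma finite_ess_switch_set:
  assumes pm: "AE t in unit_leb. u t \<in> {-1, 1}" and v: "AE t in unit_leb. v t = u t"
    and bv: "bounded_variation_on v {0<..<1}"
  shows "finite (ess_switch_set u)"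
proof (rule ccontr)
  assume inf: "infinite (ess_switch_set u)"
  obtain B where B: "\<And>n x. (\<forall>i\<le>n. x i \<in> {0<..<1}) \<Longrightarrow> (\<forall>i<n. x i \<le> x (Suc i)) \<Longrightarrow>
      (\<Sum>i<n. \<bar>v (x (Suc i)) - v (x i)\<bar>) \<le> B"
    using bv unfolding bounded_variation_on_def by blast
  \<comment> \<open>Each switching point adds 2 to the variation of some partition. The free right
    end z drives the induction: the partition for the smaller points is confined to the left of some
    y below the largest point b, which leaves (y, z) for two points near b.\<close>
  have chain: "\<forall>z. 0 < z \<and> z \<le> 1 \<and> (\<forall>t\<in>T. t < z) \<longrightarrow>
      (\<exists>n x. (\<forall>i\<le>n. x i \<in> {0<..<z}) \<and> (\<forall>i<n. x i \<le> x (Suc i)) \<and>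
        2 * real (card T) \<le> (\<Sum>i<n. \<bar>v (x (Suc i)) - v (x i)\<bar>))"
    if "finite T" "T \<subseteq> ess_switch_set u" for T
    using that
  proof (induction T rule: finite_linorder_max_induct)
    case empty
    show ?case by (intro allI impI exI[of _ 0] exI[of _ "\<lambda>_. z / 2" for z]) auto
  next
    case (insert b A)
    show ?case
    proof (intro allI impI)
      fix z :: real assume z: "0 < z \<and> z \<le> 1 \<and> (\<forall>t\<in>insert b A. t < z)"
      have b: "b \<in> ess_switch_set u" "0 < b" using insert.prems by (auto simp: ess_switch_set_def)
      obtain y where y: "0 < y" "y < b" "\<forall>t\<in>A. t < y"
        using ex_between_finite[OF insert.hyps(1) _ b(2)] insert.hyps by blast
      have sub: "A \<subseteq> ess_switch_set u" using insert.prems by simp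
      have "0 < y \<and> y \<le> 1 \<and> (\<forall>t\<in>A. t < y)" using y z by auto
      from insert.IH[OF sub, THEN spec, THEN mp, OF this] obtain n x where x: "\<forall>i\<le>n. x i \<in> {0<..<y}" "\<forall>i<n. x i \<le> x (Suc i)"
        "2 * real (card A) \<le> (\<Sum>i<n. \<bar>v (x (Suc i)) - v (x i)\<bar>)"
        by (elim exE conjE)
      obtain p where p: "p \<in> {y<..<z}" "v p = 1"
        using ess_switch_set_values[OF pm v b(1) y(2), of z 1] z by auto
      obtain q where q: "q \<in> {y<..<z}" "v q = - 1"
        using ess_switch_set_values[OF pm v b(1) y(2), of z "- 1"] z by auto
      \<comment> \<open>The order of p and q is unknown, but sorting them does not affect the last
        increment, which is 2 in absolute value. The increment that joins the old partition to the
        new pair is only bounded below by 0.\<close>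
      define x' where "x' i = (if i \<le> n then x i else if i = Suc n then min p q else max p q)" for i
      have le: "(\<Sum>i<n. \<bar>v (x' (Suc i)) - v (x' i)\<bar>) = (\<Sum>i<n. \<bar>v (x (Suc i)) - v (x i)\<bar>)"
        by (intro sum.cong) (auto simp: x'_def)
      have two: "\<bar>v (x' (Suc (Suc n))) - v (x' (Suc n))\<bar> = 2"
        using p q by (auto simp: x'_def min_def max_def)
      have "2 * real (card (insert b A)) \<le> (\<Sum>i<Suc (Suc n). \<bar>v (x' (Suc i)) - v (x' i)\<bar>)"
      proof -
        have "b \<notin> A" using insert.hyps by auto
        then have "2 * real (card (insert b A)) = 2 * real (card A) + 2"
          using insert.hyps by simp
        then show ?thesis
          using x(3) two abs_ge_zero[of "v (x' (Suc n)) - v (x' n)"] by (simp add: le)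
      qed
      moreover have "\<forall>i\<le>Suc (Suc n). x' i \<in> {0<..<z}"
        using x(1) p q y z by (auto simp: x'_def min_def max_def)
      moreover have "\<forall>i<Suc (Suc n). x' i \<le> x' (Suc i)"
      proof (intro allI impI)
        fix i assume "i < Suc (Suc n)"
        then consider "i < n" | "i = n" | "i = Suc n" by linarith
        then show "x' i \<le> x' (Suc i)"
        proof cases
          case 1
          then show ?thesis using x(2) by (simp add: x'_def)
        next
          case 2
          have "x n < y" using x(1) by simp
          then show ?thesis using 2 p q by (auto simp: x'_def)
        next
          case 3
          then show ?thesis by (auto simp: x'_def)
        qed
      qed
      ultimately show "\<exists>n x. (\<forall>i\<le>n. x i \<in> {0<..<z}) \<and> (\<forall>i<n. x i \<le> x (Suc i)) \<and>
          2 * real (card (insert b A)) \<le> (\<Sum>i<n. \<bar>v (x (Suc i)) - v (x i)\<bar>)" by blast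
    qed
  qed
  obtain T where T: "finite T" "T \<subseteq> ess_switch_set u" "card T = nat \<lceil>B\<rceil> + 1"
    using infinite_arbitrarily_large[OF inf] by blast
  have "0 < (1::real) \<and> (1::real) \<le> 1 \<and> (\<forall>t\<in>T. t < 1)" using T(2) by (auto simp: ess_switch_set_def)
  from chain[OF T(1,2), THEN spec, THEN mp, OF this] obtain n x where
    x: "\<forall>i\<le>n. x i \<in> {0<..<1}" "\<forall>i<n. x i \<le> x (Suc i)"
    "2 * real (card T) \<le> (\<Sum>i<n. \<bar>v (x (Suc i)) - v (x i)\<bar>)"
    by (elim exE conjE)
  have "2 * real (card T) \<le> B" by (rule order_trans[OF x(3) B[OF x(1,2)]])
  moreover have "B \<le> real (nat \<lceil>B\<rceil>)" by linarith
  ultimately show False using T(3) by simp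
qed

text \<open>Near a point that does not switch, both one-sided limits are forced to equal the local
  constant, so they cannot differ.\<close>

lemma jump_set_subset_ess_switch_set: "jump_set u \<subseteq> ess_switch_set u"
proof
  fix t assume "t \<in> jump_set u"
  then obtain a b where t: "t \<in> {0<..<1}" and lim: "has_ess_limit_left u a t" "has_ess_limit_right u b t"
    and ab: "a \<noteq> b"
    by (auto simp: jump_set_def)
  show "t \<in> ess_switch_set u"
  proof (rule ccontr)
    assume "t \<notin> ess_switch_set u"
    then obtain r c where r: "r > 0" and ae: "AE x in lborel. x \<in> {t - r<..<t + r} \<longrightarrow> u x = c"
      using t ess_representative_locally_constant by blast
    have near: "\<bar>c - a\<bar> < e \<and> \<bar>c - b\<bar> < e" if "e > 0" for e
    proof
      obtain d where d: "d > 0" "AE y in lborel. t - d < y \<and> y < t \<longrightarrow> \<bar>u y - a\<bar> < e"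
        using lim(1) \<open>e > 0\<close> unfolding has_ess_limit_left_def AE_completion_iff by blast
      from d(2) ae have "AE y in lborel. y \<in> {max (t - d) (t - r)<..<t} \<longrightarrow> \<bar>c - a\<bar> < e"
        by eventually_elim auto
      from AE_interval_nonempty[OF _ this] show "\<bar>c - a\<bar> < e" using d r by auto
    next
      obtain d where d: "d > 0" "AE y in lborel. t < y \<and> y < t + d \<longrightarrow> \<bar>u y - b\<bar> < e"
        using lim(2) \<open>e > 0\<close> unfolding has_ess_limit_right_def AE_completion_iff by blast
      from d(2) ae have "AE y in lborel. y \<in> {t<..<min (t + d) (t + r)} \<longrightarrow> \<bar>c - b\<bar> < e"
        by eventually_elim auto
      from AE_interval_nonempty[OF _ this] show "\<bar>c - b\<bar> < e" using d r by auto
    qed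
    have "\<bar>a - b\<bar> / 2 > 0" using ab by simp
    from near[OF this] have "\<bar>c - a\<bar> < \<bar>a - b\<bar> / 2" "\<bar>c - b\<bar> < \<bar>a - b\<bar> / 2" by auto
    then show False by argo
  qed
qed

text \<open>Finiteness isolates each switching point, so \<open>u\<close> is a.e. constant on either
  side of it. The two constants differ, since otherwise \<open>u\<close> would be a.e. constant
  across the point.\<close>

lemma jump_set_eq_ess_switch_set:
  assumes fin: "finite (ess_switch_set u)"
  shows "jump_set u = ess_switch_set u"
proof
  show "ess_switch_set u \<subseteq> jump_set u"
  proof
    fix t assume tS: "t \<in> ess_switch_set u"
    then have t: "0 < t" "t < 1" by (auto simp: ess_switch_set_def)
    obtain r0 where r0: "r0 > 0" "\<forall>s\<in>ess_switch_set u. s \<noteq> t \<longrightarrow> r0 \<le> dist t s"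
      using finite_set_avoid[OF fin, of t] by blast
    define r where "r = min r0 (min t (1 - t))"
    have r: "r > 0" "r \<le> t" "r \<le> 1 - t" "r \<le> r0" using r0 t by (auto simp: r_def)
    have iso: "s = t" if "s \<in> ess_switch_set u" "t - r < s" "s < t + r" for s
      using r0(2) that r by (force simp: dist_real_def)
    define cl cr where "cl = ess_representative u (t - r / 2)" and "cr = ess_representative u (t + r / 2)"
    have L: "ess_representative u x = cl" if "t - r < x" "x < t" for x
    proof -
      have "{min x (t - r/2)..max x (t - r/2)} \<inter> ess_switch_set u = {}"
        using iso that r by (fastforce simp: min_def max_def split: if_splits)
      then have "ess_representative u (min x (t - r/2)) = ess_representative u (max x (t - r/2))"
        using that r by (intro ess_representative_eq_on_interval) auto
      then show ?thesis by (auto simp: cl_def min_def max_def split: if_splits)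
    qed
    have R: "ess_representative u x = cr" if "t < x" "x < t + r" for x
    proof -
      have "{min x (t + r/2)..max x (t + r/2)} \<inter> ess_switch_set u = {}"
        using iso that r by (fastforce simp: min_def max_def split: if_splits)
      then have "ess_representative u (min x (t + r/2)) = ess_representative u (max x (t + r/2))"
        using that r t by (intro ess_representative_eq_on_interval) auto
      then show ?thesis by (auto simp: cr_def min_def max_def split: if_splits)
    qed
    have ae: "AE x in lborel. 0 < x \<and> x < 1 \<longrightarrow> ess_representative u x = u x"
      using ess_representative_AE_eq[OF fin] by (simp add: AE_unit_leb_iff)
    have aeL: "AE y in lborel. t - r < y \<and> y < t \<longrightarrow> u y = cl"
      using ae
    proof eventually_elim
      case (elim y)
      then show ?case using L[of y] r by auto
    qed
    have aeR: "AE y in lborel. t < y \<and> y < t + r \<longrightarrow> u y = cr"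
      using ae
    proof eventually_elim
      case (elim y)
      then show ?case using R[of y] r t by auto
    qed
    have "has_ess_limit_left u cl t"
      unfolding has_ess_limit_left_def AE_completion_iff
      using aeL r(1) by (auto intro!: exI[of _ r] elim!: eventually_mono)
    moreover have "has_ess_limit_right u cr t"
      unfolding has_ess_limit_right_def AE_completion_iff
      using aeR r(1) by (auto intro!: exI[of _ r] elim!: eventually_mono)
    moreover have "cl \<noteq> cr"
    proof
      assume "cl = cr"
      have "AE y in lborel. y \<in> {t - r<..<t + r} \<longrightarrow> u y = cl"
        using aeL aeR AE_lborel_singleton[of t] by eventually_elim (use \<open>cl = cr\<close> in fastforce)
      then show False
        using ess_switch_setD[OF tS, of "t - r" "t + r" cl] r ess_representative_range[of u]
        by (auto simp: cl_def)
    qed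
    ultimately show "t \<in> jump_set u" using t by (auto simp: jump_set_def)
  qed
qed (rule jump_set_subset_ess_switch_set)

lemma BV_pm1_iff:
  assumes "u \<in> meas_funs" "AE t in unit_leb. u t \<in> {-1, 1}"
  shows "u \<in> BV_pm1 \<longleftrightarrow> finite (ess_switch_set u)"
  using assms finite_ess_switch_set[OF assms(2)] ess_representative_AE_eq[of u]
    bounded_variation_ess_representative[of u]
  unfolding BV_pm1_def by blast

lemma ess_switch_set_cong_AE:
  assumes "AE t in unit_leb. u t = v t"
  shows "ess_switch_set u = ess_switch_set v"
proof -
  have sub: "ess_switch_set u \<subseteq> ess_switch_set v" if "AE t in unit_leb. u t = v t" for u v
  proof
    fix t assume t: "t \<in> ess_switch_set u"
    then have t01: "0 < t" "t < 1" by (auto simp: ess_switch_set_def)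
    have "\<not> (AE x in lborel. x \<in> {t - r<..<t + r} \<longrightarrow> v x = c)" if "r > 0" "c \<in> {-1, 1}" for r c
    proof
      assume "AE x in lborel. x \<in> {t - r<..<t + r} \<longrightarrow> v x = c"
      moreover have "AE x in lborel. 0 < x \<and> x < 1 \<longrightarrow> u x = v x"
        using \<open>AE t in unit_leb. u t = v t\<close> by (simp add: AE_unit_leb_iff)
      ultimately have "AE x in lborel. x \<in> {max 0 (t - r)<..<min 1 (t + r)} \<longrightarrow> u x = c"
        by eventually_elim auto
      with ess_switch_setD[OF t, of "max 0 (t - r)" "min 1 (t + r)" c] t01 that show False by auto
    qed
    with t01 show "t \<in> ess_switch_set v" by (auto simp: ess_switch_set_def)
  qed
  have "AE t in unit_leb. v t = u t" using assms by (auto elim!: eventually_mono)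
  with sub assms show ?thesis by blast
qed

section \<open>Seminorm of a function with Lipschitz transitions\<close>

lemma nn_integral_jump_profile_le:
  fixes s \<eta> :: real
  assumes s: "1/4 \<le> s" "s \<le> 3/4" and \<eta>: "0 < \<eta>" "\<eta> < 1"
  shows "(\<integral>\<^sup>+h\<in>{0<..<1}. ennreal (min 4 ((h / \<eta>)\<^sup>2) / h powr (1 + 2 * s) * (h + 2 * \<eta>)) \<partial>lborel)
    \<le> ennreal (4 * scale_weight s \<eta> + 22 * \<eta> powr (1 - 2 * s))"
proof -
  \<comment> \<open>Split at h = \<eta>. Below it the quadratic bound and h + 2\<eta> \<le> 3\<eta>
    give \<open>?A\<close>; above it the bound 4 is used, the summand h giving the leading term
    \<open>?B\<close> and the summand 2\<eta> giving \<open>?C\<close>. The exponent in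
    \<open>?C\<close> is written so that \<open>nn_integral_powr_interval\<close> applies with
    \<open>s + 1/2\<close> for \<open>s\<close>. Since 1/4 \<le> s \<le> 3/4, \<open>?A\<close> and
    \<open>?C\<close> contribute at most 6 and 16 times \<open>\<eta> powr (1 - 2 * s)\<close>,
    together 22.\<close>
  let ?A = "\<lambda>h. ennreal (3 / \<eta>) * (ennreal (h powr (1 - 2 * s)) * indicator {0..\<eta>} h)"
  let ?B = "\<lambda>h. ennreal 4 * (ennreal (h powr (- 2 * s)) * indicator {\<eta>..1} h)"
  let ?C = "\<lambda>h. ennreal (8 * \<eta>) * (ennreal (h powr (- 2 * (s + 1/2))) * indicator {\<eta>..1} h)"
  have "(\<integral>\<^sup>+h\<in>{0<..<1}. ennreal (min 4 ((h / \<eta>)\<^sup>2) / h powr (1 + 2 * s) * (h + 2 * \<eta>)) \<partial>lborel)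
      \<le> (\<integral>\<^sup>+h. ?A h + (?B h + ?C h) \<partial>lborel)"
  proof (rule nn_integral_mono)
    fix h :: real
    show "ennreal (min 4 ((h / \<eta>)\<^sup>2) / h powr (1 + 2 * s) * (h + 2 * \<eta>)) * indicator {0<..<1} h
      \<le> ?A h + (?B h + ?C h)"
    proof (cases "0 < h \<and> h < 1")
      case h: True
      show ?thesis
      proof (cases "h \<le> \<eta>")
        case True
        have "min 4 ((h / \<eta>)\<^sup>2) / h powr (1 + 2 * s) * (h + 2 * \<eta>)
            \<le> (h / \<eta>)\<^sup>2 / h powr (1 + 2 * s) * (3 * \<eta>)"
          using True h \<eta> by (intro mult_mono divide_right_mono) auto
        also have "\<dots> = 3 / \<eta> * (h powr 2 / h powr (1 + 2 * s))"
          using \<eta> h by (simp add: power2_eq_square field_simps)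
        also have "h powr 2 / h powr (1 + 2 * s) = h powr (1 - 2 * s)"
          unfolding powr_diff[symmetric] by (simp add: algebra_simps)
        finally have "ennreal (min 4 ((h / \<eta>)\<^sup>2) / h powr (1 + 2 * s) * (h + 2 * \<eta>))
            \<le> ennreal (3 / \<eta> * h powr (1 - 2 * s))" by (rule ennreal_leI)
        also have "\<dots> = ?A h" using True h \<eta> by (simp flip: ennreal_mult)
        finally show ?thesis using h by (simp add: add_increasing2)
      next
        case False
        have "min 4 ((h / \<eta>)\<^sup>2) / h powr (1 + 2 * s) * (h + 2 * \<eta>)
            \<le> 4 / h powr (1 + 2 * s) * (h + 2 * \<eta>)"
          using False h \<eta> by (intro mult_right_mono divide_right_mono) auto
        also have "\<dots> = 4 * (h powr 1 / h powr (1 + 2 * s)) + 8 * \<eta> * (h powr 0 / h powr (1 + 2 * s))"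
          using h by (simp add: field_simps)
        also have "\<dots> = 4 * h powr (- 2 * s) + 8 * \<eta> * h powr (- 2 * (s + 1/2))"
          unfolding powr_diff[symmetric] by (simp add: algebra_simps)
        finally have "ennreal (min 4 ((h / \<eta>)\<^sup>2) / h powr (1 + 2 * s) * (h + 2 * \<eta>))
            \<le> ennreal (4 * h powr (- 2 * s) + 8 * \<eta> * h powr (- 2 * (s + 1/2)))" by (rule ennreal_leI)
        also have "\<dots> = ?B h + ?C h" using False h \<eta> by (simp add: ennreal_mult)
        finally show ?thesis using h by (simp add: add_increasing)
      qed
    qed auto
  qed
  also have "\<dots> = (\<integral>\<^sup>+h. ?A h \<partial>lborel) + ((\<integral>\<^sup>+h. ?B h \<partial>lborel) + (\<integral>\<^sup>+h. ?C h \<partial>lborel))"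
    by (subst nn_integral_add; simp?)+
  also have "(\<integral>\<^sup>+h. ?A h \<partial>lborel) \<le> ennreal (6 * \<eta> powr (1 - 2 * s))"
  proof -
    have "((\<lambda>x. x powr (1 - 2 * s)) has_integral (\<eta> powr (1 - 2 * s + 1) / (1 - 2 * s + 1))) {0..\<eta>}"
      using s \<eta> by (intro has_integral_powr_from_0) auto
    from nn_integral_has_integral_lebesgue[OF _ this]
    have "(\<integral>\<^sup>+h. ennreal (h powr (1 - 2 * s)) * indicator {0..\<eta>} h \<partial>lborel)
        = ennreal (\<eta> powr (1 - 2 * s + 1) / (1 - 2 * s + 1))"
      by (simp add: ennreal_mult' ennreal_indicator mult.commute)
    then have "(\<integral>\<^sup>+h. ?A h \<partial>lborel) = ennreal (3 / \<eta> * (\<eta> powr (1 - 2 * s + 1) / (1 - 2 * s + 1)))"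
      using s \<eta> by (simp add: nn_integral_cmult flip: ennreal_mult)
    also have "\<eta> powr (1 - 2 * s + 1) = \<eta> powr (1 - 2 * s) * \<eta>"
      unfolding powr_add using \<eta> by simp
    also have "3 / \<eta> * (\<eta> powr (1 - 2 * s) * \<eta> / (1 - 2 * s + 1)) = 3 / (2 - 2 * s) * \<eta> powr (1 - 2 * s)"
      using \<eta> by simp
    also have "\<dots> \<le> 6 * \<eta> powr (1 - 2 * s)"
      using s by (intro mult_right_mono) (auto simp: field_simps)
    finally show ?thesis by (simp add: ennreal_leI)
  qed
  also have "(\<integral>\<^sup>+h. ?B h \<partial>lborel) = ennreal (4 * scale_weight s \<eta>)"
  proof -
    have "(\<integral>\<^sup>+h. ?B h \<partial>lborel) = ennreal 4 * ennreal (scale_weight s \<eta>)"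
      using nn_integral_powr_interval[of \<eta> 1 s] \<eta> by (simp add: nn_integral_cmult)
    then show ?thesis using scale_weight_antimono[of \<eta> 1 s] \<eta> by (simp add: ennreal_mult)
  qed
  also have "(\<integral>\<^sup>+h. ?C h \<partial>lborel) \<le> ennreal (16 * \<eta> powr (1 - 2 * s))"
  proof -
    have "(\<integral>\<^sup>+h. ?C h \<partial>lborel) = ennreal (8 * \<eta>) * ennreal (scale_weight (s + 1/2) \<eta>)"
      using nn_integral_powr_interval[of \<eta> 1 "s + 1/2"] \<eta> by (simp add: nn_integral_cmult)
    also have "\<dots> = ennreal (8 * \<eta> * scale_weight (s + 1/2) \<eta>)"
      using scale_weight_antimono[of \<eta> 1 "s + 1/2"] \<eta> by (simp add: ennreal_mult)
    also have "8 * \<eta> * scale_weight (s + 1/2) \<eta> \<le> 16 * \<eta> powr (1 - 2 * s)"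
    proof -
      have "scale_weight (s + 1/2) \<eta> = (\<eta> powr (- (2 * s)) - 1) / (2 * s)"
        using s by (simp add: scale_weight_def)
      also have "\<dots> \<le> \<eta> powr (- (2 * s)) / (2 * s)" using s by (intro divide_right_mono) auto
      also have "\<dots> \<le> \<eta> powr (- (2 * s)) / (1 / 2)" using s by (intro divide_left_mono) auto
      finally have "8 * \<eta> * scale_weight (s + 1/2) \<eta> \<le> 8 * \<eta> * (2 * \<eta> powr (- (2 * s)))"
        using \<eta> by (intro mult_left_mono) auto
      also have "\<dots> = 16 * (\<eta> powr 1 * \<eta> powr (- (2 * s)))" using \<eta> by simp
      finally show ?thesis unfolding powr_add[symmetric] by simp
    qed
    finally show ?thesis by (simp add: ennreal_leI)
  qed
  finally have "(\<integral>\<^sup>+h\<in>{0<..<1}. ennreal (min 4 ((h / \<eta>)\<^sup>2) / h powr (1 + 2 * s) * (h + 2 * \<eta>)) \<partial>lborel)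
      \<le> ennreal (6 * \<eta> powr (1 - 2 * s)) + (ennreal (4 * scale_weight s \<eta>) + ennreal (16 * \<eta> powr (1 - 2 * s)))"
    by (simp add: add_mono)
  also have "\<dots> = ennreal (4 * scale_weight s \<eta> + 22 * \<eta> powr (1 - 2 * s))"
    using scale_weight_antimono[of \<eta> 1 s] \<eta> by (simp flip: ennreal_plus)
  finally show ?thesis .
qed

text \<open>A pair at distance h contributes only if a point of \<open>S\<close> lies within \<eta>
  of the interval it spans. For each point of \<open>S\<close> this confines the left end of the
  pair to an interval of length h + 2\<eta>, and the squared difference is at most
  \<open>min 4 ((h / \<eta>)\<^sup>2)\<close>. Doubling the one-jump integral turns 4 and 22 into 8
  and 44.\<close>

lemma gagliardo_sq_le_of_lipschitz_transitions:
  fixes w :: "real \<Rightarrow> real"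
  assumes s: "1/4 \<le> s" "s \<le> 3/4" and \<eta>: "0 < \<eta>" "\<eta> < 1" and fin: "finite S"
    and bound: "\<And>x. \<bar>w x\<bar> \<le> 1"
    and lip: "\<And>x y. 0 < x \<Longrightarrow> x < y \<Longrightarrow> y < 1 \<Longrightarrow> \<bar>w x - w y\<bar> \<le> (y - x) / \<eta>"
    and near: "\<And>x y. 0 < x \<Longrightarrow> x < y \<Longrightarrow> y < 1 \<Longrightarrow> w x \<noteq> w y \<Longrightarrow> \<exists>t\<in>S. x - \<eta> \<le> t \<and> t \<le> y + \<eta>"
  shows "gagliardo_sq s w \<le> ennreal (card S * (8 * scale_weight s \<eta> + 44 * \<eta> powr (1 - 2 * s)))"
proof -
  define m where "m r = min 4 ((r / \<eta>)\<^sup>2) / r powr (1 + 2 * s)" for r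
  \<comment> \<open>A symmetric majorant on the whole plane, so that slicing applies. Summing over
    \<open>S\<close> bounds the maximum over nearby jumps, so the transition layers need not be
    disjoint.\<close>
  define g :: "real \<times> real \<Rightarrow> ennreal" where
    "g p = (\<Sum>t\<in>S. ennreal (m \<bar>fst p - snd p\<bar>) * (if \<bar>fst p - snd p\<bar> < 1 \<and>
      min (fst p) (snd p) - \<eta> \<le> t \<and> t \<le> max (fst p) (snd p) + \<eta> then 1 else 0))" for p
  have [measurable]: "m \<in> borel_measurable borel" unfolding m_def by measurable
  have [measurable]: "g \<in> borel_measurable borel"
    unfolding g_def borel_prod[symmetric] by measurable
  have m0: "0 \<le> m r" for r by (simp add: m_def)
  have sym: "g (x, y) = g (y, x)" for x y :: real
    by (simp add: g_def abs_minus_commute min.commute max.commute)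
  have key: "ennreal (\<bar>w x - w y\<bar>\<^sup>2 / \<bar>x - y\<bar> powr (1 + 2 * s)) \<le> g (x, y)"
    if xy: "0 < x" "x < y" "y < 1" for x y
  proof (cases "w x = w y")
    case False
    then obtain t where t: "t \<in> S" "x - \<eta> \<le> t \<and> t \<le> y + \<eta>" using near[OF xy] by blast
    have "\<bar>w x - w y\<bar>\<^sup>2 \<le> ((y - x) / \<eta>)\<^sup>2" using lip[OF that] by (intro power_mono) auto
    moreover have "\<bar>w x - w y\<bar>\<^sup>2 \<le> 2\<^sup>2"
      using bound[of x] bound[of y] by (intro power_mono) auto
    ultimately have "\<bar>w x - w y\<bar>\<^sup>2 / \<bar>x - y\<bar> powr (1 + 2 * s) \<le> m \<bar>x - y\<bar>"
      unfolding m_def using that by (intro divide_right_mono) (auto simp: abs_if)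
    then have "ennreal (\<bar>w x - w y\<bar>\<^sup>2 / \<bar>x - y\<bar> powr (1 + 2 * s)) \<le> ennreal (m \<bar>x - y\<bar>)"
      by (rule ennreal_leI)
    also have "\<dots> = ennreal (m \<bar>x - y\<bar>) * (if \<bar>x - y\<bar> < 1 \<and> min x y - \<eta> \<le> t \<and> t \<le> max x y + \<eta> then 1 else 0)"
      using t that by auto
    also have "\<dots> \<le> g (x, y)"
      unfolding g_def fst_conv snd_conv by (rule member_le_sum[OF t(1) _ fin]) auto
    finally show ?thesis .
  qed auto
  have "gagliardo_sq s w \<le> (\<integral>\<^sup>+p. g p \<partial>lebesgue)"
    unfolding gagliardo_sq_def
  proof (rule nn_integral_mono)
    fix p :: "real \<times> real"
    obtain x y where p: "p = (x, y)" by (cases p)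
    consider "x < y" | "y < x" | "x = y" by linarith
    then show "ennreal (\<bar>w (fst p) - w (snd p)\<bar>\<^sup>2 / \<bar>fst p - snd p\<bar> powr (1 + 2 * s)) *
        indicator ({0<..<1} \<times> {0<..<1}) p \<le> g p"
    proof cases
      case 1
      then show ?thesis using key[of x y] by (auto simp: p indicator_def)
    next
      case 2
      then show ?thesis using key[of y x] sym[of x y] by (auto simp: p indicator_def abs_minus_commute)
    qed (simp add: p)
  qed
  also have "\<dots> = 2 * (\<integral>\<^sup>+h\<in>{0<..}. (\<integral>\<^sup>+x. g (x, x + h) \<partial>lborel) \<partial>lborel)"
    by (rule nn_integral_symmetric_slices) (simp_all add: sym)
  also have "(\<integral>\<^sup>+h\<in>{0<..}. (\<integral>\<^sup>+x. g (x, x + h) \<partial>lborel) \<partial>lborel)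
      = (\<integral>\<^sup>+h\<in>{0<..<1}. ennreal (card S) * ennreal (m h * (h + 2 * \<eta>)) \<partial>lborel)"
  proof (rule nn_integral_cong)
    fix h :: real
    consider "h \<le> 0" | "h \<ge> 1" | "0 < h" "h < 1" by linarith
    then show "(\<integral>\<^sup>+x. g (x, x + h) \<partial>lborel) * indicator {0<..} h =
        ennreal (card S) * ennreal (m h * (h + 2 * \<eta>)) * indicator {0<..<1} h"
    proof cases
      case 3
      have "(\<integral>\<^sup>+x. g (x, x + h) \<partial>lborel)
          = (\<integral>\<^sup>+x. (\<Sum>t\<in>S. ennreal (m h) * indicator {t - h - \<eta>..t + \<eta>} x) \<partial>lborel)"
        unfolding g_def using 3 by (intro nn_integral_cong sum.cong) (auto simp: indicator_def)
      also have "\<dots> = (\<Sum>t\<in>S. ennreal (m h) * ennreal (h + 2 * \<eta>))"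
        using 3 \<eta> by (subst nn_integral_sum) (auto simp: nn_integral_cmult_indicator add.commute)
      also have "\<dots> = ennreal (card S) * ennreal (m h * (h + 2 * \<eta>))"
        using 3 \<eta> m0[of h] by (simp add: ennreal_mult ennreal_of_nat_eq_real_of_nat)
      finally show ?thesis using 3 by simp
    next
      case 2
      then have "(\<integral>\<^sup>+x. g (x, x + h) \<partial>lborel) = 0" by (simp add: g_def)
      then show ?thesis using 2 by simp
    qed simp
  qed
  also have "\<dots> = ennreal (card S) * (\<integral>\<^sup>+h\<in>{0<..<1}. ennreal (m h * (h + 2 * \<eta>)) \<partial>lborel)"
    by (subst nn_integral_cmult[symmetric]) (auto simp: mult.assoc)
  also have "2 * \<dots> \<le> 2 * (ennreal (card S) * ennreal (4 * scale_weight s \<eta> + 22 * \<eta> powr (1 - 2 * s)))"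
    using nn_integral_jump_profile_le[OF s \<eta>] by (intro mult_left_mono) (auto simp: m_def)
  also have "\<dots> = ennreal (2 * (card S * (4 * scale_weight s \<eta> + 22 * \<eta> powr (1 - 2 * s))))"
    using scale_weight_antimono[of \<eta> 1 s] \<eta> by (simp add: ennreal_mult)
  also have "2 * (card S * (4 * scale_weight s \<eta> + 22 * \<eta> powr (1 - 2 * s)))
      = card S * (8 * scale_weight s \<eta> + 44 * \<eta> powr (1 - 2 * s))"
    by (simp add: algebra_simps)
  finally show ?thesis by simp
qed

subsection \<open>Recovery sequences\<close>

text \<open>The extra point 2 keeps the set nonempty (\<open>infdist\<close> to the empty set is 0) and is at distance
  more than 1 from the unit interval.\<close>

definition recovery_profile :: "(real \<Rightarrow> real) \<Rightarrow> real \<Rightarrow> real \<Rightarrow> real" where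
  "recovery_profile u \<eta> x =
     ess_representative u x * min 1 (infdist x (insert 2 (ess_switch_set u)) / \<eta>)"

context
  fixes u :: "real \<Rightarrow> real"
  assumes u: "u \<in> meas_funs" and fin: "finite (ess_switch_set u)"
begin

lemma recovery_profile_measurable: "recovery_profile u \<eta> \<in> meas_funs"
proof -
  have ae: "AE x in lborel. 0 < x \<and> x < 1 \<longrightarrow> ess_representative u x = u x"
    using ess_representative_AE_eq[OF fin] by (simp add: AE_unit_leb_iff)
  have "(\<lambda>x. indicator {0<..<1} x *\<^sub>R u x) \<in> borel_measurable lebesgue"
    using u by (simp add: borel_measurable_restrict_space_iff)
  moreover have "AE x in lebesgue. indicator {0<..<1} x *\<^sub>R u x = indicator {0<..<1} x *\<^sub>R ess_representative u x"
    unfolding AE_completion_iff using ae by eventually_elim (auto simp: indicator_def)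
  ultimately have "(\<lambda>x. indicator {0<..<1} x *\<^sub>R ess_representative u x) \<in> borel_measurable lebesgue"
    by (rule borel_measurable_AE)
  then have "ess_representative u \<in> meas_funs"
    by (simp add: borel_measurable_restrict_space_iff)
  moreover have "(\<lambda>x. min 1 (infdist x (insert 2 (ess_switch_set u)) / \<eta>)) \<in> meas_funs"
  proof (intro measurable_restrict_space1 measurable_completion)
    have [measurable]: "(\<lambda>x. infdist x (insert 2 (ess_switch_set u))) \<in> borel_measurable borel"
      by (intro borel_measurable_continuous_onI continuous_on_infdist continuous_on_id)
    show "(\<lambda>x. min 1 (infdist x (insert 2 (ess_switch_set u)) / \<eta>)) \<in> borel_measurable lborel"
      by measurable
  qed
  ultimately show ?thesis
    unfolding recovery_profile_def[abs_def] by (rule borel_measurable_times)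
qed

lemma abs_recovery_profile_le_1:
  assumes "0 < \<eta>"
  shows "\<bar>recovery_profile u \<eta> x\<bar> \<le> 1"
proof -
  have "0 \<le> infdist x (insert 2 (ess_switch_set u)) / \<eta>"
    using assms by (simp add: infdist_nonneg)
  then have "\<bar>min 1 (infdist x (insert 2 (ess_switch_set u)) / \<eta>)\<bar> \<le> 1" by (auto simp: min_def)
  then show ?thesis
    using ess_representative_range[of u x] by (auto simp: recovery_profile_def abs_mult)
qed

lemma recovery_profile_eq:
  assumes "0 < \<eta>" "\<eta> < 1" "0 < x" "x < 1" "\<And>t. t \<in> ess_switch_set u \<Longrightarrow> t < x - \<eta> \<or> x + \<eta> < t"
  shows "recovery_profile u \<eta> x = ess_representative u x"
proof -
  have "closed (insert 2 (ess_switch_set u))" using fin by (simp add: finite_imp_closed)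
  from infdist_attains_inf[OF this, of x] obtain a
    where a: "a \<in> insert 2 (ess_switch_set u)" "infdist x (insert 2 (ess_switch_set u)) = dist x a"
    by auto
  have "\<eta> \<le> dist x a" using a(1) assms by (force simp: dist_real_def)
  then show ?thesis using a assms by (simp add: recovery_profile_def)
qed

lemma recovery_profile_near_jump:
  assumes "0 < \<eta>" "\<eta> < 1" "0 < x" "x < y" "y < 1" "recovery_profile u \<eta> x \<noteq> recovery_profile u \<eta> y"
  shows "\<exists>t\<in>ess_switch_set u. x - \<eta> \<le> t \<and> t \<le> y + \<eta>"
proof (rule ccontr)
  assume n: "\<not> ?thesis"
  then have "recovery_profile u \<eta> x = ess_representative u x" "recovery_profile u \<eta> y = ess_representative u y"
    using assms by (intro recovery_profile_eq; force)+
  moreover have "ess_representative u x = ess_representative u y"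
    by (rule ess_representative_eq_on_interval) (use n assms in \<open>auto simp: not_le\<close>)
  ultimately show False using assms by simp
qed

text \<open>If the sign is the same at both points, the distance function is 1-Lipschitz. If not,
  some switching point t lies between them; the profile vanishes at t, and its values at x and y are
  bounded by the distances to t, which add up to y - x.\<close>

lemma recovery_profile_lipschitz:
  assumes "0 < \<eta>" "0 < x" "x < y" "y < 1"
  shows "\<bar>recovery_profile u \<eta> x - recovery_profile u \<eta> y\<bar> \<le> (y - x) / \<eta>"
proof -
  define D where "D z = infdist z (insert 2 (ess_switch_set u))" for z
  have D0: "0 \<le> D z" for z by (simp add: D_def infdist_nonneg)
  have rng: "\<bar>ess_representative u z\<bar> = 1" for z using ess_representative_range[of u z] by auto
  show ?thesis
  proof (cases "ess_representative u x = ess_representative u y")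
    case True
    have "D x \<le> D y + (y - x)" "D y \<le> D x + (y - x)"
      using infdist_triangle[of x "insert 2 (ess_switch_set u)" y]
        infdist_triangle[of y "insert 2 (ess_switch_set u)" x] assms
      by (auto simp: D_def dist_real_def)
    then have "D x / \<eta> \<le> D y / \<eta> + (y - x) / \<eta>" "D y / \<eta> \<le> D x / \<eta> + (y - x) / \<eta>"
      using assms by (simp_all add: divide_right_mono flip: add_divide_distrib)
    moreover have "0 \<le> (y - x) / \<eta>" using assms by simp
    ultimately have "\<bar>min 1 (D x / \<eta>) - min 1 (D y / \<eta>)\<bar> \<le> (y - x) / \<eta>"
      by (auto simp: min_def)
    moreover have "\<bar>recovery_profile u \<eta> x - recovery_profile u \<eta> y\<bar>
        = \<bar>ess_representative u y\<bar> * \<bar>min 1 (D x / \<eta>) - min 1 (D y / \<eta>)\<bar>"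
      unfolding recovery_profile_def D_def True abs_mult[symmetric] by (simp add: algebra_simps)
    ultimately show ?thesis by (simp add: rng)
  next
    case False
    then have "{x..y} \<inter> ess_switch_set u \<noteq> {}"
      using ess_representative_eq_on_interval[of x y u] assms by auto
    then obtain t where t: "t \<in> ess_switch_set u" "x \<le> t" "t \<le> y" by auto
    have "D x \<le> t - x" "D y \<le> y - t"
      using infdist_le[of t "insert 2 (ess_switch_set u)" x] infdist_le[of t "insert 2 (ess_switch_set u)" y] t
      by (auto simp: D_def dist_real_def)
    moreover have "\<bar>recovery_profile u \<eta> z\<bar> \<le> D z / \<eta>" for z
    proof -
      have "\<bar>recovery_profile u \<eta> z\<bar> = \<bar>min 1 (D z / \<eta>)\<bar>" by (simp add: recovery_profile_def abs_mult rng D_def)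
      also have "\<dots> \<le> D z / \<eta>" using D0[of z] assms by (auto simp: min_def)
      finally show ?thesis .
    qed
    ultimately have "\<bar>recovery_profile u \<eta> x\<bar> \<le> (t - x) / \<eta>" "\<bar>recovery_profile u \<eta> y\<bar> \<le> (y - t) / \<eta>"
      using assms by (meson divide_right_mono less_imp_le order_trans)+
    moreover have "(t - x) / \<eta> + (y - t) / \<eta> = (y - x) / \<eta>" by (simp flip: add_divide_distrib)
    ultimately show ?thesis by argo
  qed
qed

lemma emeasure_transition_layer_le:
  fixes \<eta> :: real and S :: "real set"
  assumes "0 < \<eta>" "finite S"
  shows "emeasure lborel (\<Union>t\<in>S. {t - \<eta>..t + \<eta>}) \<le> ennreal (2 * real (card S) * \<eta>)"
proof -
  have "emeasure lborel (\<Union>t\<in>S. {t - \<eta>..t + \<eta>}) \<le> (\<Sum>t\<in>S. emeasure lborel {t - \<eta>..t + \<eta>})"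
    using assms by (intro emeasure_subadditive_finite) auto
  also have "\<dots> = (\<Sum>t\<in>S. ennreal (2 * \<eta>))" using assms by (intro sum.cong) auto
  also have "\<dots> = ennreal (2 * real (card S) * \<eta>)"
    using assms by (simp add: ennreal_of_nat_eq_real_of_nat algebra_simps flip: ennreal_mult)
  finally show ?thesis .
qed

lemma recovery_profile_AE_eq:
  assumes "0 < \<eta>" "\<eta> < 1"
  shows "AE x in lborel. 0 < x \<and> x < 1 \<and> x \<notin> (\<Union>t\<in>ess_switch_set u. {t - \<eta>..t + \<eta>}) \<longrightarrow>
    recovery_profile u \<eta> x = u x"
proof -
  have "AE x in lborel. 0 < x \<and> x < 1 \<longrightarrow> ess_representative u x = u x"
    using ess_representative_AE_eq[OF fin] by (simp add: AE_unit_leb_iff)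
  then show ?thesis
  proof eventually_elim
    case (elim x)
    then show ?case using recovery_profile_eq[OF assms, of x] by (force simp: not_le)
  qed
qed

lemma recovery_profile_tendsto_in_measure:
  assumes \<eta>: "filterlim \<eta> (at_right 0) sequentially"
  shows "tendsto_in_measure unit_leb (\<lambda>j. recovery_profile u (\<eta> j)) u"
  unfolding tendsto_in_measure_def
proof (intro allI impI)
  fix \<delta> :: real assume "\<delta> > 0"
  let ?L = "\<lambda>j. \<Union>t\<in>ess_switch_set u. {t - \<eta> j..t + \<eta> j}"
  have ev: "\<forall>\<^sub>F j in sequentially. 0 < \<eta> j \<and> \<eta> j < 1"
    by (rule eventually_in_unit_interval[OF \<eta>])
  have "\<forall>\<^sub>F j in sequentially. emeasure unit_leb {x \<in> space unit_leb. \<delta> < \<bar>recovery_profile u (\<eta> j) x - u x\<bar>}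
      \<le> ennreal (2 * real (card (ess_switch_set u)) * \<eta> j)"
    using ev
  proof eventually_elim
    case (elim j)
    have B: "?L j \<in> sets borel" using fin by auto
    have "AE x in unit_leb. x \<in> {x \<in> space unit_leb. \<delta> < \<bar>recovery_profile u (\<eta> j) x - u x\<bar>} \<longrightarrow>
        x \<in> ?L j \<inter> {0<..<1}"
      unfolding AE_unit_leb_iff using recovery_profile_AE_eq[of "\<eta> j"] elim \<open>\<delta> > 0\<close>
      by (auto elim!: eventually_mono)
    then have "emeasure unit_leb {x \<in> space unit_leb. \<delta> < \<bar>recovery_profile u (\<eta> j) x - u x\<bar>}
        \<le> emeasure unit_leb (?L j \<inter> {0<..<1})"
      by (rule emeasure_mono_AE) (use B in \<open>auto simp: sets_restrict_space_iff\<close>)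
    also have "\<dots> = emeasure lborel (?L j \<inter> {0<..<1})"
      using B by (simp add: emeasure_restrict_space)
    also have "\<dots> \<le> emeasure lborel (?L j)" using B by (intro emeasure_mono) auto
    also have "\<dots> \<le> ennreal (2 * real (card (ess_switch_set u)) * \<eta> j)"
      using elim fin by (intro emeasure_transition_layer_le) auto
    finally show ?case .
  qed
  moreover have "(\<lambda>j. ennreal (2 * real (card (ess_switch_set u)) * \<eta> j)) \<longlonglongrightarrow> 0"
  proof -
    have "\<eta> \<longlonglongrightarrow> 0" using \<eta> by (simp add: filterlim_at)
    then have "(\<lambda>j. 2 * real (card (ess_switch_set u)) * \<eta> j) \<longlonglongrightarrow> 2 * real (card (ess_switch_set u)) * 0"
      by (intro tendsto_intros)
    from tendsto_ennrealI[OF this] show ?thesis by simp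
  qed
  ultimately show "(\<lambda>j. emeasure unit_leb {x \<in> space unit_leb. \<delta> < \<bar>recovery_profile u (\<eta> j) x - u x\<bar>}) \<longlonglongrightarrow> 0"
    by (rule tendsto_sandwich[OF _ _ tendsto_const, rotated]) simp
qed

lemma potential_energy_recovery_profile_le:
  assumes \<eta>: "0 < \<eta>" "\<eta> < 1" and pm: "AE t in unit_leb. u t \<in> {-1, 1}"
    and W: "W 1 = 0" "W (- 1) = 0" and M: "\<And>z. \<bar>z\<bar> \<le> 1 \<Longrightarrow> W z \<le> M"
  shows "potential_energy W (recovery_profile u \<eta>) \<le> ennreal (M * (2 * real (card (ess_switch_set u)) * \<eta>))"
proof -
  let ?L = "\<Union>t\<in>ess_switch_set u. {t - \<eta>..t + \<eta>}"
  have M0: "0 \<le> M" using M[of 1] W by simp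
  have "potential_energy W (recovery_profile u \<eta>)
      = (\<integral>\<^sup>+x. ennreal (W (recovery_profile u \<eta> x)) * indicator {0<..<1} x \<partial>lborel)"
    by (simp add: potential_energy_def nn_integral_restrict_space nn_integral_completion)
  also have "\<dots> \<le> (\<integral>\<^sup>+x. ennreal M * indicator ?L x \<partial>lborel)"
  proof (rule nn_integral_mono_AE)
    have "AE x in lborel. 0 < x \<and> x < 1 \<longrightarrow> u x \<in> {-1, 1}" using pm by (simp add: AE_unit_leb_iff)
    with recovery_profile_AE_eq[OF \<eta>]
    show "AE x in lborel. ennreal (W (recovery_profile u \<eta> x)) * indicator {0<..<1} x \<le> ennreal M * indicator ?L x"
    proof eventually_elim
      case (elim x)
      show ?case
      proof (cases "x \<in> ?L")
        case True
        then show ?thesis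
          using M[OF abs_recovery_profile_le_1[OF \<eta>(1)], of x] by (auto simp: indicator_def intro: ennreal_leI)
      next
        case False
        then show ?thesis using elim W by (auto simp: indicator_def)
      qed
    qed
  qed
  also have "\<dots> = ennreal M * emeasure lborel ?L" using fin by (intro nn_integral_cmult_indicator) auto
  also have "\<dots> \<le> ennreal M * ennreal (2 * real (card (ess_switch_set u)) * \<eta>)"
    using fin \<eta> by (intro mult_left_mono emeasure_transition_layer_le) auto
  also have "\<dots> = ennreal (M * (2 * real (card (ess_switch_set u)) * \<eta>))"
    using M0 \<eta> by (simp flip: ennreal_mult)
  finally show ?thesis .
qed

text \<open>Up to the leading term 8 * N, everything is a multiple of
  \<open>\<eta> powr (1 - 2 * s) / K = 1 / Q\<close>: the potential, carried by layers of total
  length at most 2 * N * \<eta>, gives 2 * M * N, and the lower order part of the seminorm gives 44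
  * N. These two make up \<open>C\<close>.\<close>

lemma limsup_scaled_energy_recovery_profile:
  fixes W :: "real \<Rightarrow> real" and \<eta> s :: "nat \<Rightarrow> real"
  assumes \<eta>: "filterlim \<eta> (at_right 0) sequentially" and s: "s \<longlonglongrightarrow> 1/2"
    and pm: "AE t in unit_leb. u t \<in> {-1, 1}"
    and W: "continuous_on UNIV W" "W 1 = 0" "W (- 1) = 0"
  shows "limsup (\<lambda>j. scaled_energy W (s j) (\<eta> j) (recovery_profile u (\<eta> j)))
    \<le> ennreal (8 * card (ess_switch_set u))"
proof -
  obtain M where M: "\<And>z. \<bar>z\<bar> \<le> 1 \<Longrightarrow> W z \<le> M"
  proof -
    have "bounded (W ` {-1..1})"
      using W(1) by (intro compact_imp_bounded compact_continuous_image) (auto intro: continuous_on_subset)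
    then obtain B where "\<forall>z\<in>{-1..1}. norm (W z) \<le> B" by (auto simp: bounded_iff)
    then show ?thesis by (intro that[of B]) (auto simp: abs_le_iff)
  qed
  have M0: "0 \<le> M" using M[of 1] W by simp
  define N where "N = real (card (ess_switch_set u))"
  define Q where "Q j = scale_weight (s j) (\<eta> j) * \<eta> j powr (2 * s j - 1)" for j
  define C where "C = 2 * M * N + 44 * N"
  have Q: "filterlim Q at_top sequentially"
    using scale_weight_rescaled_at_top[OF \<eta> s] by (simp add: Q_def[abs_def])
  have K: "\<forall>\<^sub>F j in sequentially. 1 \<le> scale_weight (s j) (\<eta> j)"
    using scale_weight_at_top[OF \<eta> s] by (simp add: filterlim_at_top)
  have "\<forall>\<^sub>F j in sequentially. scaled_energy W (s j) (\<eta> j) (recovery_profile u (\<eta> j)) \<le> ennreal (8 * N + C / Q j)"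
    using eventually_scale[OF \<eta> s] K
  proof eventually_elim
    case (elim j)
    define k p where "k = scale_weight (s j) (\<eta> j)" and "p = \<eta> j powr (1 - 2 * s j)"
    have k: "k \<ge> 1" and \<eta>j: "0 < \<eta> j" "\<eta> j < 1" using elim by (auto simp: k_def)
    have s14: "1/4 \<le> s j" "s j \<le> 3/4" using elim by argo+
    have p: "p > 0" using \<eta>j by (simp add: p_def)
    have Qj: "1 / Q j = p / k"
    proof -
      have "p * \<eta> j powr (2 * s j - 1) = 1" unfolding p_def powr_add[symmetric] using \<eta>j by simp
      then have "\<eta> j powr (2 * s j - 1) = 1 / p" using p by (simp add: field_simps)
      then show ?thesis using k p by (simp add: Q_def k_def)
    qed
    have e: "\<eta> j powr (- 2 * s j) * \<eta> j = p"
    proof -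
      have "\<eta> j powr (- 2 * s j) * \<eta> j = \<eta> j powr (- 2 * s j) * \<eta> j powr 1" using \<eta>j by simp
      also have "\<dots> = p" unfolding p_def powr_add[symmetric] by (simp add: algebra_simps)
      finally show ?thesis .
    qed
    have "scaled_energy W (s j) (\<eta> j) (recovery_profile u (\<eta> j))
        \<le> ennreal (\<eta> j powr (- 2 * s j) / k) * ennreal (M * (2 * N * \<eta> j))
          + ennreal (1 / k) * ennreal (N * (8 * k + 44 * p))"
      unfolding scaled_energy_def k_def p_def N_def using \<eta>j s14 fin M W pm
      by (intro add_mono mult_left_mono potential_energy_recovery_profile_le gagliardo_sq_le_of_lipschitz_transitions
          abs_recovery_profile_le_1 recovery_profile_lipschitz recovery_profile_near_jump) auto
    also have "\<dots> = ennreal (\<eta> j powr (- 2 * s j) / k * (M * (2 * N * \<eta> j)) + 1 / k * (N * (8 * k + 44 * p)))"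
      using k p M0 \<eta>j by (simp add: N_def flip: ennreal_mult ennreal_plus)
    also have "\<eta> j powr (- 2 * s j) / k * (M * (2 * N * \<eta> j)) = (\<eta> j powr (- 2 * s j) * \<eta> j) / k * (2 * M * N)"
      by simp
    also have "\<dots> + 1 / k * (N * (8 * k + 44 * p)) = 8 * N + C * (1 / Q j)"
      unfolding e Qj C_def using k by (simp add: field_simps)
    finally show ?case by simp
  qed
  then have "limsup (\<lambda>j. scaled_energy W (s j) (\<eta> j) (recovery_profile u (\<eta> j))) \<le> limsup (\<lambda>j. ennreal (8 * N + C / Q j))"
    by (rule Limsup_mono)
  also have "(\<lambda>j. ennreal (8 * N + C / Q j)) \<longlonglongrightarrow> ennreal (8 * N + 0)"
    by (intro tendsto_ennrealI tendsto_add tendsto_const tendsto_divide_0[OF tendsto_const]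
        filterlim_at_top_imp_at_infinity Q)
  then have "limsup (\<lambda>j. ennreal (8 * N + C / Q j)) = ennreal (8 * N)"
    by (simp add: lim_imp_Limsup)
  finally show ?thesis by (simp add: N_def)
qed

end

subsection \<open>Lower bound for switching sets\<close>

text \<open>Two admissible indices differ by less than \<open>l / h\<close>, so all of them lie in a
  block of at most \<open>l / h + 1\<close> consecutive integers.\<close>

lemma card_progression_in_interval_le:
  fixes h l a y :: real
  assumes "0 < h" "0 \<le> l"
  shows "real (card {k. k < n \<and> a < y - real k * h \<and> y - real k * h < a + l}) \<le> l / h + 1"
proof -
  define K where "K = {k. k < n \<and> a < y - real k * h \<and> y - real k * h < a + l}"
  have fin: "finite K" by (simp add: K_def)
  show ?thesis
  proof (cases "K = {}")
    case True
    then show ?thesis using assms by (simp add: K_def[symmetric])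
  next
    case False
    define i j where "i = Min K" and "j = Max K"
    have ij: "i \<in> K" "j \<in> K" "i \<le> j" using False fin by (auto simp: i_def j_def)
    have "K \<subseteq> {i..j}" using fin by (auto simp: i_def j_def)
    then have "card K \<le> card {i..j}" by (intro card_mono) auto
    then have "real (card K) \<le> real j - real i + 1" using ij(3) by (simp add: Suc_diff_le of_nat_diff flip: of_nat_Suc)
    moreover have "real j * h - real i * h < l" using ij(1,2) by (simp add: K_def)
    then have "real j - real i < l / h" using assms by (simp add: field_simps)
    ultimately show ?thesis by (simp add: K_def[symmetric])
  qed
qed

lemma emeasure_lborel_translation_real:
  fixes c :: real
  assumes "{y. P y} \<in> sets borel"
  shows "emeasure lborel {x. P (x + c)} = emeasure lborel {y. P y}"
proof -
  have "emeasure lborel {y. P y} = (\<integral>\<^sup>+y. indicator {y. P y} y \<partial>lborel)" using assms by simp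
  also have "\<dots> = (\<integral>\<^sup>+x. indicator {y. P y} (c + 1 * x) \<partial>lborel)"
    using assms by (subst nn_integral_real_affine[where c = 1 and t = c]) auto
  also have "\<dots> = (\<integral>\<^sup>+x. indicator {x. P (x + c)} x \<partial>lborel)"
    by (intro nn_integral_cong) (auto simp: indicator_def add.commute)
  also have "\<dots> = emeasure lborel {x. P (x + c)}"
  proof (rule nn_integral_indicator)
    have "(\<lambda>x. x + c) -` {y. P y} \<inter> space borel \<in> sets borel"
      by (rule measurable_sets[OF _ assms]) simp
    then show "{x. P (x + c)} \<in> sets lborel" by (simp add: vimage_def)
  qed
  finally show ?thesis by simp
qed

lemma emeasure_lborel_preimage_add:
  fixes c :: real
  assumes "S \<in> sets borel"
  shows "emeasure lborel {x. x + c \<in> S} = emeasure lborel S"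
  using emeasure_lborel_translation_real[of "\<lambda>y. y \<in> S" c] assms by simp

text \<open>A discrete intermediate value argument: an orbit that starts in \<open>A\<close> and
  ends in \<open>B\<close> must leave \<open>A\<close>, and it does so either directly into
  \<open>B\<close> or through a point in neither set. Such a point comes before the end of the
  orbit, because the end is in \<open>B\<close>, so k < n is enough.\<close>

lemma switch_along_chain:
  fixes x h p q :: real
  assumes "A \<inter> B = {}" "0 \<le> h" "x \<in> A" "x + real n * h \<in> B" "p < x" "x + real n * h < q"
  shows "\<exists>k<n. x + real k * h \<in> {y. p < y \<and> y + h < q \<and> (y \<in> A \<and> y + h \<in> B \<or> y \<in> B \<and> y + h \<in> A)}
    \<union> ({p<..<q} - A - B)"
proof (rule ccontr)
  assume n: "\<not> ?thesis"
  have pq: "p < x + real k * h" "x + real k * h < q" if "k \<le> n" for k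
  proof -
    have "real k * h \<le> real n * h" "0 \<le> real k * h" using that assms(2) by (simp_all add: mult_right_mono)
    then show "p < x + real k * h" "x + real k * h < q" using assms by linarith+
  qed
  have "x + real k * h \<in> A" if "k \<le> n" for k
    using that
  proof (induction k)
    case 0
    then show ?case using assms by simp
  next
    case (Suc k)
    have eq: "x + real (Suc k) * h = x + real k * h + h" by (simp add: algebra_simps)
    have "x + real k * h \<in> A" using Suc by simp
    moreover have "x + real (Suc k) * h < q" "p < x + real k * h" using pq[of "Suc k"] pq[of k] Suc.prems by auto
    ultimately have notB: "x + real (Suc k) * h \<notin> B" using n Suc.prems unfolding eq by auto
    show ?case
    proof (cases "Suc k = n")
      case True
      then show ?thesis using notB assms by simp
    next
      case False
      then have "Suc k < n" using Suc.prems by simp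
      then have "x + real (Suc k) * h \<notin> {p<..<q} - A - B" using n by blast
      moreover have "x + real (Suc k) * h \<in> {p<..<q}" using pq[of "Suc k"] Suc.prems by simp
      ultimately show ?thesis using notB by blast
    qed
  qed
  from this[of n] show False using assms by auto
qed

text \<open>Translate an interval of length \<open>l\<close> by steps of size \<open>h\<close> from a region where \<open>A\<close> has
  almost full density to one where \<open>B\<close> has. Nearly every orbit meets a switch or the complement
  of \<open>A \<union> B\<close>, and each such point is met by at most \<open>l / h + 1\<close> orbits.\<close>

lemma switching_measure_ge_of_le:
  fixes a b l h \<tau> p q :: real
  assumes [measurable]: "A \<in> sets borel" "B \<in> sets borel" and disj: "A \<inter> B = {}"
    and h: "0 < h" "h \<le> \<tau> * l" and l: "0 < l" and \<tau>: "0 < \<tau>"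
    and pq: "p \<le> a" "a \<le> b" "b + l \<le> q"
    and A: "emeasure lborel ({a<..<a + l} - A) \<le> ennreal (2 * \<tau> * l)"
    and B: "emeasure lborel ({b<..<b + l} - B) \<le> ennreal (2 * \<tau> * l)"
  shows "ennreal ((1 - 6 * \<tau>) * h) \<le>
    emeasure lborel {x. p < x \<and> x + h < q \<and> (x \<in> A \<and> x + h \<in> B \<or> x \<in> B \<and> x + h \<in> A)}
    + emeasure lborel ({p<..<q} - A - B)"
proof -
  define Sw where "Sw = {x. p < x \<and> x + h < q \<and> (x \<in> A \<and> x + h \<in> B \<or> x \<in> B \<and> x + h \<in> A)}"
  define R where "R = {p<..<q} - A - B"
  define Z where "Z = Sw \<union> R"
  define J where "J = {a<..<a + l}"
  \<comment> \<open>The number of whole steps that fit into b - a. The translate by n steps falls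
    short of the shift from a to b by less than h, so only starting points in
    \<open>{a<..a + h}\<close> may miss the target interval; they are discarded.\<close>
  define n where "n = nat \<lfloor>(b - a) / h\<rfloor>"
  define T where "T = {x. x \<in> J \<and> x \<in> A \<and> x + real n * h \<in> {b<..<b + l} \<inter> B}"
  have [measurable]: "Sw \<in> sets borel" "R \<in> sets borel" "J \<in> sets borel"
    unfolding Sw_def R_def J_def by measurable
  then have [measurable]: "Z \<in> sets borel" unfolding Z_def by measurable
  have [measurable]: "T \<in> sets borel" unfolding T_def by measurable
  have n: "real n * h \<le> b - a" "b - a < real n * h + h"
  proof -
    have "real n = of_int \<lfloor>(b - a) / h\<rfloor>" using h pq by (simp add: n_def)
    then have "real n \<le> (b - a) / h" "(b - a) / h < real n + 1" by linarith+
    then show "real n * h \<le> b - a" "b - a < real n * h + h" using h by (simp_all add: field_simps)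
  qed
  have "J \<subseteq> T \<union> (J - A) \<union> {x. x + real n * h \<in> {b<..<b + l} - B} \<union> {a<..a + h}"
    using n by (auto simp: T_def J_def)
  then have "emeasure lborel J \<le> emeasure lborel (T \<union> (J - A) \<union> {x. x + real n * h \<in> {b<..<b + l} - B} \<union> {a<..a + h})"
    by (intro emeasure_mono) auto
  also have "\<dots> \<le> emeasure lborel T + emeasure lborel (J - A)
      + emeasure lborel {x. x + real n * h \<in> {b<..<b + l} - B} + emeasure lborel {a<..a + h}"
    by (intro order_trans[OF emeasure_subadditive] add_mono order_refl) auto
  also have "emeasure lborel {x. x + real n * h \<in> {b<..<b + l} - B} = emeasure lborel ({b<..<b + l} - B)"
    by (rule emeasure_lborel_preimage_add) simp
  also have "emeasure lborel T \<le> ennreal (l / h + 1) * emeasure lborel Z"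
  proof -
    \<comment> \<open>The redundant form of \<open>x \<in> J\<close> expresses the condition through
      y = x + k * h alone. Translating to y then turns the sum over k into a count of the k for
      which y - k * h is in \<open>J\<close>.\<close>
    have "T \<subseteq> (\<Union>k<n. {x. x + real k * h \<in> Z \<and> x + real k * h - real k * h \<in> J})"
    proof
      fix x assume x: "x \<in> T"
      then have "\<exists>k<n. x + real k * h \<in> Z"
        unfolding Z_def Sw_def R_def
        using disj h pq by (intro switch_along_chain) (auto simp: T_def J_def)
      then show "x \<in> (\<Union>k<n. {x. x + real k * h \<in> Z \<and> x + real k * h - real k * h \<in> J})"
        using x by (auto simp: T_def)
    qed
    then have "emeasure lborel T \<le> (\<Sum>k<n. emeasure lborel {x. x + real k * h \<in> Z \<and> x + real k * h - real k * h \<in> J})"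
      by (intro order_trans[OF emeasure_mono emeasure_subadditive_finite]) auto
    also have "\<dots> = (\<Sum>k<n. emeasure lborel {y. y \<in> Z \<and> y - real k * h \<in> J})"
      by (intro sum.cong refl emeasure_lborel_translation_real[where P = "\<lambda>y. y \<in> Z \<and> y - real k * h \<in> J" for k]) measurable
    also have "\<dots> = (\<Sum>k<n. \<integral>\<^sup>+y. indicator {y. y \<in> Z \<and> y - real k * h \<in> J} y \<partial>lborel)"
      by (intro sum.cong refl nn_integral_indicator[symmetric]) measurable
    also have "\<dots> = (\<integral>\<^sup>+y. (\<Sum>k<n. indicator {y. y \<in> Z \<and> y - real k * h \<in> J} y) \<partial>lborel)"
      by (rule nn_integral_sum[symmetric]) measurable
    also have "\<dots> \<le> (\<integral>\<^sup>+y. ennreal (l / h + 1) * indicator Z y \<partial>lborel)"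
    proof (rule nn_integral_mono)
      fix y :: real
      show "(\<Sum>k<n. indicator {y. y \<in> Z \<and> y - real k * h \<in> J} y) \<le> ennreal (l / h + 1) * indicator Z y"
      proof (cases "y \<in> Z")
        case True
        have "(\<Sum>k<n. indicator {y. y \<in> Z \<and> y - real k * h \<in> J} y :: ennreal)
            = (\<Sum>k<n. if k \<in> {k. a < y - real k * h \<and> y - real k * h < a + l} then 1 else 0)"
          using True by (intro sum.cong) (auto simp: indicator_def J_def)
        also have "\<dots> = of_nat (card {k. k < n \<and> a < y - real k * h \<and> y - real k * h < a + l})"
          by (subst sum.If_cases) (auto simp: Int_def)
        also have "\<dots> \<le> ennreal (l / h + 1)"
          unfolding ennreal_of_nat_eq_real_of_nat
          using h l by (intro ennreal_leI card_progression_in_interval_le) auto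
        finally show ?thesis using True by simp
      qed simp
    qed
    also have "\<dots> = ennreal (l / h + 1) * emeasure lborel Z" by (rule nn_integral_cmult_indicator) simp
    finally show ?thesis .
  qed
  also have "emeasure lborel Z \<le> emeasure lborel Sw + emeasure lborel R"
    unfolding Z_def by (rule emeasure_subadditive) auto
  finally have "ennreal l \<le> ennreal (l / h + 1) * (emeasure lborel Sw + emeasure lborel R)
      + emeasure lborel (J - A) + emeasure lborel ({b<..<b + l} - B) + ennreal h"
    using l h by (simp add: J_def mult_left_mono)
  also have "\<dots> \<le> ennreal (l / h + 1) * (emeasure lborel Sw + emeasure lborel R)
      + ennreal (2 * \<tau> * l) + ennreal (2 * \<tau> * l) + ennreal h"
    unfolding J_def by (intro add_mono order_refl A B)
  finally have *: "ennreal l \<le> ennreal (l / h + 1) * (emeasure lborel Sw + emeasure lborel R)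
      + ennreal (2 * \<tau> * l) + ennreal (2 * \<tau> * l) + ennreal h" .
  show ?thesis
  proof (cases "emeasure lborel Sw + emeasure lborel R")
    case (real m)
    have nn: "0 \<le> l / h + 1" "0 \<le> 2 * \<tau> * l" "0 \<le> m" "0 \<le> h" using h l \<tau> real by auto
    have "ennreal l \<le> ennreal ((l / h + 1) * m + 2 * \<tau> * l + 2 * \<tau> * l + h)"
      using * unfolding real(2)
      by (simp only: nn ennreal_mult[symmetric] ennreal_plus[symmetric] add_nonneg_nonneg mult_nonneg_nonneg)
    moreover have "0 \<le> (l / h + 1) * m + 2 * \<tau> * l + 2 * \<tau> * l + h"
      by (intro add_nonneg_nonneg mult_nonneg_nonneg nn)
    \<comment> \<open>Origin of the 6: 2 for each density defect makes 4, the discarded piece of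
      length h \<le> \<tau> * l adds 1, and l + h \<le> (1 + \<tau>) * l adds 1 more through (1 -
      6\<tau>) * (1 + \<tau>) \<le> 1 - 5\<tau>.\<close>
    ultimately have "l \<le> (l / h + 1) * m + 4 * \<tau> * l + h"
      by (simp add: ennreal_le_iff)
    then have "(1 - 5 * \<tau>) * l \<le> (l / h + 1) * m" using h by (simp add: algebra_simps)
    then have "(1 - 5 * \<tau>) * l * h \<le> (l + h) * m" using h by (simp add: field_simps)
    also have "\<dots> \<le> (l + \<tau> * l) * m" using h real by (intro mult_right_mono) auto
    finally have "l * ((1 - 5 * \<tau>) * h) \<le> l * ((1 + \<tau>) * m)" by (simp add: algebra_simps)
    then have "(1 - 5 * \<tau>) * h \<le> (1 + \<tau>) * m" using l by simp
    moreover have "(1 - 6 * \<tau>) * (1 + \<tau>) * h \<le> (1 - 5 * \<tau>) * h"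
      using h by (intro mult_right_mono) (auto simp: algebra_simps)
    ultimately have "(1 + \<tau>) * ((1 - 6 * \<tau>) * h) \<le> (1 + \<tau>) * m" by (simp add: mult_ac)
    then have "(1 - 6 * \<tau>) * h \<le> m" using \<tau> by simp
    then show ?thesis unfolding Sw_def[symmetric] R_def[symmetric] real(2) by (rule ennreal_leI)
  next
    case top
    show ?thesis unfolding Sw_def[symmetric] R_def[symmetric] top by simp
  qed
qed

lemma switching_measure_ge:
  fixes a b l h \<tau> p q :: real
  assumes "A \<in> sets borel" "B \<in> sets borel" and disj: "A \<inter> B = {}"
    and h: "0 < h" "h \<le> \<tau> * l" and l: "0 < l" and \<tau>: "0 < \<tau>"
    and pq: "p \<le> a" "a + l \<le> q" "p \<le> b" "b + l \<le> q"
    and A: "emeasure lborel ({a<..<a + l} - A) \<le> ennreal (2 * \<tau> * l)"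
    and B: "emeasure lborel ({b<..<b + l} - B) \<le> ennreal (2 * \<tau> * l)"
  shows "ennreal ((1 - 6 * \<tau>) * h) \<le>
    emeasure lborel {x. p < x \<and> x + h < q \<and> (x \<in> A \<and> x + h \<in> B \<or> x \<in> B \<and> x + h \<in> A)}
    + emeasure lborel ({p<..<q} - A - B)"
proof (cases "a \<le> b")
  case True
  then show ?thesis using switching_measure_ge_of_le[of A B h \<tau> l p a b q] assms by auto
next
  case False
  have "B \<inter> A = {}" using disj by auto
  moreover have "{p<..<q} - B - A = {p<..<q} - A - B" by auto
  moreover have "{x. p < x \<and> x + h < q \<and> (x \<in> B \<and> x + h \<in> A \<or> x \<in> A \<and> x + h \<in> B)}
      = {x. p < x \<and> x + h < q \<and> (x \<in> A \<and> x + h \<in> B \<or> x \<in> B \<and> x + h \<in> A)}" by auto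
  ultimately show ?thesis using switching_measure_ge_of_le[of B A h \<tau> l p b a q] assms False by auto
qed

text \<open>An averaging argument. Take a compact \<open>K\<close> inside \<open>E\<close> and an
  open \<open>U\<close> around it with \<open>U - K\<close> of measure below \<tau> times that of
  \<open>K\<close>. If the interval of length l to the right of every x in \<open>K\<close> missed
  more than \<tau> * l of \<open>K\<close>, integrating over \<open>K\<close> and exchanging the
  integrals would contradict this, since a translate of \<open>K\<close> by less than l stays in
  \<open>U\<close>. Having every small l at hand makes it possible to choose a common length for
  both phases.\<close>

lemma ex_dense_intervals:
  fixes E :: "real set" and \<alpha> \<beta> \<tau> :: real
  assumes E: "E \<in> sets borel" "E \<subseteq> {\<alpha><..<\<beta>}" "emeasure lborel E \<noteq> 0" and \<tau>: "0 < \<tau>"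
  obtains r where "r > 0" "\<And>l. 0 < l \<Longrightarrow> l \<le> r \<Longrightarrow>
    \<exists>x. \<alpha> \<le> x \<and> x + l \<le> \<beta> \<and> emeasure lborel ({x<..<x + l} - E) \<le> ennreal (\<tau> * l)"
proof -
  have Efin: "emeasure lborel E < \<infinity>"
    using E(2) by (intro emeasure_bounded_finite bounded_subset[OF bounded_box[of \<alpha> \<beta>]]) auto
  define \<mu> where "\<mu> = measure lborel E"
  have \<mu>1: "emeasure lborel E = ennreal \<mu>"
    unfolding \<mu>_def using Efin by (intro emeasure_eq_ennreal_measure) auto
  have "\<mu> \<noteq> 0" "0 \<le> \<mu>" using E(3) unfolding \<mu>1 by (auto simp: \<mu>_def)
  with \<mu>1 have \<mu>: "emeasure lborel E = ennreal \<mu>" "\<mu> > 0" by auto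
  obtain K where K: "compact K" "K \<subseteq> E" "emeasure lborel K \<noteq> 0"
  proof -
    obtain T where T: "closed T" "T \<subseteq> E" "emeasure lebesgue (E - T) < ennreal \<mu>"
      using sets_lebesgue_inner_closed[of E \<mu>] E(1) \<mu>(2) by (metis sets_completionI_sets sets_lborel)
    have Tb: "T \<in> sets borel" using T(1) by simp
    have "bounded T" using T(2) E(2) by (intro bounded_subset[OF bounded_box[of \<alpha> \<beta>]]) auto
    then have "compact T" using T(1) by (simp add: compact_eq_bounded_closed)
    moreover have "emeasure lborel T \<noteq> 0"
    proof
      assume "emeasure lborel T = 0"
      then have "T \<in> null_sets lborel" using Tb by (simp add: null_sets_def)
      then have "emeasure lborel (E - T) = emeasure lborel E"
        using E(1) by (intro emeasure_Diff_null_set) auto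
      then show False using T(3) E(1) Tb \<mu>(1) by simp
    qed
    ultimately show ?thesis using T(2) that by blast
  qed
  have Kb [measurable]: "K \<in> sets borel" using K(1) by (simp add: compact_imp_closed)
  define \<kappa> where "\<kappa> = measure lborel K"
  have Kfin: "emeasure lborel K < \<infinity>" by (rule emeasure_bounded_finite[OF compact_imp_bounded[OF K(1)]])
  have \<kappa>1: "emeasure lborel K = ennreal \<kappa>"
    unfolding \<kappa>_def using Kfin by (intro emeasure_eq_ennreal_measure) auto
  have "\<kappa> \<noteq> 0" "0 \<le> \<kappa>" using K(3) unfolding \<kappa>1 by (auto simp: \<kappa>_def)
  with \<kappa>1 have \<kappa>: "emeasure lborel K = ennreal \<kappa>" "\<kappa> > 0" by auto
  obtain U0 where U0: "open U0" "K \<subseteq> U0" "emeasure lebesgue (U0 - K) < ennreal (\<tau> * \<kappa>)"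
    using sets_lebesgue_outer_open[of K "\<tau> * \<kappa>"] Kb \<tau> \<kappa>(2) by (metis mult_pos_pos sets_completionI_sets sets_lborel)
  \<comment> \<open>The intersection also keeps the selected intervals inside [\<alpha>, \<beta>],
    because their end points lie in \<open>U\<close>.\<close>
  define U where "U = U0 \<inter> {\<alpha><..<\<beta>}"
  have U: "open U" "K \<subseteq> U" using U0 K(2) E(2) by (auto simp: U_def)
  then have [measurable]: "U \<in> sets borel" by simp
  have "emeasure lborel (U - K) \<le> emeasure lebesgue (U0 - K)"
  proof -
    have "U0 - K \<in> sets borel" using U0(1) Kb by (intro sets.Diff) auto
    moreover from this have "emeasure lborel (U - K) \<le> emeasure lborel (U0 - K)"
      by (intro emeasure_mono) (auto simp: U_def)
    ultimately show ?thesis by simp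
  qed
  then have UK: "emeasure lborel (U - K) < ennreal (\<tau> * \<kappa>)" using U0(3) by (rule le_less_trans)
  obtain e where e: "e > 0" "\<And>x. x \<in> K \<Longrightarrow> ball x e \<subseteq> U"
    using compact_subset_open_imp_ball_epsilon_subset[OF K(1) U] by (metis UN_subset_iff)
  show ?thesis
  proof (rule that[of "e / 2"])
    fix l :: real assume l: "0 < l" "l \<le> e / 2"
    have inU: "x + t \<in> U" if "x \<in> K" "0 \<le> t" "t \<le> l" for x t
      using e(2)[OF that(1)] that l e(1) by (auto simp: dist_real_def subset_iff)
    have "\<exists>x\<in>K. emeasure lborel ({x<..<x + l} - K) \<le> ennreal (\<tau> * l)"
    proof (rule ccontr)
      assume "\<not> ?thesis"
      then have big: "ennreal (\<tau> * l) \<le> emeasure lborel ({x<..<x + l} - K)" if "x \<in> K" for x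
        using that by (auto simp: not_le intro: less_imp_le)
      let ?f = "\<lambda>x t. indicator K x * (indicator {0<..<l} t * indicator (- K) (x + t)) :: ennreal"
      have [measurable]: "(\<lambda>(x, t). ?f x t) \<in> borel_measurable (lborel \<Otimes>\<^sub>M lborel)"
        by measurable
      have "ennreal (\<tau> * l) * ennreal \<kappa> = (\<integral>\<^sup>+x. ennreal (\<tau> * l) * indicator K x \<partial>lborel)"
        by (simp add: nn_integral_cmult_indicator \<kappa>)
      also have "\<dots> \<le> (\<integral>\<^sup>+x. \<integral>\<^sup>+t. ?f x t \<partial>lborel \<partial>lborel)"
      proof (rule nn_integral_mono)
        fix x :: real
        show "ennreal (\<tau> * l) * indicator K x \<le> (\<integral>\<^sup>+t. ?f x t \<partial>lborel)"
        proof (cases "x \<in> K")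
          case True
          have "emeasure lborel {y. x < y \<and> y < x + l \<and> y \<notin> K}
              = emeasure lborel {t. x < t + x \<and> t + x < x + l \<and> t + x \<notin> K}"
            by (rule emeasure_lborel_translation_real[symmetric]) measurable
          also have "\<dots> = (\<integral>\<^sup>+t. indicator {t. x < t + x \<and> t + x < x + l \<and> t + x \<notin> K} t \<partial>lborel)"
            by (rule nn_integral_indicator[symmetric]) measurable
          also have "\<dots> = (\<integral>\<^sup>+t. ?f x t \<partial>lborel)"
            using True by (intro nn_integral_cong) (auto simp: indicator_def add.commute)
          also have "{y. x < y \<and> y < x + l \<and> y \<notin> K} = {x<..<x + l} - K" by auto
          finally show ?thesis using big[OF True] True by simp
        qed simp
      qed
      also have "\<dots> = (\<integral>\<^sup>+t. \<integral>\<^sup>+x. ?f x t \<partial>lborel \<partial>lborel)"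
        by (rule lborel_pair.Fubini'[symmetric]) measurable
      also have "\<dots> \<le> (\<integral>\<^sup>+t. emeasure lborel (U - K) * indicator {0<..<l} t \<partial>lborel)"
      proof (rule nn_integral_mono)
        fix t :: real
        show "(\<integral>\<^sup>+x. ?f x t \<partial>lborel) \<le> emeasure lborel (U - K) * indicator {0<..<l} t"
        proof (cases "0 < t \<and> t < l")
          case True
          have "(\<integral>\<^sup>+x. ?f x t \<partial>lborel) \<le> (\<integral>\<^sup>+x. indicator {x. x + t \<in> U - K} x \<partial>lborel)"
            using inU True by (intro nn_integral_mono) (auto simp: indicator_def)
          also have "\<dots> = emeasure lborel {x. x + t \<in> U - K}"
            by (rule nn_integral_indicator) measurable
          also have "\<dots> = emeasure lborel (U - K)"
            by (rule emeasure_lborel_preimage_add) simp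
          finally show ?thesis using True by simp
        qed (auto simp: indicator_def)
      qed
      also have "\<dots> = emeasure lborel (U - K) * ennreal l"
        using l by (simp add: nn_integral_cmult_indicator)
      also have "\<dots> < ennreal (\<tau> * \<kappa>) * ennreal l"
        using UK l by (intro ennreal_mult_strict_right_mono) auto
      finally show False using l \<tau> \<kappa>(2) by (simp add: mult_ac flip: ennreal_mult)
    qed
    then obtain x where x: "x \<in> K" "emeasure lborel ({x<..<x + l} - K) \<le> ennreal (\<tau> * l)" by blast
    have "emeasure lborel ({x<..<x + l} - E) \<le> emeasure lborel ({x<..<x + l} - K)"
      using K(2) by (intro emeasure_mono) auto
    moreover have "\<alpha> \<le> x" "x + l \<le> \<beta>" using inU[OF x(1), of 0] inU[OF x(1), of l] l by (auto simp: U_def)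
    ultimately show "\<exists>x. \<alpha> \<le> x \<and> x + l \<le> \<beta> \<and> emeasure lborel ({x<..<x + l} - E) \<le> ennreal (\<tau> * l)"
      using x(2) by (auto intro: order_trans)
  qed (use e in auto)
qed

text \<open>Both x and x + h are confined to the window (p, q). Hence disjoint windows give disjoint
  sets and the contributions of different switches add up. Only thresholds are used, so values of
  \<open>v\<close> beyond the wells need no truncation.\<close>

definition opposite_phases :: "(real \<Rightarrow> real) \<Rightarrow> real \<Rightarrow> real \<Rightarrow> real \<Rightarrow> real \<Rightarrow> real set" where
  "opposite_phases v \<delta> h p q = {x. p < x \<and> x + h < q \<and>
     (v x > 1 - \<delta> \<and> v (x + h) < - (1 - \<delta>) \<or> v x < - (1 - \<delta>) \<and> v (x + h) > 1 - \<delta>)}"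

definition intermediate_phase :: "(real \<Rightarrow> real) \<Rightarrow> real \<Rightarrow> real \<Rightarrow> real \<Rightarrow> real set" where
  "intermediate_phase v \<delta> p q = {x. p < x \<and> x < q \<and> \<bar>v x\<bar> \<le> 1 - \<delta>}"

lemma opposite_phases_borel [measurable]:
  assumes [measurable]: "v \<in> borel_measurable borel"
  shows "opposite_phases v \<delta> h p q \<in> sets borel"
  unfolding opposite_phases_def by measurable

lemma intermediate_phase_borel [measurable]:
  assumes [measurable]: "v \<in> borel_measurable borel"
  shows "intermediate_phase v \<delta> p q \<in> sets borel"
  unfolding intermediate_phase_def by measurable

text \<open>On opposite phases the difference is at least 2 * (1 - \<delta>), so the slice at h is
  at least \<open>4 * (1 - \<delta>)\<^sup>2 * c * h powr (- 2 * s)\<close>. Integrating over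
  [G, h0] gives a difference of scale weights, and the symmetry of the pair doubles the 4.\<close>

lemma gagliardo_sq_ge_opposite_phases:
  assumes [measurable]: "v \<in> borel_measurable borel" and \<delta>: "0 < \<delta>" "\<delta> < 1" and c: "0 \<le> c" and G: "0 < G" "G \<le> h0"
    and opp: "\<And>h. G \<le> h \<Longrightarrow> h \<le> h0 \<Longrightarrow> ennreal (c * h) \<le> emeasure lborel (opposite_phases v \<delta> h 0 1)"
  shows "ennreal (8 * (1 - \<delta>)\<^sup>2 * c * (scale_weight s G - scale_weight s h0)) \<le> gagliardo_sq s v"
proof -
  define g :: "real \<times> real \<Rightarrow> ennreal" where
    "g p = ennreal (\<bar>v (fst p) - v (snd p)\<bar>\<^sup>2 / \<bar>fst p - snd p\<bar> powr (1 + 2 * s))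
      * indicator ({0<..<1} \<times> {0<..<1}) p" for p
  have [measurable]: "g \<in> borel_measurable borel"
    unfolding g_def borel_prod[symmetric] by measurable
  have sym: "g (x, y) = g (y, x)" for x y :: real
    by (simp add: g_def abs_minus_commute indicator_def conj_commute)
  have slice: "ennreal (4 * (1 - \<delta>)\<^sup>2 * c) * ennreal (h powr (- 2 * s)) \<le> (\<integral>\<^sup>+x. g (x, x + h) \<partial>lborel)"
    if h: "G \<le> h" "h \<le> h0" for h
  proof -
    have h0: "0 < h" using h G by simp
    have "4 * (1 - \<delta>)\<^sup>2 * c * h powr (- 2 * s) = (2 * (1 - \<delta>))\<^sup>2 / h powr (1 + 2 * s) * (c * h)"
    proof -
      have "h / h powr (1 + 2 * s) = h powr 1 / h powr (1 + 2 * s)" using h0 by simp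
      also have "\<dots> = h powr (- 2 * s)" unfolding powr_diff[symmetric] by simp
      finally have "h powr (- 2 * s) = h / h powr (1 + 2 * s)" ..
      then show ?thesis unfolding power_mult_distrib by simp
    qed
    then have "ennreal (4 * (1 - \<delta>)\<^sup>2 * c) * ennreal (h powr (- 2 * s))
        = ennreal ((2 * (1 - \<delta>))\<^sup>2 / h powr (1 + 2 * s)) * ennreal (c * h)"
      using c h0 by (simp flip: ennreal_mult)
    also have "\<dots> \<le> ennreal ((2 * (1 - \<delta>))\<^sup>2 / h powr (1 + 2 * s)) * emeasure lborel (opposite_phases v \<delta> h 0 1)"
      by (intro mult_left_mono opp h) auto
    also have "\<dots> = (\<integral>\<^sup>+x. ennreal ((2 * (1 - \<delta>))\<^sup>2 / h powr (1 + 2 * s)) * indicator (opposite_phases v \<delta> h 0 1) x \<partial>lborel)"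
      by (rule nn_integral_cmult_indicator[symmetric]) simp
    also have "\<dots> \<le> (\<integral>\<^sup>+x. g (x, x + h) \<partial>lborel)"
    proof (rule nn_integral_mono)
      fix x :: real
      show "ennreal ((2 * (1 - \<delta>))\<^sup>2 / h powr (1 + 2 * s)) * indicator (opposite_phases v \<delta> h 0 1) x \<le> g (x, x + h)"
      proof (cases "x \<in> opposite_phases v \<delta> h 0 1")
        case True
        then have "2 * (1 - \<delta>) \<le> \<bar>v x - v (x + h)\<bar>" by (auto simp: opposite_phases_def)
        then have "(2 * (1 - \<delta>))\<^sup>2 \<le> \<bar>v x - v (x + h)\<bar>\<^sup>2" using \<delta> by (intro power_mono) auto
        then have "(2 * (1 - \<delta>))\<^sup>2 / h powr (1 + 2 * s) \<le> \<bar>v x - v (x + h)\<bar>\<^sup>2 / h powr (1 + 2 * s)"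
          by (intro divide_right_mono) auto
        moreover have "x \<in> {0<..<1}" "x + h \<in> {0<..<1}" using True h0 by (auto simp: opposite_phases_def)
        ultimately show ?thesis using True h0 by (simp add: g_def ennreal_leI)
      qed simp
    qed
    finally show ?thesis .
  qed
  have "ennreal (8 * (1 - \<delta>)\<^sup>2 * c * (scale_weight s G - scale_weight s h0))
      = 2 * (ennreal (4 * (1 - \<delta>)\<^sup>2 * c) * ennreal (scale_weight s G - scale_weight s h0))"
  proof -
    have "ennreal (8 * (1 - \<delta>)\<^sup>2 * c * (scale_weight s G - scale_weight s h0))
      = ennreal (2 * (4 * (1 - \<delta>)\<^sup>2 * c * (scale_weight s G - scale_weight s h0)))" by (simp add: mult.assoc)
    then show ?thesis
      using c scale_weight_antimono[OF G, of s] by (simp add: ennreal_mult mult.assoc)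
  qed
  also have "ennreal (scale_weight s G - scale_weight s h0) = (\<integral>\<^sup>+h\<in>{G..h0}. ennreal (h powr (- 2 * s)) \<partial>lborel)"
    by (rule nn_integral_powr_interval[OF G, symmetric])
  also have "ennreal (4 * (1 - \<delta>)\<^sup>2 * c) * \<dots>
      = (\<integral>\<^sup>+h. ennreal (4 * (1 - \<delta>)\<^sup>2 * c) * (ennreal (h powr (- 2 * s)) * indicator {G..h0} h) \<partial>lborel)"
    by (rule nn_integral_cmult[symmetric]) simp
  also have "\<dots> \<le> (\<integral>\<^sup>+h\<in>{0<..}. (\<integral>\<^sup>+x. g (x, x + h) \<partial>lborel) \<partial>lborel)"
    using slice G by (intro nn_integral_mono) (auto simp: indicator_def)
  also have "2 * \<dots> = (\<integral>\<^sup>+p. g p \<partial>lebesgue)"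
    by (rule nn_integral_symmetric_slices[symmetric]) (simp_all add: sym)
  also have "\<dots> = gagliardo_sq s v" by (simp add: gagliardo_sq_def g_def)
  finally show ?thesis by (simp add: mult_left_mono)
qed

text \<open>Markov's inequality for \<open>W\<close> composed with \<open>v\<close>.\<close>

lemma potential_energy_ge:
  assumes [measurable]: "E \<in> sets borel" and E: "E \<subseteq> {0<..<1}" "\<And>x. x \<in> E \<Longrightarrow> \<omega> \<le> W (v x)"
  shows "ennreal \<omega> * emeasure lborel E \<le> potential_energy W v"
proof -
  have "ennreal \<omega> * emeasure lborel E = (\<integral>\<^sup>+x. ennreal \<omega> * indicator E x \<partial>lborel)"
    by (rule nn_integral_cmult_indicator[symmetric]) simp
  also have "\<dots> \<le> (\<integral>\<^sup>+x. ennreal (W (v x)) * indicator {0<..<1} x \<partial>lborel)"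
    using E by (intro nn_integral_mono) (auto simp: indicator_def intro: ennreal_leI)
  also have "\<dots> = potential_energy W v"
    by (simp add: potential_energy_def nn_integral_restrict_space nn_integral_completion)
  finally show ?thesis .
qed

text \<open>A dichotomy. If the intermediate phase has measure at most \<tau> * G, then for h \<ge>
  G it is absorbed at the price of one more \<tau> (here n \<ge> 1 enters), and the seminorm gives
  the second entry of the minimum. Otherwise the potential alone pays: \<open>G\<close> is chosen so
  that \<omega> * \<tau> * G times the coefficient \<open>\<eta> powr (- 2 * s) / k\<close> is
  exactly 8 * n.\<close>

lemma scaled_energy_ge:
  fixes n :: nat
  assumes v [measurable]: "v \<in> borel_measurable borel" and \<delta>: "0 < \<delta>" "\<delta> < 1" and \<tau>: "0 < \<tau>" "\<tau> \<le> 1/7"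
    and \<omega>: "0 < \<omega>" "\<And>z. \<bar>z\<bar> \<le> 1 - \<delta> \<Longrightarrow> \<omega> \<le> W z" and n: "1 \<le> n" and \<eta>: "0 < \<eta>"
    and k: "k = scale_weight s \<eta>" "0 < k"
    and G: "G = 8 * real n / (\<omega> * \<tau>) * (k * \<eta> powr (2 * s))" "G \<le> h0"
    and sw: "\<And>h. 0 < h \<Longrightarrow> h \<le> h0 \<Longrightarrow> ennreal (real n * ((1 - 6 * \<tau>) * h))
      \<le> emeasure lborel (opposite_phases v \<delta> h 0 1) + emeasure lborel (intermediate_phase v \<delta> 0 1)"
  shows "ennreal (min (8 * real n)
      (8 * real n * (1 - \<delta>)\<^sup>2 * (1 - 7 * \<tau>) * ((scale_weight s G - scale_weight s h0) / k))) \<le> scaled_energy W s \<eta> v"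
proof -
  have G0: "0 < G" using G \<omega> \<tau> n k \<eta> by simp
  show ?thesis
  proof (cases "emeasure lborel (intermediate_phase v \<delta> 0 1) \<le> ennreal (\<tau> * G)")
    case True
    define c where "c = real n * (1 - 7 * \<tau>)"
    have c: "0 \<le> c" using \<tau> by (simp add: c_def)
    have "ennreal (c * h) \<le> emeasure lborel (opposite_phases v \<delta> h 0 1)" if h: "G \<le> h" "h \<le> h0" for h
    proof (cases "emeasure lborel (opposite_phases v \<delta> h 0 1)")
      case (real m)
      have h0: "0 < h" using h G0 by simp
      have "ennreal (real n * ((1 - 6 * \<tau>) * h)) \<le> ennreal m + ennreal (\<tau> * G)"
        using order_trans[OF sw[OF h0 h(2)] add_left_mono[OF True]] real by simp
      also have "\<dots> = ennreal (m + \<tau> * G)" using real \<tau> G0 by simp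
      finally have "real n * ((1 - 6 * \<tau>) * h) \<le> m + \<tau> * G"
        by (rule iffD1[OF ennreal_le_iff, rotated]) (use real \<tau> G0 in auto)
      moreover have "\<tau> * G \<le> real n * (\<tau> * h)"
      proof -
        have "\<tau> * G \<le> 1 * (\<tau> * h)" using h \<tau> by simp
        also have "\<dots> \<le> real n * (\<tau> * h)" using n \<tau> h0 by (intro mult_right_mono) auto
        finally show ?thesis .
      qed
      moreover have "c * h = real n * ((1 - 6 * \<tau>) * h) - real n * (\<tau> * h)" by (simp add: c_def algebra_simps)
      ultimately show ?thesis using real by (simp add: ennreal_leI)
    qed simp
    from gagliardo_sq_ge_opposite_phases[OF v \<delta> c G0 G(2) this]
    have "ennreal (1 / k) * ennreal (8 * (1 - \<delta>)\<^sup>2 * c * (scale_weight s G - scale_weight s h0))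
        \<le> ennreal (1 / k) * gagliardo_sq s v" by (intro mult_left_mono) auto
    also have "\<dots> \<le> scaled_energy W s \<eta> v" by (simp add: scaled_energy_def k)
    finally have "ennreal (1 / k) * ennreal (8 * (1 - \<delta>)\<^sup>2 * c * (scale_weight s G - scale_weight s h0))
      \<le> scaled_energy W s \<eta> v" .
    moreover have "0 \<le> 8 * (1 - \<delta>)\<^sup>2 * c * (scale_weight s G - scale_weight s h0)"
      using c scale_weight_antimono[OF G0 G(2), of s] by simp
    ultimately have "ennreal (1 / k * (8 * (1 - \<delta>)\<^sup>2 * c * (scale_weight s G - scale_weight s h0)))
      \<le> scaled_energy W s \<eta> v"
      using k(2) by (subst ennreal_mult) auto
    moreover have "1 / k * (8 * (1 - \<delta>)\<^sup>2 * c * (scale_weight s G - scale_weight s h0))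
        = 8 * real n * (1 - \<delta>)\<^sup>2 * (1 - 7 * \<tau>) * ((scale_weight s G - scale_weight s h0) / k)"
      by (simp add: c_def)
    ultimately show ?thesis by (metis ennreal_leI min.cobounded2 order_trans)
  next
    case False
    have "\<omega> * (\<tau> * G) * (\<eta> powr (- 2 * s) / k) = 8 * real n"
    proof -
      have "\<eta> powr (2 * s) * \<eta> powr (- 2 * s) = 1" using \<eta> by (simp flip: powr_add)
      moreover have "\<omega> * (\<tau> * G) = 8 * real n * k * \<eta> powr (2 * s)" using \<omega> \<tau> by (simp add: G)
      ultimately show ?thesis using k(2) by (simp add: mult.assoc)
    qed
    then have "ennreal (8 * real n) = ennreal (\<eta> powr (- 2 * s) / k) * (ennreal \<omega> * ennreal (\<tau> * G))"
      using \<omega> \<tau> G0 k(2) by (simp add: mult_ac flip: ennreal_mult)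
    also have "\<dots> \<le> ennreal (\<eta> powr (- 2 * s) / k) * (ennreal \<omega> * emeasure lborel (intermediate_phase v \<delta> 0 1))"
      using False by (intro mult_left_mono) auto
    also have "\<dots> \<le> ennreal (\<eta> powr (- 2 * s) / k) * potential_energy W v"
      using \<omega>(2) by (intro mult_left_mono potential_energy_ge) (auto simp: intermediate_phase_def)
    also have "\<dots> \<le> scaled_energy W s \<eta> v" by (simp add: scaled_energy_def k)
    finally show ?thesis by (metis ennreal_leI min.cobounded1 order_trans)
  qed
qed

section \<open>Switches forced by convergence in measure\<close>

context
  fixes v :: "nat \<Rightarrow> real \<Rightarrow> real" and u :: "real \<Rightarrow> real"
  assumes v [measurable]: "\<And>j. v j \<in> borel_measurable borel" and u [measurable]: "u \<in> borel_measurable borel"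
    and conv: "\<And>\<delta>. \<delta> > 0 \<Longrightarrow> (\<lambda>j. emeasure lborel {x. 0 < x \<and> x < 1 \<and> \<delta> < \<bar>v j x - u x\<bar>}) \<longlonglongrightarrow> 0"
begin

text \<open>Around t both level sets of \<open>u\<close> have positive measure in the window, so
  each has density at least 1 - \<tau> in some interval of a common length l. Convergence in measure
  costs another \<tau> * l, whence the 2 * \<tau> * l of \<open>switching_measure_ge\<close>. The
  range h \<le> \<tau> * l depends on \<open>u\<close> but not on j.\<close>

lemma opposite_phases_near_switch:
  assumes pm: "AE x in lborel. 0 < x \<and> x < 1 \<longrightarrow> u x \<in> {-1, 1}" and t: "t \<in> ess_switch_set u"
    and pq: "0 \<le> p" "p < t" "t < q" "q \<le> 1" and \<delta>: "0 < \<delta>" "\<delta> < 1" and \<tau>: "0 < \<tau>"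
  shows "\<exists>h0>0. \<forall>\<^sub>F j in sequentially. \<forall>h. 0 < h \<and> h \<le> h0 \<longrightarrow> ennreal ((1 - 6 * \<tau>) * h)
    \<le> emeasure lborel (opposite_phases (v j) \<delta> h p q) + emeasure lborel (intermediate_phase (v j) \<delta> p q)"
proof -
  define E where "E c = {x. p < x \<and> x < q \<and> u x = c}" for c
  have Eb [measurable]: "E c \<in> sets borel" for c unfolding E_def by measurable
  have Epos: "emeasure lborel (E c) \<noteq> 0" if "c \<in> {-1, 1}" for c
  proof
    assume "emeasure lborel (E c) = 0"
    then have "E c \<in> null_sets lborel" by (simp add: null_sets_def)
    then have "AE x in lborel. x \<notin> E c" by (rule AE_not_in)
    with pm have "AE x in lborel. x \<in> {p<..<q} \<longrightarrow> u x = - c"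
      by eventually_elim (use that pq in \<open>auto simp: E_def\<close>)
    moreover have "\<not> (AE x in lborel. x \<in> {p<..<q} \<longrightarrow> u x = - c)"
      by (rule ess_switch_setD[OF t pq(2,3)]) (use that in auto)
    ultimately show False by contradiction
  qed
  have Esub: "E c \<subseteq> {p<..<q}" for c by (auto simp: E_def)
  obtain r1 where r1: "r1 > 0" "\<And>l. 0 < l \<Longrightarrow> l \<le> r1 \<Longrightarrow>
      \<exists>x. p \<le> x \<and> x + l \<le> q \<and> emeasure lborel ({x<..<x + l} - E 1) \<le> ennreal (\<tau> * l)"
    using ex_dense_intervals[OF Eb Esub Epos \<tau>, of 1] by auto
  obtain r2 where r2: "r2 > 0" "\<And>l. 0 < l \<Longrightarrow> l \<le> r2 \<Longrightarrow>
      \<exists>x. p \<le> x \<and> x + l \<le> q \<and> emeasure lborel ({x<..<x + l} - E (- 1)) \<le> ennreal (\<tau> * l)"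
    using ex_dense_intervals[OF Eb Esub Epos \<tau>, of "- 1"] by auto
  define l where "l = min r1 r2"
  have l: "0 < l" using r1(1) r2(1) by (simp add: l_def)
  obtain a where a: "p \<le> a" "a + l \<le> q" "emeasure lborel ({a<..<a + l} - E 1) \<le> ennreal (\<tau> * l)"
    using r1(2)[OF l] by (auto simp: l_def)
  obtain b where b: "p \<le> b" "b + l \<le> q" "emeasure lborel ({b<..<b + l} - E (- 1)) \<le> ennreal (\<tau> * l)"
    using r2(2)[OF l] by (auto simp: l_def)
  let ?D = "\<lambda>j. {x. 0 < x \<and> x < 1 \<and> \<delta> / 2 < \<bar>v j x - u x\<bar>}"
  have "\<forall>\<^sub>F j in sequentially. emeasure lborel (?D j) < ennreal (\<tau> * l)"
    using order_tendstoD(2)[OF conv[of "\<delta> / 2"], of "ennreal (\<tau> * l)"] \<delta> \<tau> l by simp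
  then have "\<forall>\<^sub>F j in sequentially. \<forall>h. 0 < h \<and> h \<le> \<tau> * l \<longrightarrow> ennreal ((1 - 6 * \<tau>) * h)
    \<le> emeasure lborel (opposite_phases (v j) \<delta> h p q) + emeasure lborel (intermediate_phase (v j) \<delta> p q)"
  proof eventually_elim
    case (elim j)
    define A where "A = {x. v j x > 1 - \<delta>}"
    define B where "B = {x. v j x < - (1 - \<delta>)}"
    have AB [measurable]: "A \<in> sets borel" "B \<in> sets borel" unfolding A_def B_def by measurable
    have Db: "?D j \<in> sets borel" by measurable
    have dens: "emeasure lborel ({c<..<c + l} - S) \<le> ennreal (2 * \<tau> * l)"
      if c: "p \<le> c" "c + l \<le> q" "emeasure lborel ({c<..<c + l} - E e) \<le> ennreal (\<tau> * l)"
        and S: "S \<in> sets borel" "\<And>x. \<lbrakk>p < x; x < q; u x = e; \<bar>v j x - u x\<bar> \<le> \<delta> / 2\<rbrakk> \<Longrightarrow> x \<in> S" for c e S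
    proof -
      have "{c<..<c + l} - S \<subseteq> ({c<..<c + l} - E e) \<union> ?D j"
      proof
        fix x assume x: "x \<in> {c<..<c + l} - S"
        then have "p < x" "x < q" "0 < x" "x < 1" using c(1,2) pq by auto
        then show "x \<in> ({c<..<c + l} - E e) \<union> ?D j" using x S(2)[of x]
          by (cases "\<bar>v j x - u x\<bar> \<le> \<delta> / 2") (auto simp: E_def not_le)
      qed
      then have "emeasure lborel ({c<..<c + l} - S) \<le> emeasure lborel (({c<..<c + l} - E e) \<union> ?D j)"
        using Db by (intro emeasure_mono) auto
      also have "\<dots> \<le> emeasure lborel ({c<..<c + l} - E e) + emeasure lborel (?D j)"
        using Db by (intro emeasure_subadditive) auto
      also have "\<dots> \<le> ennreal (\<tau> * l) + ennreal (\<tau> * l)" using c(3) elim by (intro add_mono) auto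
      also have "\<dots> = ennreal (2 * \<tau> * l)" using \<tau> l by (simp flip: ennreal_plus)
      finally show ?thesis .
    qed
    have dA: "emeasure lborel ({a<..<a + l} - A) \<le> ennreal (2 * \<tau> * l)"
      by (rule dens[OF a AB(1)]) (use \<delta> in \<open>auto simp: A_def abs_if split: if_splits\<close>)
    have dB: "emeasure lborel ({b<..<b + l} - B) \<le> ennreal (2 * \<tau> * l)"
      by (rule dens[OF b AB(2)]) (use \<delta> in \<open>auto simp: B_def abs_if split: if_splits\<close>)
    have disj: "A \<inter> B = {}" using \<delta> by (auto simp: A_def B_def)
    show ?case
    proof (intro allI impI)
      fix h assume h: "0 < h \<and> h \<le> \<tau> * l"
      have "ennreal ((1 - 6 * \<tau>) * h) \<le>
        emeasure lborel {x. p < x \<and> x + h < q \<and> (x \<in> A \<and> x + h \<in> B \<or> x \<in> B \<and> x + h \<in> A)}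
        + emeasure lborel ({p<..<q} - A - B)"
        using h by (intro switching_measure_ge[OF AB disj _ _ l \<tau> a(1,2) b(1,2) dA dB]) auto
      also have "{x. p < x \<and> x + h < q \<and> (x \<in> A \<and> x + h \<in> B \<or> x \<in> B \<and> x + h \<in> A)} = opposite_phases (v j) \<delta> h p q"
        by (auto simp: opposite_phases_def A_def B_def)
      also have "{p<..<q} - A - B = intermediate_phase (v j) \<delta> p q"
        by (auto simp: intermediate_phase_def A_def B_def)
      finally show "ennreal ((1 - 6 * \<tau>) * h)
        \<le> emeasure lborel (opposite_phases (v j) \<delta> h p q) + emeasure lborel (intermediate_phase (v j) \<delta> p q)" .
    qed
  qed
  then show ?thesis using \<tau> l by (intro exI[of _ "\<tau> * l"]) auto
qed

text \<open>Induction with the largest switching point added last: a cut y separates it from the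
  others, and the windows (0, y) and (y, z) contribute disjoint sets. The bound \<tau> \<le> 1/6
  keeps each summand nonnegative, so that \<open>ennreal\<close> respects the sum.\<close>

lemma opposite_phases_near_switches:
  assumes pm: "AE x in lborel. 0 < x \<and> x < 1 \<longrightarrow> u x \<in> {-1, 1}"
    and \<delta>: "0 < \<delta>" "\<delta> < 1" and \<tau>: "0 < \<tau>" "\<tau> \<le> 1/6" and T: "finite T" "T \<subseteq> ess_switch_set u"
  shows "\<exists>h0>0. \<forall>\<^sub>F j in sequentially. \<forall>h. 0 < h \<and> h \<le> h0 \<longrightarrow> ennreal (real (card T) * ((1 - 6 * \<tau>) * h))
    \<le> emeasure lborel (opposite_phases (v j) \<delta> h 0 1) + emeasure lborel (intermediate_phase (v j) \<delta> 0 1)"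
proof -
  have "0 < z \<Longrightarrow> z \<le> 1 \<Longrightarrow> \<forall>t\<in>T. t < z \<Longrightarrow>
    \<exists>h0>0. \<forall>\<^sub>F j in sequentially. \<forall>h. 0 < h \<and> h \<le> h0 \<longrightarrow> ennreal (real (card T) * ((1 - 6 * \<tau>) * h))
    \<le> emeasure lborel (opposite_phases (v j) \<delta> h 0 z) + emeasure lborel (intermediate_phase (v j) \<delta> 0 z)" for z
    using T
  proof (induction T arbitrary: z rule: finite_linorder_max_induct)
    case empty
    show ?case by (intro exI[of _ 1]) auto
  next
    case (insert b A z)
    have b: "b \<in> ess_switch_set u" "0 < b" using insert.prems by (auto simp: ess_switch_set_def)
    obtain y where y: "0 < y" "y < b" "\<forall>t\<in>A. t < y"
      using ex_between_finite[OF insert.hyps(1) _ b(2)] insert.hyps by blast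
    have bz: "b < z" "z \<le> 1" using insert.prems by auto
    have y1: "y \<le> 1" using y bz by simp
    have sub: "A \<subseteq> ess_switch_set u" using insert.prems by simp
    obtain h1 where h1: "h1 > 0" and e1: "\<forall>\<^sub>F j in sequentially. \<forall>h. 0 < h \<and> h \<le> h1 \<longrightarrow>
        ennreal (real (card A) * ((1 - 6 * \<tau>) * h))
        \<le> emeasure lborel (opposite_phases (v j) \<delta> h 0 y) + emeasure lborel (intermediate_phase (v j) \<delta> 0 y)"
      using insert.IH[OF y(1) y1 y(3) sub] by (elim exE conjE)
    obtain h2 where h2: "h2 > 0" and e2: "\<forall>\<^sub>F j in sequentially. \<forall>h. 0 < h \<and> h \<le> h2 \<longrightarrow>
        ennreal ((1 - 6 * \<tau>) * h)
        \<le> emeasure lborel (opposite_phases (v j) \<delta> h y z) + emeasure lborel (intermediate_phase (v j) \<delta> y z)"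
      using opposite_phases_near_switch[OF pm b(1) less_imp_le[OF y(1)] y(2) bz \<delta> \<tau>(1)] by (elim exE conjE)
    from e1 e2 have "\<forall>\<^sub>F j in sequentially. \<forall>h. 0 < h \<and> h \<le> min h1 h2 \<longrightarrow>
        ennreal (real (card (insert b A)) * ((1 - 6 * \<tau>) * h))
        \<le> emeasure lborel (opposite_phases (v j) \<delta> h 0 z) + emeasure lborel (intermediate_phase (v j) \<delta> 0 z)"
    proof eventually_elim
      case (elim j)
      show ?case
      proof (intro allI impI)
        fix h assume h: "0 < h \<and> h \<le> min h1 h2"
        have "b \<notin> A" using insert.hyps by auto
        then have "real (card (insert b A)) * ((1 - 6 * \<tau>) * h)
            = real (card A) * ((1 - 6 * \<tau>) * h) + (1 - 6 * \<tau>) * h"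
          using insert.hyps by (simp add: distrib_right)
        moreover have nn: "0 \<le> (1 - 6 * \<tau>) * h" using h \<tau> by simp
        ultimately have "ennreal (real (card (insert b A)) * ((1 - 6 * \<tau>) * h))
            = ennreal (real (card A) * ((1 - 6 * \<tau>) * h)) + ennreal ((1 - 6 * \<tau>) * h)"
          by (simp only: ennreal_plus[OF mult_nonneg_nonneg[OF of_nat_0_le_iff nn] nn])
        also have "\<dots> \<le> (emeasure lborel (opposite_phases (v j) \<delta> h 0 y) + emeasure lborel (intermediate_phase (v j) \<delta> 0 y))
            + (emeasure lborel (opposite_phases (v j) \<delta> h y z) + emeasure lborel (intermediate_phase (v j) \<delta> y z))"
          using elim h by (intro add_mono) auto
        also have "\<dots> = (emeasure lborel (opposite_phases (v j) \<delta> h 0 y) + emeasure lborel (opposite_phases (v j) \<delta> h y z))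
            + (emeasure lborel (intermediate_phase (v j) \<delta> 0 y) + emeasure lborel (intermediate_phase (v j) \<delta> y z))"
          by (simp add: ac_simps)
        also have "emeasure lborel (opposite_phases (v j) \<delta> h 0 y) + emeasure lborel (opposite_phases (v j) \<delta> h y z)
            = emeasure lborel (opposite_phases (v j) \<delta> h 0 y \<union> opposite_phases (v j) \<delta> h y z)"
          using h by (intro plus_emeasure) (auto simp: opposite_phases_def)
        also have "\<dots> \<le> emeasure lborel (opposite_phases (v j) \<delta> h 0 z)"
          using y bz by (intro emeasure_mono) (auto simp: opposite_phases_def)
        also have "emeasure lborel (intermediate_phase (v j) \<delta> 0 y) + emeasure lborel (intermediate_phase (v j) \<delta> y z)
            = emeasure lborel (intermediate_phase (v j) \<delta> 0 y \<union> intermediate_phase (v j) \<delta> y z)"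
          by (intro plus_emeasure) (auto simp: intermediate_phase_def)
        also have "\<dots> \<le> emeasure lborel (intermediate_phase (v j) \<delta> 0 z)"
          using y bz by (intro emeasure_mono) (auto simp: intermediate_phase_def)
        finally show "ennreal (real (card (insert b A)) * ((1 - 6 * \<tau>) * h))
            \<le> emeasure lborel (opposite_phases (v j) \<delta> h 0 z) + emeasure lborel (intermediate_phase (v j) \<delta> 0 z)"
          by (simp add: add_mono)
      qed
    qed
    then show ?case using h1 h2 by (intro exI[of _ "min h1 h2"]) auto
  qed
  from this[of 1] show ?thesis using T by (auto simp: ess_switch_set_def)
qed

end

subsection \<open>The lower bound\<close>

lemma continuous_pos_lower_bound:
  fixes W :: "real \<Rightarrow> real"
  assumes "continuous_on UNIV W" "compact K" "\<And>z. z \<in> K \<Longrightarrow> 0 < W z"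
  obtains \<omega> where "0 < \<omega>" "\<And>z. z \<in> K \<Longrightarrow> \<omega> \<le> W z"
proof (cases "K = {}")
  case True
  then show ?thesis using that[of 1] by simp
next
  case False
  obtain z0 where "z0 \<in> K" "\<forall>z\<in>K. W z0 \<le> W z"
    using continuous_attains_inf[OF assms(2) False continuous_on_subset[OF assms(1)]] by auto
  then show ?thesis using that[of "W z0"] assms(3) by auto
qed

lemma intrinsic_potential_weight_at_top:
  fixes \<eta> s :: "nat \<Rightarrow> real"
  assumes \<eta>: "filterlim \<eta> (at_right 0) sequentially" and s: "s \<longlonglongrightarrow> 1/2"
  shows "filterlim (\<lambda>j. \<eta> j powr (- 2 * s j) / scale_weight (s j) (\<eta> j)) at_top sequentially"
proof -
  have K: "\<forall>\<^sub>F j in sequentially. 1 \<le> scale_weight (s j) (\<eta> j)"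
    using scale_weight_at_top[OF \<eta> s] by (simp add: filterlim_at_top)
  have "\<forall>\<^sub>F j in sequentially. 0 < scale_weight (s j) (\<eta> j) * \<eta> j powr (2 * s j)"
    using K eventually_scale[OF \<eta> s] by eventually_elim simp
  from filterlim_inverse_at_top[OF scale_weight_times_powr_tendsto_0[OF \<eta> s] this]
  show ?thesis
    by (simp add: divide_inverse powr_minus mult.commute)
qed

context
  fixes v :: "nat \<Rightarrow> real \<Rightarrow> real" and u :: "real \<Rightarrow> real" and \<eta> s :: "nat \<Rightarrow> real" and W :: "real \<Rightarrow> real"
  assumes v [measurable]: "\<And>j. v j \<in> borel_measurable borel" and u [measurable]: "u \<in> borel_measurable borel"
    and conv: "\<And>\<delta>. \<delta> > 0 \<Longrightarrow> (\<lambda>j. emeasure lborel {x. 0 < x \<and> x < 1 \<and> \<delta> < \<bar>v j x - u x\<bar>}) \<longlonglongrightarrow> 0"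
    and \<eta>: "filterlim \<eta> (at_right 0) sequentially" and s: "s \<longlonglongrightarrow> 1/2"
    and W: "continuous_on UNIV W" "\<And>z. 0 \<le> W z" "\<And>z. W z = 0 \<longleftrightarrow> z = 1 \<or> z = - 1"
begin

text \<open>On a set of positive measure \<open>u\<close> is bounded and bounded away from both
  wells. By convergence in measure, \<open>v j\<close> stays in a fixed compact set off the wells on
  at least half of it, where \<open>W\<close> has a positive minimum; the coefficient of the
  potential tends to infinity.\<close>

lemma liminf_scaled_energy_infinite:
  assumes npm: "\<not> (AE x in lborel. 0 < x \<and> x < 1 \<longrightarrow> u x \<in> {-1, 1})"
  shows "liminf (\<lambda>j. scaled_energy W (s j) (\<eta> j) (v j)) = \<infinity>"
proof -
  \<comment> \<open>The distance to the wells is twice the later \<delta> = 1 / (m + 1), so a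
    perturbation by at most \<delta> leaves distance \<delta>. The bound on
    \<open>\<bar>u x\<bar>\<close> makes the set of perturbed values bounded.\<close>
  define E where "E m = {x. 0 < x \<and> x < 1 \<and> 2 / real (Suc m) < \<bar>\<bar>u x\<bar> - 1\<bar> \<and> \<bar>u x\<bar> \<le> real m}" for m
  have Eb [measurable]: "E m \<in> sets borel" for m unfolding E_def by measurable
  have "\<exists>m. emeasure lborel (E m) \<noteq> 0"
  proof (rule ccontr)
    assume "\<not> ?thesis"
    then have "E m \<in> null_sets lborel" for m by (auto simp: null_sets_def)
    then have "AE x in lborel. \<forall>m. x \<notin> E m" by (simp add: AE_all_countable AE_not_in)
    then have "AE x in lborel. 0 < x \<and> x < 1 \<longrightarrow> u x \<in> {-1, 1}"
    proof eventually_elim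
      case (elim x)
      show ?case
      proof (rule impI, rule ccontr)
        assume x: "0 < x \<and> x < 1" "u x \<notin> {-1, 1}"
        then have "0 < \<bar>\<bar>u x\<bar> - 1\<bar>" by auto
        then obtain m1 where m1: "2 / \<bar>\<bar>u x\<bar> - 1\<bar> < real m1" using reals_Archimedean2 by blast
        obtain m2 where m2: "\<bar>u x\<bar> < real m2" using reals_Archimedean2 by blast
        define m where "m = max m1 m2"
        have "2 / \<bar>\<bar>u x\<bar> - 1\<bar> < real (Suc m)" using m1 by (simp add: m_def)
        then have "2 / real (Suc m) < \<bar>\<bar>u x\<bar> - 1\<bar>"
          using \<open>0 < \<bar>\<bar>u x\<bar> - 1\<bar>\<close> by (simp add: field_simps)
        moreover have "\<bar>u x\<bar> \<le> real m" using m2 by (simp add: m_def)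
        ultimately show False using elim x(1) by (auto simp: E_def)
      qed
    qed
    with npm show False by contradiction
  qed
  then obtain m where m: "emeasure lborel (E m) \<noteq> 0" by blast
  define \<delta> where "\<delta> = 1 / real (Suc m)"
  have \<delta>: "0 < \<delta>" "\<delta> \<le> 1" by (simp_all add: \<delta>_def)
  define K where "K = {z. \<bar>z\<bar> \<le> real m + 1 \<and> \<delta> \<le> \<bar>\<bar>z\<bar> - 1\<bar>}"
  have "closed K" unfolding K_def by (intro closed_Collect_conj closed_Collect_le continuous_intros)
  moreover have "bounded K" by (rule bounded_subset[OF bounded_cball[of 0 "real m + 1"]]) (auto simp: K_def)
  ultimately have K: "compact K" by (simp add: compact_eq_bounded_closed)
  have "0 < W z" if "z \<in> K" for z
  proof -
    have "z \<noteq> 1" "z \<noteq> - 1" using that \<delta> by (auto simp: K_def)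
    then show ?thesis using W(2)[of z] W(3)[of z] by simp
  qed
  then obtain \<omega> where \<omega>: "0 < \<omega>" "\<And>z. z \<in> K \<Longrightarrow> \<omega> \<le> W z"
    using continuous_pos_lower_bound[OF W(1) K] by metis
  have Efin: "emeasure lborel (E m) < \<infinity>"
    by (rule emeasure_bounded_finite, rule bounded_subset[OF bounded_box[of 0 1]]) (auto simp: E_def)
  define c where "c = measure lborel (E m)"
  have c1: "emeasure lborel (E m) = ennreal c"
    unfolding c_def using Efin by (intro emeasure_eq_ennreal_measure) auto
  have "c \<noteq> 0" "0 \<le> c" using m unfolding c1 by (auto simp: c_def)
  then have c: "0 < c" by simp
  let ?D = "\<lambda>j. {x. 0 < x \<and> x < 1 \<and> \<delta> < \<bar>v j x - u x\<bar>}"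
  have D: "\<forall>\<^sub>F j in sequentially. emeasure lborel (?D j) < ennreal (c / 2)"
    using order_tendstoD(2)[OF conv[OF \<delta>(1)], of "ennreal (c / 2)"] c by simp
  have large: "ennreal b \<le> liminf (\<lambda>j. scaled_energy W (s j) (\<eta> j) (v j))" if "0 \<le> b" for b
  proof (rule Liminf_bounded)
    have "\<forall>\<^sub>F j in sequentially. b / (\<omega> * (c / 2)) \<le> \<eta> j powr (- 2 * s j) / scale_weight (s j) (\<eta> j)"
      using intrinsic_potential_weight_at_top[OF \<eta> s] unfolding filterlim_at_top by blast
    with D show "\<forall>\<^sub>F j in sequentially. ennreal b \<le> scaled_energy W (s j) (\<eta> j) (v j)"
    proof eventually_elim
      case (elim j)
      define k where "k = \<eta> j powr (- 2 * s j) / scale_weight (s j) (\<eta> j)"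
      have Db: "?D j \<in> sets borel" by measurable
      have "ennreal c \<le> emeasure lborel (E m - ?D j) + emeasure lborel (?D j)"
        unfolding c1[symmetric] using Db
        by (intro order_trans[OF emeasure_mono emeasure_subadditive]) auto
      also have "\<dots> \<le> emeasure lborel (E m - ?D j) + ennreal (c / 2)" using elim by (intro add_left_mono) auto
      finally have ED: "ennreal (c / 2) \<le> emeasure lborel (E m - ?D j)"
      proof (cases "emeasure lborel (E m - ?D j)")
        case (real r)
        assume "ennreal c \<le> emeasure lborel (E m - ?D j) + ennreal (c / 2)"
        then have "ennreal c \<le> ennreal (r + c / 2)" using real c by simp
        then have "c \<le> r + c / 2" by (rule iffD1[OF ennreal_le_iff, rotated]) (use real c in auto)
        then show ?thesis using real by (simp add: ennreal_leI)
      qed simp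
      have "b \<le> k * (\<omega> * (c / 2))" using elim(2) \<omega>(1) c unfolding k_def[symmetric]
        by (simp only: pos_divide_le_eq mult_pos_pos half_gt_zero)
      then have "ennreal b \<le> ennreal (k * (\<omega> * (c / 2)))" by (rule ennreal_leI)
      also have "\<dots> = ennreal k * (ennreal \<omega> * ennreal (c / 2))"
      proof -
        have "0 \<le> k" using elim that \<omega> c unfolding k_def[symmetric]
          by (meson divide_nonneg_pos half_gt_zero mult_pos_pos order_trans)
        then show ?thesis using \<omega> c by (simp flip: ennreal_mult)
      qed
      also have "\<dots> \<le> ennreal k * (ennreal \<omega> * emeasure lborel (E m - ?D j))"
        by (intro mult_left_mono ED) auto
      also have "\<dots> \<le> ennreal k * potential_energy W (v j)"
      proof (intro mult_left_mono potential_energy_ge)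
        fix x assume x: "x \<in> E m - ?D j"
        then have "\<bar>v j x - u x\<bar> \<le> \<delta>" "2 * \<delta> < \<bar>\<bar>u x\<bar> - 1\<bar>" "\<bar>u x\<bar> \<le> real m"
          by (auto simp: E_def \<delta>_def)
        then have "v j x \<in> K" using \<delta> unfolding K_def mem_Collect_eq by argo
        then show "\<omega> \<le> W (v j x)" by (rule \<omega>(2))
      qed (use Db in \<open>auto simp: E_def\<close>)
      also have "\<dots> \<le> scaled_energy W (s j) (\<eta> j) (v j)" by (simp add: scaled_energy_def k_def)
      finally show ?case .
    qed
  qed
  show ?thesis
  proof (rule ccontr)
    assume "liminf (\<lambda>j. scaled_energy W (s j) (\<eta> j) (v j)) \<noteq> \<infinity>"
    then obtain n where "liminf (\<lambda>j. scaled_energy W (s j) (\<eta> j) (v j)) < of_nat n"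
      using ennreal_Ex_less_of_nat by (auto simp: less_top)
    then show False using large[of "real n"] by (simp add: ennreal_of_nat_eq_real_of_nat not_less[symmetric])
  qed
qed

lemma liminf_scaled_energy_ge_factor:
  fixes \<delta> :: real
  assumes pm: "AE x in lborel. 0 < x \<and> x < 1 \<longrightarrow> u x \<in> {-1, 1}"
    and T: "finite T" "T \<subseteq> ess_switch_set u" "T \<noteq> {}" and \<delta>: "0 < \<delta>" "\<delta> < 1"
  shows "ennreal (8 * real (card T) * (1 - \<delta>) ^ 3) \<le> liminf (\<lambda>j. scaled_energy W (s j) (\<eta> j) (v j))"
proof -
  define n where "n = card T"
  have n: "1 \<le> n" using T by (simp add: n_def Suc_le_eq card_gt_0_iff)
  \<comment> \<open>Turns the loss 1 - 7 * \<tau> into a third factor 1 - \<delta>.\<close>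
  define \<tau> where "\<tau> = \<delta> / 7"
  have \<tau>: "0 < \<tau>" "\<tau> \<le> 1/7" "\<tau> \<le> 1/6" using \<delta> by (auto simp: \<tau>_def)
  have "0 < W z" if "z \<in> {- (1 - \<delta>)..1 - \<delta>}" for z
  proof -
    have "z \<noteq> 1" "z \<noteq> - 1" using that \<delta> by auto
    then show ?thesis using W(2)[of z] W(3)[of z] by simp
  qed
  then obtain \<omega> where "0 < \<omega>" "\<And>z. z \<in> {- (1 - \<delta>)..1 - \<delta>} \<Longrightarrow> \<omega> \<le> W z"
    using continuous_pos_lower_bound[OF W(1) compact_Icc, of "- (1 - \<delta>)" "1 - \<delta>"] by metis
  then have \<omega>: "0 < \<omega>" "\<And>z. \<bar>z\<bar> \<le> 1 - \<delta> \<Longrightarrow> \<omega> \<le> W z" by (auto simp: abs_le_iff)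
  have "\<exists>h1>0. \<forall>\<^sub>F j in sequentially. \<forall>h. 0 < h \<and> h \<le> h1 \<longrightarrow>
      ennreal (real (card T) * ((1 - 6 * \<tau>) * h))
      \<le> emeasure lborel (opposite_phases (v j) \<delta> h 0 1) + emeasure lborel (intermediate_phase (v j) \<delta> 0 1)"
    by (rule opposite_phases_near_switches[OF v u _ pm \<delta> \<tau>(1,3) T(1,2)]) (rule conv)
  then obtain h1 where h1: "0 < h1" and ev1: "\<forall>\<^sub>F j in sequentially. \<forall>h. 0 < h \<and> h \<le> h1 \<longrightarrow>
      ennreal (real (card T) * ((1 - 6 * \<tau>) * h))
      \<le> emeasure lborel (opposite_phases (v j) \<delta> h 0 1) + emeasure lborel (intermediate_phase (v j) \<delta> 0 1)"
    by (elim exE conjE)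
  \<comment> \<open>The cap at 1 makes \<open>scale_weight (s j) h0\<close> nonnegative and lets it
    be estimated as a difference from its value 0 at 1.\<close>
  define h0 where "h0 = min h1 1"
  have h0: "0 < h0" "h0 \<le> 1" "h0 \<le> h1" using h1 by (auto simp: h0_def)
  define k where "k j = scale_weight (s j) (\<eta> j)" for j
  define C where "C = 8 * real n / (\<omega> * \<tau>)"
  have C: "0 < C" using n \<omega> \<tau> by (simp add: C_def)
  define G where "G j = C * (k j * \<eta> j powr (2 * s j))" for j
  have "(\<lambda>j. C * (k j * \<eta> j powr (2 * s j))) \<longlonglongrightarrow> C * 0"
    unfolding k_def by (intro tendsto_mult_left scale_weight_times_powr_tendsto_0[OF \<eta> s])
  then have G_lim: "G \<longlonglongrightarrow> 0" by (simp add: G_def[abs_def])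
  have evG: "\<forall>\<^sub>F j in sequentially. G j < h0" using order_tendstoD(2)[OF G_lim h0(1)] .
  have k_top: "filterlim k at_top sequentially" using scale_weight_at_top[OF \<eta> s] by (simp add: k_def[abs_def])
  have evk: "\<forall>\<^sub>F j in sequentially. 1 \<le> k j" using k_top by (simp add: filterlim_at_top)
  define B where "B j = 8 * real n * (1 - \<delta>)\<^sup>2 * (1 - 7 * \<tau>) * ((scale_weight (s j) (G j) - scale_weight (s j) h0) / k j)" for j
  have "\<forall>\<^sub>F j in sequentially. ennreal (min (8 * real n) (B j)) \<le> scaled_energy W (s j) (\<eta> j) (v j)"
    using ev1 evG evk eventually_scale[OF \<eta> s]
  proof eventually_elim
    case (elim j)
    show ?case unfolding B_def
      by (rule scaled_energy_ge[OF v \<delta> \<tau>(1,2) \<omega> n])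
        (use elim h0 in \<open>auto simp: k_def G_def C_def n_def\<close>)
  qed
  then have "liminf (\<lambda>j. ennreal (min (8 * real n) (B j))) \<le> liminf (\<lambda>j. scaled_energy W (s j) (\<eta> j) (v j))"
    by (rule Liminf_mono)
  moreover have "(\<lambda>j. ennreal (min (8 * real n) (B j))) \<longlonglongrightarrow> ennreal (8 * real n * (1 - \<delta>) ^ 3)"
  proof -
    have "(\<lambda>j. scale_weight (s j) (G j) / k j) \<longlonglongrightarrow> 1"
      unfolding G_def k_def by (rule scale_weight_cutoff[OF \<eta> s C])
    \<comment> \<open>For fixed h0 the weight of the scales above h0 is at most 2 / h0 uniformly in
      s \<in> [1/4, 3/4], hence negligible against \<open>k j\<close>.\<close>
    moreover have "(\<lambda>j. scale_weight (s j) h0 / k j) \<longlonglongrightarrow> 0"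
    proof (rule tendsto_sandwich)
      show "\<forall>\<^sub>F j in sequentially. 0 \<le> scale_weight (s j) h0 / k j"
        using evk
      proof eventually_elim
        case (elim j)
        then show ?case using scale_weight_antimono[OF h0(1,2), of "s j"] by simp
      qed
      show "\<forall>\<^sub>F j in sequentially. scale_weight (s j) h0 / k j \<le> (2 / h0) / k j"
        using evk eventually_scale[OF \<eta> s]
      proof eventually_elim
        case (elim j)
        have "1/4 \<le> s j" "s j \<le> 3/4" using elim by argo+
        have "scale_weight (s j) h0 \<le> 2 * h0 powr (1 - 2 * s j) * sqrt (1 / h0)"
          using scale_weight_diff_le[OF \<open>1/4 \<le> s j\<close> h0(1,2)] by simp
        also have "\<dots> \<le> 2 * h0 powr (- 1/2) * sqrt (1 / h0)"
          using h0 \<open>s j \<le> 3/4\<close> by (intro mult_right_mono mult_left_mono powr_mono') auto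
        also have "\<dots> = 2 / h0"
        proof -
          have "h0 powr (- 1/2) = 1 / sqrt h0"
            using h0 powr_minus_divide[of h0 "1/2"] by (simp add: powr_half_sqrt)
          then show ?thesis using h0 by (simp add: real_sqrt_divide)
        qed
        finally show ?case using elim by (intro divide_right_mono) auto
      qed
      show "(\<lambda>j. (2 / h0) / k j) \<longlonglongrightarrow> 0"
        by (rule tendsto_divide_0[OF tendsto_const filterlim_at_top_imp_at_infinity[OF k_top]])
    qed simp
    ultimately have "B \<longlonglongrightarrow> 8 * real n * (1 - \<delta>)\<^sup>2 * (1 - 7 * \<tau>) * (1 - 0)"
      unfolding B_def[abs_def] diff_divide_distrib by (intro tendsto_mult tendsto_diff tendsto_const)
    then have "(\<lambda>j. min (8 * real n) (B j)) \<longlonglongrightarrow> min (8 * real n) (8 * real n * (1 - \<delta>)\<^sup>2 * (1 - 7 * \<tau>) * (1 - 0))"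
      by (intro tendsto_min tendsto_const)
    also have "8 * real n * (1 - \<delta>)\<^sup>2 * (1 - 7 * \<tau>) * (1 - 0) = 8 * real n * (1 - \<delta>) ^ 3"
      by (simp add: \<tau>_def power2_eq_square power3_eq_cube)
    also have "min (8 * real n) (8 * real n * (1 - \<delta>) ^ 3) = 8 * real n * (1 - \<delta>) ^ 3"
      using \<delta> by (intro min.absorb2 mult_left_le power_le_one) auto
    finally show ?thesis by (rule tendsto_ennrealI)
  qed
  then have "liminf (\<lambda>j. ennreal (min (8 * real n) (B j))) = ennreal (8 * real n * (1 - \<delta>) ^ 3)"
    by (simp add: lim_imp_Liminf)
  ultimately show ?thesis by (simp add: n_def)
qed

lemma liminf_scaled_energy_ge:
  assumes pm: "AE x in lborel. 0 < x \<and> x < 1 \<longrightarrow> u x \<in> {-1, 1}"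
    and T: "finite T" "T \<subseteq> ess_switch_set u"
  shows "ennreal (8 * real (card T)) \<le> liminf (\<lambda>j. scaled_energy W (s j) (\<eta> j) (v j))"
proof (cases "T = {}")
  case False
  \<comment> \<open>Here \<delta> is 1 / (i + 2); the double successor keeps it below 1 already at i
    = 0.\<close>
  have "(\<lambda>i. 8 * real (card T) * (1 - inverse (real (Suc (Suc i)))) ^ 3) \<longlonglongrightarrow> 8 * real (card T) * (1 - 0) ^ 3"
    by (intro tendsto_intros LIMSEQ_Suc[OF LIMSEQ_inverse_real_of_nat])
  from tendsto_ennrealI[OF this]
  have lim: "(\<lambda>i. ennreal (8 * real (card T) * (1 - inverse (real (Suc (Suc i)))) ^ 3)) \<longlonglongrightarrow> ennreal (8 * real (card T))"
    by simp
  have "ennreal (8 * real (card T) * (1 - inverse (real (Suc (Suc i)))) ^ 3)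
      \<le> liminf (\<lambda>j. scaled_energy W (s j) (\<eta> j) (v j))" for i
    by (rule liminf_scaled_energy_ge_factor[OF pm T False]) (auto simp: inverse_eq_divide)
  then show ?thesis by (intro LIMSEQ_le_const2[OF lim]) auto
qed simp

text \<open>The bound by finite subsets of the switch set covers functions outside
  \<open>BV_pm1\<close> as well: with infinitely many switching points, arbitrarily large finite
  subsets force the liminf to be infinite.\<close>

lemma jump_functional_le_liminf_scaled_energy:
  assumes um: "u \<in> meas_funs"
  shows "jump_functional 8 u \<le> liminf (\<lambda>j. scaled_energy W (s j) (\<eta> j) (v j))"
proof (cases "AE x in lborel. 0 < x \<and> x < 1 \<longrightarrow> u x \<in> {-1, 1}")
  case False
  then show ?thesis using liminf_scaled_energy_infinite by simp
next
  case True
  show ?thesis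
  proof (cases "finite (ess_switch_set u)")
    case fin: True
    have "u \<in> BV_pm1" using BV_pm1_iff[OF um] True fin by (simp add: AE_unit_leb_iff)
    then have "jump_functional 8 u = ennreal (8 * real (card (ess_switch_set u)))"
      using jump_set_eq_ess_switch_set[OF fin] fin
      by (simp add: jump_functional_def ennreal_of_nat_eq_real_of_nat ennreal_mult)
    then show ?thesis using liminf_scaled_energy_ge[OF True fin] by simp
  next
    case False
    have "of_nat n \<le> liminf (\<lambda>j. scaled_energy W (s j) (\<eta> j) (v j))" for n
    proof -
      obtain T where T: "finite T" "T \<subseteq> ess_switch_set u" "card T = n"
        using infinite_arbitrarily_large[OF False] by blast
      have "of_nat n = ennreal (real n)" by (simp add: ennreal_of_nat_eq_real_of_nat)
      also have "\<dots> \<le> ennreal (8 * real n)" by (rule ennreal_leI) simp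
      also have "\<dots> \<le> liminf (\<lambda>j. scaled_energy W (s j) (\<eta> j) (v j))"
        using liminf_scaled_energy_ge[OF True T(1,2)] T(3) by simp
      finally show ?thesis .
    qed
    then have "liminf (\<lambda>j. scaled_energy W (s j) (\<eta> j) (v j)) = \<infinity>"
      using ennreal_Ex_less_of_nat[of "liminf (\<lambda>j. scaled_energy W (s j) (\<eta> j) (v j))"]
      by (metis infinity_ennreal_def less_top not_less)
    then show ?thesis by simp
  qed
qed

end

section \<open>Independence of the representative, and the Gamma-limit\<close>

lemma jump_functional_eq_card:
  assumes "u \<in> meas_funs" "AE t in unit_leb. u t \<in> {-1, 1}" "finite (ess_switch_set u)"
  shows "jump_functional 8 u = ennreal (8 * real (card (ess_switch_set u)))"
  using assms BV_pm1_iff[OF assms(1,2)] jump_set_eq_ess_switch_set[OF assms(3)]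
  by (simp add: jump_functional_def ennreal_of_nat_eq_real_of_nat ennreal_mult)

lemma jump_functional_cong_AE:
  assumes "u \<in> meas_funs" "w \<in> meas_funs" and eq: "AE t in unit_leb. u t = w t"
  shows "jump_functional 8 u = jump_functional 8 w"
proof -
  have pm: "(AE t in unit_leb. u t \<in> {-1, 1}) \<longleftrightarrow> (AE t in unit_leb. w t \<in> {-1, 1})"
    by (rule eventually_cong[OF eq]) simp
  show ?thesis
  proof (cases "AE t in unit_leb. u t \<in> {-1, 1}")
    case True
    then show ?thesis
      using pm assms ess_switch_set_cong_AE[OF eq] BV_pm1_iff[of u] BV_pm1_iff[of w]
        jump_functional_eq_card[of u] jump_functional_eq_card[of w]
      by (cases "finite (ess_switch_set u)") (auto simp: jump_functional_def)
  next
    case False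
    then have "u \<notin> BV_pm1" "w \<notin> BV_pm1" using pm by (auto simp: BV_pm1_def)
    then show ?thesis by (simp add: jump_functional_def)
  qed
qed

theorem theorem3p1:
  fixes W :: "real \<Rightarrow> real" and s :: "real \<Rightarrow> real"
  assumes "double_well W"
    and "\<And>\<epsilon>. 0 < \<epsilon> \<Longrightarrow> \<epsilon> < 1 \<Longrightarrow> 0 < s \<epsilon> \<and> s \<epsilon> < 1"
    and "(s \<longlongrightarrow> 1/2) (at_right 0)"
  shows "Gamma_converges meas_funs (tendsto_in_measure unit_leb) (F_eps W s) (jump_functional 8)"
  unfolding Gamma_converges_def
proof (intro allI impI ballI conjI)
  fix \<epsilon> :: "nat \<Rightarrow> real" and u
  assume \<epsilon>: "filterlim \<epsilon> (at_right 0) sequentially" and u: "u \<in> meas_funs"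
  have W: "continuous_on UNIV W" "\<And>z. 0 \<le> W z" "\<And>z. W z = 0 \<longleftrightarrow> z = 1 \<or> z = - 1"
    using assms(1) by (auto simp: double_well_def)
  define \<sigma> \<eta> where "\<sigma> j = s (\<epsilon> j)" and "\<eta> j = intrinsic_scale (s (\<epsilon> j)) (\<epsilon> j)" for j
  have \<sigma>: "\<sigma> \<longlonglongrightarrow> 1/2" unfolding \<sigma>_def by (rule filterlim_compose[OF assms(3) \<epsilon>])
  have ev: "\<forall>\<^sub>F j in sequentially. 0 < \<epsilon> j \<and> \<epsilon> j < 1"
    by (rule eventually_in_unit_interval[OF \<epsilon>])
  then have "\<forall>\<^sub>F j in sequentially. 0 < s (\<epsilon> j)"
    by eventually_elim (use assms(2) in blast)
  from intrinsic_scale_tendsto_0[OF \<epsilon> this] have \<eta>: "filterlim \<eta> (at_right 0) sequentially"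
    by (simp add: \<eta>_def[abs_def])
  have F_eq: "\<forall>\<^sub>F j in sequentially. F_eps W s (\<epsilon> j) (U j) = scaled_energy W (\<sigma> j) (\<eta> j) (U j)" for U
    using ev
  proof eventually_elim
    case (elim j)
    then show ?case unfolding \<sigma>_def \<eta>_def using assms(2)[of "\<epsilon> j"] by (intro F_eps_eq_scaled_energy) auto
  qed
  {
    fix U assume U: "(\<forall>j. U j \<in> meas_funs) \<and> tendsto_in_measure unit_leb U u"
    \<comment> \<open>Pass to Borel representatives of the sequence and of the limit. The energies,
      the convergence and the limit functional depend only on the a.e. class, so the bound carries
      back.\<close>
    have "\<exists>w. w \<in> borel_measurable borel \<and> (AE t in unit_leb. U j t = w t)" for j
      using meas_funs_borel_representative[of "U j"] U by blast
    then obtain v where v: "\<And>j. v j \<in> borel_measurable borel" "\<And>j. AE t in unit_leb. U j t = v j t"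
      by metis
    obtain w where w: "w \<in> borel_measurable borel" "AE t in unit_leb. u t = w t"
      using meas_funs_borel_representative[OF u] by blast
    note [measurable] = v(1) w(1)
    have conv: "(\<lambda>j. emeasure lborel {x. 0 < x \<and> x < 1 \<and> \<delta> < \<bar>v j x - w x\<bar>}) \<longlonglongrightarrow> 0" if "\<delta> > 0" for \<delta>
    proof -
      have "emeasure lborel {x. 0 < x \<and> x < 1 \<and> \<delta> < \<bar>v j x - w x\<bar>}
          = emeasure unit_leb {x \<in> space unit_leb. \<bar>U j x - u x\<bar> > \<delta>}" for j
      proof -
        have [measurable]: "U j \<in> meas_funs" "u \<in> meas_funs" using U u by auto
        have B: "{x. 0 < x \<and> x < 1 \<and> \<delta> < \<bar>v j x - w x\<bar>} \<in> sets borel" by measurable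
        have sub: "{x. 0 < x \<and> x < 1 \<and> \<delta> < \<bar>v j x - w x\<bar>} \<subseteq> {0<..<1}" by auto
        have "emeasure lborel {x. 0 < x \<and> x < 1 \<and> \<delta> < \<bar>v j x - w x\<bar>}
            = emeasure unit_leb {x. 0 < x \<and> x < 1 \<and> \<delta> < \<bar>v j x - w x\<bar>}"
          using B sub by (simp add: emeasure_restrict_space)
        also have "\<dots> = emeasure unit_leb {x \<in> space unit_leb. \<bar>U j x - u x\<bar> > \<delta>}"
        proof (rule emeasure_eq_AE)
          show "AE x in unit_leb. x \<in> {x. 0 < x \<and> x < 1 \<and> \<delta> < \<bar>v j x - w x\<bar>} \<longleftrightarrow>
              x \<in> {x \<in> space unit_leb. \<bar>U j x - u x\<bar> > \<delta>}"
            using v(2)[of j] w(2) AE_space by eventually_elim auto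
          show "{x. 0 < x \<and> x < 1 \<and> \<delta> < \<bar>v j x - w x\<bar>} \<in> sets unit_leb"
            using B sub by (simp add: sets_restrict_space_iff)
        qed measurable
        finally show ?thesis .
      qed
      then show ?thesis using U that by (simp add: tendsto_in_measure_def)
    qed
    have wm: "w \<in> meas_funs" using w(1) by (intro measurable_restrict_space1 measurable_completion) simp
    have "jump_functional 8 u = jump_functional 8 w" by (rule jump_functional_cong_AE[OF u wm w(2)])
    also have "\<dots> \<le> liminf (\<lambda>j. scaled_energy W (\<sigma> j) (\<eta> j) (v j))"
      by (rule jump_functional_le_liminf_scaled_energy[OF v(1) w(1) _ \<eta> \<sigma> W wm]) (rule conv)
    also have "\<dots> = liminf (\<lambda>j. F_eps W s (\<epsilon> j) (U j))"
    proof (rule Liminf_eq)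
      have "scaled_energy W (\<sigma> j) (\<eta> j) (U j) = scaled_energy W (\<sigma> j) (\<eta> j) (v j)" for j
        using gagliardo_sq_cong_AE[OF v(2)] potential_energy_cong_AE[OF v(2)] by (simp add: scaled_energy_def)
      with F_eq[of U] show "\<forall>\<^sub>F j in sequentially. scaled_energy W (\<sigma> j) (\<eta> j) (v j) = F_eps W s (\<epsilon> j) (U j)"
        by (auto elim!: eventually_mono)
    qed
    finally show "jump_functional 8 u \<le> liminf (\<lambda>j. F_eps W s (\<epsilon> j) (U j))" .
  }
  show "\<exists>U. (\<forall>j. U j \<in> meas_funs) \<and> tendsto_in_measure unit_leb U u \<and>
      limsup (\<lambda>j. F_eps W s (\<epsilon> j) (U j)) \<le> jump_functional 8 u"
  proof (cases "u \<in> BV_pm1")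
    case False
    then show ?thesis
      using u by (intro exI[of _ "\<lambda>_. u"]) (auto simp: jump_functional_def tendsto_in_measure_def)
  next
    case True
    then have pm: "AE t in unit_leb. u t \<in> {-1, 1}" by (auto simp: BV_pm1_def)
    have fin: "finite (ess_switch_set u)" using True BV_pm1_iff[OF u pm] by simp
    have "limsup (\<lambda>j. F_eps W s (\<epsilon> j) (recovery_profile u (\<eta> j)))
        = limsup (\<lambda>j. scaled_energy W (\<sigma> j) (\<eta> j) (recovery_profile u (\<eta> j)))"
      by (rule Limsup_eq[OF F_eq])
    also have "\<dots> \<le> ennreal (8 * card (ess_switch_set u))"
      using W by (intro limsup_scaled_energy_recovery_profile[OF u fin \<eta> \<sigma> pm]) auto
    also have "\<dots> = jump_functional 8 u" using jump_functional_eq_card[OF u pm fin] by simp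
    finally show ?thesis
      using recovery_profile_measurable[OF u fin] recovery_profile_tendsto_in_measure[OF u fin \<eta>]
      by (intro exI[of _ "\<lambda>j. recovery_profile u (\<eta> j)"]) auto
  qed
qed

end
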